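(* Let $A$ be a unital separable C*-algebra, $H$ a separable Hilbert space, $G$ a group, and $\tau : G \to \mathrm{Aut}(A)$ an action of $G$ on $A$ by *-automorphisms. Let $\phi \in \mathrm{UCP}^G_A(H)$ and let $(X,\sigma,e)$ be the triple in the Paschke dilation of $\phi$, with associated representations $\tilde\sigma$ of $A$ and $\tilde W_\phi$ of $G$ on the self-dual Hilbert $B(H)$-module $X'$. Then the map $T \mapsto \phi_T$, where $\phi_T(a) = \langle T\tilde\sigma(a)\hat e,\hat e\rangle$ for $a\in A$, is an affine order isomorphism of $\{T \in (\tilde\sigma(A)\cup\tilde W_\phi(G))' : 0\le T\le 1_{X'}\}$ onto $[0,\phi]\cap \mathrm{CP}^G_A(H)$.
   Context: $\mathrm{UCP}^G_A(H)$ is the set of unital completely positive maps $\phi:A\to B(H)$ with $\phi(\tau_g(a))=\phi(a)$ for all $g\in G$, $a\in A$. $\mathrm{CP}^G_A(H)$ is the set of all completely positive maps $\theta:A\to B(H)$ with $\theta(\tau_g(a))=\theta(a)$ for all $g\in G$, $a\in A$. $[0,\phi]$ is the set of completely positive $\theta:A\to B(H)$ such that $\phi-\theta$ is completely positive; the partial order is $\theta_1\le\theta_2$ iff $\theta_2-\theta_1$ is completely positive. Paschke dilation (with $B=B(H)$): Hilbert $B$-modules are right $B$-modules, complete, with $B$-valued inner product linear in the first variable, $\langle x b,y\rangle=\langle x,y\rangle b$; $\mathcal{P}(X)$ is the C*-algebra of adjointable operators on $X$. The Paschke dilation of $\phi$ is $(X,\sigma,e)$ with $X$ a Hilbert $B$-module,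 $\sigma:A\to\mathcal{P}(X)$ a *-representation, $e\in X$, $\phi(a)=\langle\sigma(a)e,e\rangle$ for all $a\in A$ and $\mathrm{span}\{\sigma(a)(eb):a\in A,b\in B\}$ dense in $X$ (unique up to isomorphism). For $\phi$ $G$-invariant, $W_\phi:G\to\mathcal{P}(X)$ is the unitary representation with $W_\phi(g)e=e$ and $W_\phi(g)\sigma(a)W_\phi(g)^*=\sigma(\tau_g(a))$. $X'$ is the set of bounded $B$-module maps $X\to B$; for $x\in X$, $\hat x\in X'$ is $\hat x(y)=\langle y,x\rangle$. Since $B$ is a von Neumann algebra, the inner product of $X$ (embedded by $x\mapsto\hat x$) extends to $X'$, making it a self-dual Hilbert $B$-module with $\langle\hat x,\eta\rangle=\eta(x)$ for $x\in X$, $\eta\in X'$, and each $T\in\mathcal{P}(X)$ extends uniquely to $\tilde T\in\mathcal{P}(X')$, with $\tilde T\hat x=\widehat{Tx}$ (Paschke). Set $\tilde\sigma(a)=\widetilde{\sigma(a)}$, $\tilde W_\phi(g)=\widetilde{W_\phi(g)}$. The commutant $(\tilde\sigma(A)\cup\tilde W_\phi(G))'$ is taken in $\mathcal{P}(X')$. *)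

theory Defs
  imports
    "HOL-Analysis.Analysis"
    "HOL-Library.Nonpos_Ints"
    "HOL-Algebra.Group"
begin

section \<open>Complex normed spaces, Hilbert spaces, unital C*-algebras\<close>

class complex_normed_vector = real_normed_vector +
  fixes scaleC :: "complex \<Rightarrow> 'a \<Rightarrow> 'a" (infixr \<open>*\<^sub>C\<close> 75)
  assumes scaleC_add_right: "c *\<^sub>C (x + y) = c *\<^sub>C x + c *\<^sub>C y"
    and scaleC_add_left: "(c + d) *\<^sub>C x = c *\<^sub>C x + d *\<^sub>C x"
    and scaleC_scaleC: "c *\<^sub>C d *\<^sub>C x = (c * d) *\<^sub>C x"
    and scaleC_of_real: "complex_of_real r *\<^sub>C x = r *\<^sub>R x"
    and norm_scaleC: "norm (c *\<^sub>C x) = cmod c * norm x"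

text \<open>The inner product of a Hilbert space is linear in the first variable.\<close>

class complex_hilbert = complex_normed_vector + banach +
  fixes cinner :: "'a \<Rightarrow> 'a \<Rightarrow> complex"
  assumes cinner_add_left: "cinner (x + y) z = cinner x z + cinner y z"
    and cinner_scaleC_left: "cinner (c *\<^sub>C x) y = c * cinner x y"
    and cinner_commute: "cinner x y = cnj (cinner y x)"
    and cinner_self: "cinner x x = complex_of_real ((norm x)\<^sup>2)"

text \<open>The base class is \<^class>\<open>real_normed_algebra\<close> together with \<^class>\<open>monoid_mult\<close> rather than
  \<^class>\<open>real_normed_algebra_1\<close>, so that the zero algebra is not excluded.\<close>

class unital_cstar_algebra = complex_normed_vector + real_normed_algebra + monoid_mult + banach +
  fixes star :: "'a \<Rightarrow> 'a"
  assumes scaleC_mult_left: "(c *\<^sub>C x) * y = c *\<^sub>C (x * y)"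
    and scaleC_mult_right: "x * (c *\<^sub>C y) = c *\<^sub>C (x * y)"
    and star_star: "star (star x) = x"
    and star_add: "star (x + y) = star x + star y"
    and star_scaleC: "star (c *\<^sub>C x) = cnj c *\<^sub>C star x"
    and star_mult: "star (x * y) = star y * star x"
    and cstar_identity: "norm (star x * x) = (norm x)\<^sup>2"

definition complex_linear :: "('a::complex_normed_vector \<Rightarrow> 'b::complex_normed_vector) \<Rightarrow> bool"
  where "complex_linear f \<longleftrightarrow>
    (\<forall>x y. f (x + y) = f x + f y) \<and> (\<forall>c x. f (c *\<^sub>C x) = c *\<^sub>C f x)"

definition star_automorphism :: "('a::unital_cstar_algebra \<Rightarrow> 'a) \<Rightarrow> bool"
  where "star_automorphism f \<longleftrightarrow> bij f \<and> complex_linear f \<and>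
    (\<forall>x y. f (x * y) = f x * f y) \<and> (\<forall>x. f (star x) = star (f x))"

definition star_action ::
    "('g, 'm) monoid_scheme \<Rightarrow> ('g \<Rightarrow> 'a::unital_cstar_algebra \<Rightarrow> 'a) \<Rightarrow> bool"
  where "star_action G \<tau> \<longleftrightarrow>
    (\<forall>g\<in>carrier G. star_automorphism (\<tau> g)) \<and>
    (\<forall>g\<in>carrier G. \<forall>h\<in>carrier G. \<tau> (g \<otimes>\<^bsub>G\<^esub> h) = \<tau> g \<circ> \<tau> h)"


section \<open>The algebra of bounded operators on a Hilbert space\<close>

lemma scaleC_minus_right: "c *\<^sub>C (- x) = - (c *\<^sub>C (x::'a::complex_normed_vector))"
  by (metis add_eq_0_iff add.left_inverse scaleC_add_right add_cancel_right_right)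

lemma scaleC_zero_right [simp]: "c *\<^sub>C (0::'a::complex_normed_vector) = 0"
  by (metis scaleC_add_right add_cancel_right_right)

lemma scaleC_diff_right: "c *\<^sub>C (x - y) = c *\<^sub>C x - c *\<^sub>C (y::'a::complex_normed_vector)"
  by (metis scaleC_add_right scaleC_minus_right diff_conv_add_uminus)

lemma scaleC_scaleR_commute: "c *\<^sub>C r *\<^sub>R x = r *\<^sub>R c *\<^sub>C (x::'a::complex_normed_vector)"
  by (metis scaleC_of_real scaleC_scaleC mult.commute)

lemma bounded_linear_scaleC: "bounded_linear (\<lambda>x::'a::complex_normed_vector. c *\<^sub>C x)"
  by (rule bounded_linear_intro[where K = "cmod c"])
    (auto simp: scaleC_add_right scaleC_scaleR_commute norm_scaleC)

typedef (overloaded) 'h bop = "{T :: 'h::complex_hilbert \<Rightarrow>\<^sub>L 'h. \<forall>c x. T (c *\<^sub>C x) = c *\<^sub>C T x}"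
  morphisms blinfun_of_bop Bop
  by (rule exI[of _ 0]) simp

setup_lifting type_definition_bop

lift_definition bop_apply :: "'h::complex_hilbert bop \<Rightarrow> 'h \<Rightarrow> 'h" is blinfun_apply .

declare [[coercion "bop_apply :: 'h::complex_hilbert bop \<Rightarrow> 'h \<Rightarrow> 'h"]]

instantiation bop :: (complex_hilbert) complex_normed_vector
begin

lift_definition zero_bop :: "'a bop" is 0 by simp

lift_definition plus_bop :: "'a bop \<Rightarrow> 'a bop \<Rightarrow> 'a bop" is "(+)"
  by (simp add: blinfun.add_left scaleC_add_right)

lift_definition minus_bop :: "'a bop \<Rightarrow> 'a bop \<Rightarrow> 'a bop" is "(-)"
  by (simp add: blinfun.diff_left scaleC_diff_right)

lift_definition uminus_bop :: "'a bop \<Rightarrow> 'a bop" is uminus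
  by (simp add: blinfun.minus_left scaleC_minus_right)

lift_definition scaleR_bop :: "real \<Rightarrow> 'a bop \<Rightarrow> 'a bop" is scaleR
  by (simp add: blinfun.scaleR_left scaleC_scaleR_commute)

lift_definition scaleC_bop :: "complex \<Rightarrow> 'a bop \<Rightarrow> 'a bop"
  is "\<lambda>c T. Blinfun (\<lambda>x. c *\<^sub>C blinfun_apply T x)"
  by (subst (1 2) bounded_linear_Blinfun_apply)
    (auto intro!: bounded_linear_compose[OF bounded_linear_scaleC] bounded_linear_intros
      simp: scaleC_scaleC mult.commute)

lift_definition norm_bop :: "'a bop \<Rightarrow> real" is norm .

definition dist_bop :: "'a bop \<Rightarrow> 'a bop \<Rightarrow> real"
  where "dist_bop S T = norm (S - T)"

definition sgn_bop :: "'a bop \<Rightarrow> 'a bop"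
  where "sgn_bop T = scaleR (inverse (norm T)) T"

definition uniformity_bop :: "('a bop \<times> 'a bop) filter"
  where "uniformity_bop = (INF e\<in>{0<..}. principal {(S, T). dist S T < e})"

definition open_bop :: "'a bop set \<Rightarrow> bool"
  where "open_bop U = (\<forall>S\<in>U. \<forall>\<^sub>F (S', T) in uniformity. S' = S \<longrightarrow> T \<in> U)"

lemma scaleC_Blinfun_apply:
  "blinfun_apply (Blinfun (\<lambda>x. c *\<^sub>C blinfun_apply T x)) x = c *\<^sub>C blinfun_apply T x"
  for T :: "'b::complex_normed_vector \<Rightarrow>\<^sub>L 'b"
  by (subst bounded_linear_Blinfun_apply)
    (auto intro!: bounded_linear_compose[OF bounded_linear_scaleC] bounded_linear_intros)

lemma norm_scaleC_Blinfun:
  "norm (Blinfun (\<lambda>x. c *\<^sub>C blinfun_apply T x)) = cmod c * norm T"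
  for T :: "'b::complex_normed_vector \<Rightarrow>\<^sub>L 'b"
proof -
  have "norm (Blinfun (\<lambda>x. c *\<^sub>C blinfun_apply T x)) = norm (cmod c *\<^sub>R T)"
    by (simp add: norm_blinfun.rep_eq onorm_def scaleC_Blinfun_apply norm_scaleC blinfun.scaleR_left)
  then show ?thesis by simp
qed

instance
proof
  fix x y z :: "'a bop" and a b :: real and c d :: complex
  show "dist x y = norm (x - y)" by (fact dist_bop_def)
  show "sgn x = inverse (norm x) *\<^sub>R x" by (fact sgn_bop_def)
  show "uniformity = (INF e\<in>{0<..}. principal {(x, y::'a bop). dist x y < e})"
    by (fact uniformity_bop_def)
  show "open U = (\<forall>x\<in>U. \<forall>\<^sub>F (x', y) in uniformity. x' = x \<longrightarrow> y \<in> U)" for U :: "'a bop set"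
    by (fact open_bop_def)
  show "x + y + z = x + (y + z)" by transfer simp
  show "x + y = y + x" by transfer simp
  show "0 + x = x" by transfer simp
  show "- x + x = 0" by transfer simp
  show "x - y = x + - y" by transfer simp
  show "a *\<^sub>R (x + y) = a *\<^sub>R x + a *\<^sub>R y" by transfer (simp add: scaleR_add_right)
  show "(a + b) *\<^sub>R x = a *\<^sub>R x + b *\<^sub>R x" by transfer (simp add: scaleR_add_left)
  show "a *\<^sub>R b *\<^sub>R x = (a * b) *\<^sub>R x" by transfer simp
  show "1 *\<^sub>R x = x" by transfer simp
  show "norm x = 0 \<longleftrightarrow> x = 0" by transfer simp
  show "norm (x + y) \<le> norm x + norm y" by transfer (rule norm_triangle_ineq)
  show "norm (a *\<^sub>R x) = \<bar>a\<bar> * norm x" by transfer simp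
  show "c *\<^sub>C (x + y) = c *\<^sub>C x + c *\<^sub>C y"
    by transfer
      (rule blinfun_eqI, subst scaleC_Blinfun_apply,
        simp only: scaleC_Blinfun_apply blinfun.add_left scaleC_add_right)
  show "(c + d) *\<^sub>C x = c *\<^sub>C x + d *\<^sub>C x"
    by transfer
      (rule blinfun_eqI, subst scaleC_Blinfun_apply,
        simp only: scaleC_Blinfun_apply blinfun.add_left scaleC_add_left)
  show "c *\<^sub>C d *\<^sub>C x = (c * d) *\<^sub>C x"
    by transfer (rule blinfun_eqI, simp only: scaleC_Blinfun_apply scaleC_scaleC)
  show "complex_of_real a *\<^sub>C x = a *\<^sub>R x"
    by transfer (rule blinfun_eqI, subst scaleC_Blinfun_apply, simp only: scaleC_of_real blinfun.scaleR_left)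
  show "norm (c *\<^sub>C x) = cmod c * norm x"
    by transfer (rule norm_scaleC_Blinfun)
qed

end

instantiation bop :: (complex_hilbert) "{real_normed_algebra, monoid_mult}"
begin

lift_definition one_bop :: "'a bop" is id_blinfun by simp

lift_definition times_bop :: "'a bop \<Rightarrow> 'a bop \<Rightarrow> 'a bop" is blinfun_compose by simp

instance
proof
  fix x y z :: "'a bop" and a :: real
  show "x * y * z = x * (y * z)" by transfer (rule blinfun_eqI, simp)
  show "(x + y) * z = x * z + y * z"
    by transfer (rule blinfun_eqI, simp add: blinfun.add_left)
  show "x * (y + z) = x * y + x * z"
    by transfer (rule blinfun_eqI, simp add: blinfun.add_left blinfun.add_right)
  show "a *\<^sub>R x * y = a *\<^sub>R (x * y)"
    by transfer (rule blinfun_eqI, simp add: blinfun.scaleR_left)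
  show "x * a *\<^sub>R y = a *\<^sub>R (x * y)"
    by transfer (rule blinfun_eqI, simp add: blinfun.scaleR_left blinfun.scaleR_right)
  show "norm (x * y) \<le> norm x * norm y" by transfer (rule norm_blinfun_compose)
  show "1 * x = x" by transfer (rule blinfun_eqI, simp)
  show "x * 1 = x" by transfer (rule blinfun_eqI, simp)
qed

end

definition bop_adj :: "'h::complex_hilbert bop \<Rightarrow> 'h bop"
  where "bop_adj T = (THE S. \<forall>x y. cinner (bop_apply T x) y = cinner x (bop_apply S y))"

definition bop_positive :: "'h::complex_hilbert bop \<Rightarrow> bool"
  where "bop_positive T \<longleftrightarrow> (\<forall>x. cinner (T x) x \<in> \<real>\<^sub>\<ge>\<^sub>0)"


section \<open>Completely positive maps\<close>

text \<open>\<open>matrix_positive n m\<close>: the matrix \<open>(m i j)\<close>, \<open>i, j < n\<close>, is a positive element \<open>x\<^sup>* x\<close> of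
  the C*-algebra of \<open>n \<times> n\<close> matrices over \<open>A\<close>.  \<open>bop_matrix_positive n m\<close>: the operator matrix
  \<open>(m i j)\<close> is a positive operator on the direct sum of \<open>n\<close> copies of \<open>H\<close>.\<close>

definition matrix_positive :: "nat \<Rightarrow> (nat \<Rightarrow> nat \<Rightarrow> 'a::unital_cstar_algebra) \<Rightarrow> bool"
  where "matrix_positive n m \<longleftrightarrow>
    (\<exists>x :: nat \<Rightarrow> nat \<Rightarrow> 'a. \<forall>i<n. \<forall>j<n. m i j = (\<Sum>k<n. star (x k i) * x k j))"

definition bop_matrix_positive :: "nat \<Rightarrow> (nat \<Rightarrow> nat \<Rightarrow> 'h::complex_hilbert bop) \<Rightarrow> bool"
  where "bop_matrix_positive n m \<longleftrightarrow>
    (\<forall>h :: nat \<Rightarrow> 'h. (\<Sum>i<n. cinner (\<Sum>j<n. m i j (h j)) (h i)) \<in> \<real>\<^sub>\<ge>\<^sub>0)"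

definition completely_positive ::
    "('a::unital_cstar_algebra \<Rightarrow> 'h::complex_hilbert bop) \<Rightarrow> bool"
  where "completely_positive \<theta> \<longleftrightarrow> complex_linear \<theta> \<and>
    (\<forall>n m. matrix_positive n m \<longrightarrow> bop_matrix_positive n (\<lambda>i j. \<theta> (m i j)))"

definition cp_le ::
    "('a::unital_cstar_algebra \<Rightarrow> 'h::complex_hilbert bop) \<Rightarrow> ('a \<Rightarrow> 'h bop) \<Rightarrow> bool"
  where "cp_le \<theta>\<^sub>1 \<theta>\<^sub>2 \<longleftrightarrow> completely_positive (\<lambda>a. \<theta>\<^sub>2 a - \<theta>\<^sub>1 a)"

definition cp_interval ::
    "('a::unital_cstar_algebra \<Rightarrow> 'h::complex_hilbert bop) \<Rightarrow> ('a \<Rightarrow> 'h bop) set"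
  where "cp_interval \<phi> = {\<theta>. completely_positive \<theta> \<and> cp_le \<theta> \<phi>}"

definition CPG :: "('g, 'm) monoid_scheme \<Rightarrow> ('g \<Rightarrow> 'a::unital_cstar_algebra \<Rightarrow> 'a) \<Rightarrow>
    ('a \<Rightarrow> 'h::complex_hilbert bop) set"
  where "CPG G \<tau> = {\<theta>. completely_positive \<theta> \<and> (\<forall>g\<in>carrier G. \<forall>a. \<theta> (\<tau> g a) = \<theta> a)}"

definition UCPG :: "('g, 'm) monoid_scheme \<Rightarrow> ('g \<Rightarrow> 'a::unital_cstar_algebra \<Rightarrow> 'a) \<Rightarrow>
    ('a \<Rightarrow> 'h::complex_hilbert bop) set"
  where "UCPG G \<tau> = {\<phi> \<in> CPG G \<tau>. \<phi> 1 = 1}"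


section \<open>Hilbert modules over the bounded operators\<close>

text \<open>Hilbert modules are carrier-based records, since the dual module below is a set of functions
  whose operations differ from the pointwise ones.\<close>

record ('x, 'b) hmod = "'x partial_object" +
  hadd :: "'x \<Rightarrow> 'x \<Rightarrow> 'x"
  hzero :: 'x
  hscale :: "complex \<Rightarrow> 'x \<Rightarrow> 'x"
  hact :: "'x \<Rightarrow> 'b \<Rightarrow> 'x"
  hip :: "'x \<Rightarrow> 'x \<Rightarrow> 'b"

definition hdiff :: "('x, 'b) hmod \<Rightarrow> 'x \<Rightarrow> 'x \<Rightarrow> 'x"
  where "hdiff M x y = hadd M x (hscale M (-1) y)"

definition hnorm :: "('x, 'b::real_normed_vector) hmod \<Rightarrow> 'x \<Rightarrow> real"
  where "hnorm M x = sqrt (norm (hip M x x))"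

locale hilbert_module =
  fixes M :: "('x, 'h::complex_hilbert bop) hmod"
  assumes hadd_closed: "\<lbrakk>x \<in> carrier M; y \<in> carrier M\<rbrakk> \<Longrightarrow> hadd M x y \<in> carrier M"
    and hzero_closed: "hzero M \<in> carrier M"
    and hscale_closed: "x \<in> carrier M \<Longrightarrow> hscale M c x \<in> carrier M"
    and hact_closed: "x \<in> carrier M \<Longrightarrow> hact M x b \<in> carrier M"
    and hadd_assoc: "\<lbrakk>x \<in> carrier M; y \<in> carrier M; z \<in> carrier M\<rbrakk> \<Longrightarrow>
      hadd M (hadd M x y) z = hadd M x (hadd M y z)"
    and hadd_commute: "\<lbrakk>x \<in> carrier M; y \<in> carrier M\<rbrakk> \<Longrightarrow> hadd M x y = hadd M y x"
    and hadd_zero: "x \<in> carrier M \<Longrightarrow> hadd M (hzero M) x = x"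
    and hadd_inverse: "x \<in> carrier M \<Longrightarrow> hadd M x (hscale M (-1) x) = hzero M"
    and hscale_hadd: "\<lbrakk>x \<in> carrier M; y \<in> carrier M\<rbrakk> \<Longrightarrow>
      hscale M c (hadd M x y) = hadd M (hscale M c x) (hscale M c y)"
    and hscale_add: "x \<in> carrier M \<Longrightarrow>
      hscale M (c + d) x = hadd M (hscale M c x) (hscale M d x)"
    and hscale_hscale: "x \<in> carrier M \<Longrightarrow> hscale M c (hscale M d x) = hscale M (c * d) x"
    and hscale_one: "x \<in> carrier M \<Longrightarrow> hscale M 1 x = x"
    and hact_hadd: "\<lbrakk>x \<in> carrier M; y \<in> carrier M\<rbrakk> \<Longrightarrow>
      hact M (hadd M x y) b = hadd M (hact M x b) (hact M y b)"
    and hact_add: "x \<in> carrier M \<Longrightarrow> hact M x (b + b') = hadd M (hact M x b) (hact M x b')"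
    and hact_mult: "x \<in> carrier M \<Longrightarrow> hact M x (b * b') = hact M (hact M x b) b'"
    and hact_one: "x \<in> carrier M \<Longrightarrow> hact M x 1 = x"
    and hact_hscale: "x \<in> carrier M \<Longrightarrow> hact M (hscale M c x) b = hscale M c (hact M x b)"
    and hact_scaleC: "x \<in> carrier M \<Longrightarrow> hact M x (c *\<^sub>C b) = hscale M c (hact M x b)"
    and hip_hadd: "\<lbrakk>x \<in> carrier M; y \<in> carrier M; z \<in> carrier M\<rbrakk> \<Longrightarrow>
      hip M (hadd M x y) z = hip M x z + hip M y z"
    and hip_hscale: "\<lbrakk>x \<in> carrier M; y \<in> carrier M\<rbrakk> \<Longrightarrow>
      hip M (hscale M c x) y = c *\<^sub>C hip M x y"
    and hip_hact: "\<lbrakk>x \<in> carrier M; y \<in> carrier M\<rbrakk> \<Longrightarrow> hip M (hact M x b) y = hip M x y * b"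
    and hip_commute: "\<lbrakk>x \<in> carrier M; y \<in> carrier M\<rbrakk> \<Longrightarrow> hip M y x = bop_adj (hip M x y)"
    and hip_positive: "x \<in> carrier M \<Longrightarrow> bop_positive (hip M x x)"
    and hip_definite: "\<lbrakk>x \<in> carrier M; hip M x x = 0\<rbrakk> \<Longrightarrow> x = hzero M"
    and hcomplete: "\<lbrakk>\<And>n::nat. s n \<in> carrier M;
        \<And>\<epsilon>. \<epsilon> > 0 \<Longrightarrow> \<exists>N. \<forall>m\<ge>N. \<forall>n\<ge>N. hnorm M (hdiff M (s m) (s n)) < \<epsilon>\<rbrakk> \<Longrightarrow>
      \<exists>x\<in>carrier M. (\<lambda>n. hnorm M (hdiff M (s n) x)) \<longlonglongrightarrow> 0"

inductive_set hspan :: "('x, 'b) hmod \<Rightarrow> 'x set \<Rightarrow> 'x set"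
  for M :: "('x, 'b) hmod" and S :: "'x set"
  where
    "hzero M \<in> hspan M S"
  | "\<lbrakk>x \<in> S; y \<in> hspan M S\<rbrakk> \<Longrightarrow> hadd M (hscale M c x) y \<in> hspan M S"

definition hdense :: "('x, 'b::real_normed_vector) hmod \<Rightarrow> 'x set \<Rightarrow> bool"
  where "hdense M S \<longleftrightarrow> (\<forall>x\<in>carrier M. \<forall>\<epsilon>>0. \<exists>y\<in>S. hnorm M (hdiff M x y) < \<epsilon>)"


subsection \<open>Adjointable operators\<close>

text \<open>Operators on a module are functions that are \<^const>\<open>undefined\<close> off the carrier, so that equal
  operators are equal functions.\<close>

definition is_adjoint :: "('x, 'b) hmod \<Rightarrow> ('x \<Rightarrow> 'x) \<Rightarrow> ('x \<Rightarrow> 'x) \<Rightarrow> bool"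
  where "is_adjoint M T S \<longleftrightarrow> S \<in> carrier M \<rightarrow>\<^sub>E carrier M \<and>
    (\<forall>x\<in>carrier M. \<forall>y\<in>carrier M. hip M (T x) y = hip M x (S y))"

definition adjointable :: "('x, 'b) hmod \<Rightarrow> ('x \<Rightarrow> 'x) set"
  where "adjointable M = {T \<in> carrier M \<rightarrow>\<^sub>E carrier M. \<exists>S. is_adjoint M T S}"

definition hadj :: "('x, 'b) hmod \<Rightarrow> ('x \<Rightarrow> 'x) \<Rightarrow> 'x \<Rightarrow> 'x"
  where "hadj M T = (THE S. is_adjoint M T S)"

definition op_one :: "('x, 'b) hmod \<Rightarrow> 'x \<Rightarrow> 'x"
  where "op_one M = (\<lambda>x\<in>carrier M. x)"

definition op_zero :: "('x, 'b) hmod \<Rightarrow> 'x \<Rightarrow> 'x"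
  where "op_zero M = (\<lambda>x\<in>carrier M. hzero M)"

definition op_add :: "('x, 'b) hmod \<Rightarrow> ('x \<Rightarrow> 'x) \<Rightarrow> ('x \<Rightarrow> 'x) \<Rightarrow> 'x \<Rightarrow> 'x"
  where "op_add M S T = (\<lambda>x\<in>carrier M. hadd M (S x) (T x))"

definition op_scale :: "('x, 'b) hmod \<Rightarrow> complex \<Rightarrow> ('x \<Rightarrow> 'x) \<Rightarrow> 'x \<Rightarrow> 'x"
  where "op_scale M c T = (\<lambda>x\<in>carrier M. hscale M c (T x))"

definition op_mult :: "('x, 'b) hmod \<Rightarrow> ('x \<Rightarrow> 'x) \<Rightarrow> ('x \<Rightarrow> 'x) \<Rightarrow> 'x \<Rightarrow> 'x"
  where "op_mult M S T = compose (carrier M) S T"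

text \<open>Positivity and order are those of the C*-algebra of adjointable operators.\<close>

definition op_positive :: "('x, 'b) hmod \<Rightarrow> ('x \<Rightarrow> 'x) \<Rightarrow> bool"
  where "op_positive M T \<longleftrightarrow> (\<exists>S\<in>adjointable M. T = op_mult M (hadj M S) S)"

definition op_le :: "('x, 'b) hmod \<Rightarrow> ('x \<Rightarrow> 'x) \<Rightarrow> ('x \<Rightarrow> 'x) \<Rightarrow> bool"
  where "op_le M S T \<longleftrightarrow> op_positive M (op_add M T (op_scale M (-1) S))"

definition op_unitary :: "('x, 'b) hmod \<Rightarrow> ('x \<Rightarrow> 'x) \<Rightarrow> bool"
  where "op_unitary M U \<longleftrightarrow> U \<in> adjointable M \<and>
    op_mult M (hadj M U) U = op_one M \<and> op_mult M U (hadj M U) = op_one M"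

definition commutant :: "('x, 'b) hmod \<Rightarrow> ('x \<Rightarrow> 'x) set \<Rightarrow> ('x \<Rightarrow> 'x) set"
  where "commutant M \<S> = {T \<in> adjointable M. \<forall>S\<in>\<S>. op_mult M T S = op_mult M S T}"

definition star_representation ::
    "('x, 'b) hmod \<Rightarrow> ('a::unital_cstar_algebra \<Rightarrow> 'x \<Rightarrow> 'x) \<Rightarrow> bool"
  where "star_representation M \<sigma> \<longleftrightarrow>
    (\<forall>a. \<sigma> a \<in> adjointable M) \<and>
    (\<forall>a b. \<sigma> (a + b) = op_add M (\<sigma> a) (\<sigma> b)) \<and>
    (\<forall>c a. \<sigma> (c *\<^sub>C a) = op_scale M c (\<sigma> a)) \<and>
    (\<forall>a b. \<sigma> (a * b) = op_mult M (\<sigma> a) (\<sigma> b)) \<and>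
    (\<forall>a. \<sigma> (star a) = hadj M (\<sigma> a))"

definition unitary_representation ::
    "('g, 'm) monoid_scheme \<Rightarrow> ('x, 'b) hmod \<Rightarrow> ('g \<Rightarrow> 'x \<Rightarrow> 'x) \<Rightarrow> bool"
  where "unitary_representation G M W \<longleftrightarrow>
    (\<forall>g\<in>carrier G. op_unitary M (W g)) \<and>
    (\<forall>g\<in>carrier G. \<forall>h\<in>carrier G. W (g \<otimes>\<^bsub>G\<^esub> h) = op_mult M (W g) (W h))"


subsection \<open>The self-dual completion\<close>

definition dual_carrier :: "('x, 'h::complex_hilbert bop) hmod \<Rightarrow> ('x \<Rightarrow> 'h bop) set"
  where "dual_carrier M = {\<eta> \<in> extensional (carrier M).
    (\<forall>x\<in>carrier M. \<forall>y\<in>carrier M. \<eta> (hadd M x y) = \<eta> x + \<eta> y) \<and>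
    (\<forall>x\<in>carrier M. \<forall>c. \<eta> (hscale M c x) = c *\<^sub>C \<eta> x) \<and>
    (\<forall>x\<in>carrier M. \<forall>b. \<eta> (hact M x b) = \<eta> x * b) \<and>
    (\<exists>C. \<forall>x\<in>carrier M. norm (\<eta> x) \<le> C * hnorm M x)}"

definition hat :: "('x, 'b) hmod \<Rightarrow> 'x \<Rightarrow> 'x \<Rightarrow> 'b"
  where "hat M x = (\<lambda>y\<in>carrier M. hip M y x)"

text \<open>The scalar multiplication \<open>(c \<cdot> \<eta>)(x) = cnj c \<cdot> \<eta>(x)\<close> and the action \<open>(\<eta> \<cdot> b)(x) = b\<^sup>* \<eta>(x)\<close>
  on the dual are the ones that make \<^const>\<open>hat\<close> a linear module map.\<close>

definition dual_with :: "('x, 'h::complex_hilbert bop) hmod \<Rightarrow>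
    (('x \<Rightarrow> 'h bop) \<Rightarrow> ('x \<Rightarrow> 'h bop) \<Rightarrow> 'h bop) \<Rightarrow> ('x \<Rightarrow> 'h bop, 'h bop) hmod"
  where "dual_with M p =
    \<lparr>carrier = dual_carrier M,
     hadd = (\<lambda>\<eta> \<zeta>. \<lambda>x\<in>carrier M. \<eta> x + \<zeta> x),
     hzero = (\<lambda>x\<in>carrier M. 0),
     hscale = (\<lambda>c \<eta>. \<lambda>x\<in>carrier M. cnj c *\<^sub>C \<eta> x),
     hact = (\<lambda>\<eta> b. \<lambda>x\<in>carrier M. bop_adj b * \<eta> x),
     hip = p\<rparr>"

definition self_dual :: "('x, 'h::complex_hilbert bop) hmod \<Rightarrow> bool"
  where "self_dual M \<longleftrightarrow> (\<forall>\<eta>\<in>dual_carrier M. \<exists>y\<in>carrier M. \<eta> = hat M y)"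

text \<open>By Paschke's theorem an inner product on the dual with the following properties exists; its
  values on the dual carrier are uniquely determined by them.\<close>

definition is_dual_ip :: "('x, 'h::complex_hilbert bop) hmod \<Rightarrow>
    (('x \<Rightarrow> 'h bop) \<Rightarrow> ('x \<Rightarrow> 'h bop) \<Rightarrow> 'h bop) \<Rightarrow> bool"
  where "is_dual_ip M p \<longleftrightarrow>
    hilbert_module (dual_with M p) \<and> self_dual (dual_with M p) \<and>
    (\<forall>x\<in>carrier M. \<forall>y\<in>carrier M. p (hat M x) (hat M y) = hip M x y) \<and>
    (\<forall>x\<in>carrier M. \<forall>\<eta>\<in>dual_carrier M. p (hat M x) \<eta> = \<eta> x)"

definition dual_module :: "('x, 'h::complex_hilbert bop) hmod \<Rightarrow> ('x \<Rightarrow> 'h bop, 'h bop) hmod"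
  where "dual_module M = dual_with M (SOME p. is_dual_ip M p)"

definition op_extend :: "('x, 'h::complex_hilbert bop) hmod \<Rightarrow> ('x \<Rightarrow> 'x) \<Rightarrow>
    ('x \<Rightarrow> 'h bop) \<Rightarrow> 'x \<Rightarrow> 'h bop"
  where "op_extend M T = (THE T'. T' \<in> adjointable (dual_module M) \<and>
    (\<forall>x\<in>carrier M. T' (hat M x) = hat M (T x)))"


section \<open>Paschke dilations\<close>

definition paschke_dilation :: "('a::unital_cstar_algebra \<Rightarrow> 'h::complex_hilbert bop) \<Rightarrow>
    ('x, 'h bop) hmod \<Rightarrow> ('a \<Rightarrow> 'x \<Rightarrow> 'x) \<Rightarrow> 'x \<Rightarrow> bool"
  where "paschke_dilation \<phi> X \<sigma> e \<longleftrightarrow>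
    hilbert_module X \<and> star_representation X \<sigma> \<and> e \<in> carrier X \<and>
    (\<forall>a. \<phi> a = hip X (\<sigma> a e) e) \<and>
    hdense X (hspan X {\<sigma> a (hact X e b) | a b. True})"

text \<open>The conditions determine the representation on the group uniquely.\<close>

definition paschke_unitaries :: "('g, 'm) monoid_scheme \<Rightarrow>
    ('g \<Rightarrow> 'a::unital_cstar_algebra \<Rightarrow> 'a) \<Rightarrow> ('x, 'h::complex_hilbert bop) hmod \<Rightarrow>
    ('a \<Rightarrow> 'x \<Rightarrow> 'x) \<Rightarrow> 'x \<Rightarrow> 'g \<Rightarrow> 'x \<Rightarrow> 'x"
  where "paschke_unitaries G \<tau> X \<sigma> e = (SOME W. unitary_representation G X W \<and>
    (\<forall>g\<in>carrier G. W g e = e \<and>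
      (\<forall>a. op_mult X (op_mult X (W g) (\<sigma> a)) (hadj X (W g)) = \<sigma> (\<tau> g a))))"

definition dual_rep :: "('x, 'h::complex_hilbert bop) hmod \<Rightarrow> ('i \<Rightarrow> 'x \<Rightarrow> 'x) \<Rightarrow>
    'i \<Rightarrow> ('x \<Rightarrow> 'h bop) \<Rightarrow> 'x \<Rightarrow> 'h bop"
  where "dual_rep X \<rho> i = op_extend X (\<rho> i)"

definition commutant_interval :: "('g, 'm) monoid_scheme \<Rightarrow>
    ('g \<Rightarrow> 'a::unital_cstar_algebra \<Rightarrow> 'a) \<Rightarrow> ('x, 'h::complex_hilbert bop) hmod \<Rightarrow>
    ('a \<Rightarrow> 'x \<Rightarrow> 'x) \<Rightarrow> 'x \<Rightarrow> (('x \<Rightarrow> 'h bop) \<Rightarrow> 'x \<Rightarrow> 'h bop) set"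
  where "commutant_interval G \<tau> X \<sigma> e =
    {T \<in> commutant (dual_module X)
        (range (dual_rep X \<sigma>) \<union> dual_rep X (paschke_unitaries G \<tau> X \<sigma> e) ` carrier G).
      op_le (dual_module X) (op_zero (dual_module X)) T \<and>
      op_le (dual_module X) T (op_one (dual_module X))}"

definition compressed_map :: "('x, 'h::complex_hilbert bop) hmod \<Rightarrow> ('a \<Rightarrow> 'x \<Rightarrow> 'x) \<Rightarrow> 'x \<Rightarrow>
    (('x \<Rightarrow> 'h bop) \<Rightarrow> 'x \<Rightarrow> 'h bop) \<Rightarrow> 'a \<Rightarrow> 'h bop"
  where "compressed_map X \<sigma> e T a =
    hip (dual_module X) (T (dual_rep X \<sigma> a (hat X e))) (hat X e)"

definition affine_order_iso_cp :: "('y, 'b) hmod \<Rightarrow> ('y \<Rightarrow> 'y) set \<Rightarrow>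
    ('a::unital_cstar_algebra \<Rightarrow> 'h::complex_hilbert bop) set \<Rightarrow>
    (('y \<Rightarrow> 'y) \<Rightarrow> 'a \<Rightarrow> 'h bop) \<Rightarrow> bool"
  where "affine_order_iso_cp M D R \<Phi> \<longleftrightarrow>
    bij_betw \<Phi> D R \<and>
    (\<forall>S\<in>D. \<forall>T\<in>D. op_le M S T \<longleftrightarrow> cp_le (\<Phi> S) (\<Phi> T)) \<and>
    (\<forall>S\<in>D. \<forall>T\<in>D. \<forall>t\<in>{0..1::real}.
      let V = op_add M (op_scale M (of_real t) S) (op_scale M (of_real (1 - t)) T)
      in V \<in> D \<and> \<Phi> V = (\<lambda>a. t *\<^sub>R \<Phi> S a + (1 - t) *\<^sub>R \<Phi> T a))"

end

theory Submission
  imports Defs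
begin

text \<open>
  Fix a unit vector \<open>w\<close> of \<open>H\<close> and write \<open>ket h\<close> for the rank one operator \<open>k \<mapsto> \<langle>k, w\<rangle> h\<close>.  On a Hilbert
  \<open>B(H)\<close>-module \<open>X\<close> the scalar form \<open>s(x, y) = \<langle>\<langle>x, y\<rangle> w, w\<rangle>\<close> is a complete semi-inner product, and
  \<open>s(x \<cdot> ket h, y \<cdot> ket k) = \<langle>\<langle>x, y\<rangle> h, k\<rangle>\<close>, so that every statement about \<open>X\<close> can be tested on \<open>s\<close>.  By the
  Riesz theorem for \<open>s\<close>, \<open>\<eta> \<cdot> ket h\<close> lies in the image of \<open>X\<close> for every \<open>\<eta>\<close> in \<open>X'\<close>; this yields Paschke's
  inner product on \<open>X'\<close>, the extension of adjointable operators from \<open>X\<close> to \<open>X'\<close>, and the fact that an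
  adjointable \<open>T\<close> on \<open>X'\<close>, and its positivity, can be read off from the numbers \<open>s(T x, y)\<close> with \<open>x\<close>, \<open>y\<close> in
  a dense subset of \<open>X\<close>.

  For \<open>T\<close> commuting with the representation of \<open>A\<close>, the form of \<open>T\<close> at the vectors
  \<open>\<Sum> \<sigma>(a\<^sub>i)(e b\<^sub>i)\<close> and \<open>\<Sum> \<sigma>(a'\<^sub>j)(e b'\<^sub>j)\<close> equals
  \<open>\<Sum> \<langle>\<phi>\<^sub>T(a'\<^sub>j\<^sup>* a\<^sub>i) b\<^sub>i w, b'\<^sub>j w\<rangle>\<close>, and a linear map is completely positive iff this expression, as a
  quadratic form, is nonnegative.  Hence \<open>\<phi>\<^sub>T\<close> determines \<open>T\<close>, and \<open>T\<close> is positive iff \<open>\<phi>\<^sub>T\<close> is completely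
  positive.  Conversely, \<open>0 \<le> \<theta> \<le> \<phi>\<close> makes the form of \<open>\<theta>\<close> a contractive one, which is represented by an
  operator; it commutes with \<open>A\<close> because of the shape of the form, and with \<open>G\<close> because \<open>\<theta>\<close> is invariant.
\<close>

section \<open>Semi-inner products and the Riesz representation theorem\<close>

text \<open>Positivity on \<open>X'\<close> means a factorization by an adjointable operator and its
  adjoint, so a nonnegative form is not enough: a square root has to be produced among the
  adjointable operators. A bounded form on \<open>X\<close> is in general represented only by an
  operator on \<open>X'\<close>, because \<open>X\<close> need not be self-dual. Conversely,
  \<open>T\<close> on \<open>X\<close> extends to \<open>X'\<close> by composing functionals with
  its adjoint, and the composite must again be a bounded functional; this calls for a uniform
  boundedness argument, since adjointability is defined without linearity and without a norm. The
  price of the scalar form \<open>s\<close> is that it has null vectors. Riesz vectors and limits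
  are determined only up to these, so maps obtained by choosing them are linear only modulo null
  vectors, and each has to be fed into a quantity that ignores them, such as the value of a
  functional at \<open>unit_vec\<close>. The inner product of \<open>X'\<close> and the unitaries
  are picked by \<open>SOME\<close>; existence is proved by construction, but everything afterwards
  may use only their specifications.\<close>

lemma mult_cnj_cmod: "z * cnj z = (complex_of_real (cmod z))\<^sup>2"
  by (metis complex_norm_square of_real_power)

text \<open>Common source of the hermitian symmetry and Cauchy-Schwarz arguments below: the
  hypothesis is what a nonnegative form gives at \<open>y + c x\<close>. The values
  \<open>c = 0, 1, -1, \<i>\<close> force \<open>\<beta>' = cnj \<beta>\<close>; the inequality is
  then the discriminant condition for a real quadratic polynomial.\<close>

lemma nonneg_quadratic_form:
  fixes \<alpha> \<beta> \<beta>' \<gamma> :: complex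
  assumes nn: "\<And>c. \<alpha> + c * \<beta> + cnj c * \<beta>' + c * cnj c * \<gamma> \<in> \<real>\<^sub>\<ge>\<^sub>0"
  shows "\<beta>' = cnj \<beta>" and "(cmod \<beta>)\<^sup>2 \<le> Re \<alpha> * Re \<gamma>"
proof -
  have 0: "Re \<alpha> \<ge> 0" "Im \<alpha> = 0"
    using nn[of 0] by (auto simp: complex_nonneg_Reals_iff)
  have 1: "Im \<gamma> + Im \<beta> + Im \<beta>' = 0" "Im \<gamma> - Im \<beta> - Im \<beta>' = 0"
    using nn[of 1] nn[of "-1"] 0 by (auto simp: complex_nonneg_Reals_iff)
  have 2: "Im \<gamma> + Re \<beta> - Re \<beta>' = 0"
    using nn[of \<i>] 0 by (auto simp: complex_nonneg_Reals_iff)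
  show eq: "\<beta>' = cnj \<beta>"
    using 1 2 by (auto simp: complex_eq_iff)
  define b where "b = (cmod \<beta>)\<^sup>2"
  have b: "b \<ge> 0" "\<beta> * cnj \<beta> = of_real b"
    by (auto simp: b_def mult_cnj_cmod)
  \<comment> \<open>Along \<open>c = - t cnj \<beta>\<close> both mixed terms become the real number
    \<open>- t b\<close>.\<close>
  have q: "0 \<le> Re \<alpha> - 2 * t * b + t\<^sup>2 * b * Re \<gamma>" for t :: real
  proof -
    have "\<alpha> + (- t * cnj \<beta>) * \<beta> + cnj (- t * cnj \<beta>) * \<beta>' + (- t * cnj \<beta>) * cnj (- t * cnj \<beta>) * \<gamma>
      = \<alpha> - 2 * t * (\<beta> * cnj \<beta>) + t\<^sup>2 * (\<beta> * cnj \<beta>) * \<gamma>"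
      unfolding eq by (simp add: algebra_simps power2_eq_square)
    also have "\<dots> = \<alpha> - of_real (2 * t * b) + of_real (t\<^sup>2 * b) * \<gamma>"
      by (simp add: b(2))
    finally have "\<alpha> - of_real (2 * t * b) + of_real (t\<^sup>2 * b) * \<gamma> \<in> \<real>\<^sub>\<ge>\<^sub>0"
      using nn[of "- t * cnj \<beta>"] by argo
    then have "0 \<le> Re (\<alpha> - of_real (2 * t * b) + of_real (t\<^sup>2 * b) * \<gamma>)"
      by (simp only: complex_nonneg_Reals_iff)
    then show ?thesis by (simp del: of_real_mult)
  qed
  \<comment> \<open>Averaging over \<open>t\<close> and \<open>- t\<close> cancels the mixed terms;
    if \<open>Re \<gamma>\<close> were negative, a large \<open>t\<close> would violate the
    bound.\<close>
  have r: "0 \<le> Re \<alpha> + t\<^sup>2 * Re \<gamma>" for t :: real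
    using nn[of t] nn[of "-t"] by (simp add: complex_nonneg_Reals_iff power2_eq_square)
  have g: "Re \<gamma> \<ge> 0"
  proof (rule ccontr)
    assume "\<not> Re \<gamma> \<ge> 0"
    then have n: "Re \<gamma> < 0" by simp
    have "(sqrt ((Re \<alpha> + 1) / (- Re \<gamma>)))\<^sup>2 = (Re \<alpha> + 1) / (- Re \<gamma>)"
      using n 0 by (intro real_sqrt_pow2 divide_nonneg_pos) auto
    then show False
      using r[of "sqrt ((Re \<alpha> + 1) / (- Re \<gamma>))"] n by (simp add: field_simps)
  qed
  have "b \<le> Re \<alpha> * Re \<gamma>"
  proof (cases "Re \<gamma> = 0")
    case True
    have "b = 0"
    proof (rule ccontr)
      assume "b \<noteq> 0"
      \<comment> \<open>For \<open>Re \<gamma> = 0\<close> the bound \<open>q\<close> is affine in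
        \<open>t\<close>, and at this \<open>t\<close> it reads \<open>0 \<le> -1\<close>.\<close>
      then show False using q[of "(Re \<alpha> + 1) / (2 * b)"] True by simp
    qed
    then show ?thesis using True by simp
  next
    case False
    then show ?thesis using q[of "1 / Re \<gamma>"] g by (simp add: field_simps power2_eq_square)
  qed
  then show "(cmod \<beta>)\<^sup>2 \<le> Re \<alpha> * Re \<gamma>" by (simp add: b_def)
qed

locale semi_inner_product =
  fixes V :: "'v set" and add :: "'v \<Rightarrow> 'v \<Rightarrow> 'v" and scale :: "complex \<Rightarrow> 'v \<Rightarrow> 'v"
    and ip :: "'v \<Rightarrow> 'v \<Rightarrow> complex"
  assumes add_closed [simp]: "\<lbrakk>x \<in> V; y \<in> V\<rbrakk> \<Longrightarrow> add x y \<in> V"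
    and scale_closed [simp]: "x \<in> V \<Longrightarrow> scale c x \<in> V"
    and ip_add_left: "\<lbrakk>x \<in> V; y \<in> V; z \<in> V\<rbrakk> \<Longrightarrow> ip (add x y) z = ip x z + ip y z"
    and ip_scale_left: "\<lbrakk>x \<in> V; y \<in> V\<rbrakk> \<Longrightarrow> ip (scale c x) y = c * ip x y"
    and ip_commute: "\<lbrakk>x \<in> V; y \<in> V\<rbrakk> \<Longrightarrow> ip x y = cnj (ip y x)"
    and ip_self_nonneg: "x \<in> V \<Longrightarrow> ip x x \<in> \<real>\<^sub>\<ge>\<^sub>0"
begin

definition seminorm :: "'v \<Rightarrow> real"
  where "seminorm x = sqrt (Re (ip x x))"

abbreviation diff :: "'v \<Rightarrow> 'v \<Rightarrow> 'v"
  where "diff x y \<equiv> add x (scale (-1) y)"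

text \<open>Completeness is stated on the vectors themselves and not on the quotient by null
  vectors, so a limit is unique only up to these.\<close>

definition seminorm_complete :: bool
  where "seminorm_complete \<longleftrightarrow> (\<forall>u::nat \<Rightarrow> 'v. (\<forall>n. u n \<in> V) \<longrightarrow>
    (\<forall>\<epsilon>>0. \<exists>N. \<forall>m\<ge>N. \<forall>n\<ge>N. seminorm (diff (u m) (u n)) < \<epsilon>) \<longrightarrow>
    (\<exists>x\<in>V. (\<lambda>n. seminorm (diff (u n) x)) \<longlonglongrightarrow> 0))"

lemma ip_add_right: "\<lbrakk>x \<in> V; y \<in> V; z \<in> V\<rbrakk> \<Longrightarrow> ip z (add x y) = ip z x + ip z y"
  using ip_commute[of z "add x y"] ip_commute[of z x] ip_commute[of z y]
  by (simp add: ip_add_left)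

lemma ip_scale_right: "\<lbrakk>x \<in> V; y \<in> V\<rbrakk> \<Longrightarrow> ip y (scale c x) = cnj c * ip y x"
  using ip_commute[of y "scale c x"] ip_commute[of y x] by (simp add: ip_scale_left)

lemmas ip_simps = ip_add_left ip_add_right ip_scale_left ip_scale_right

lemma ip_self: "x \<in> V \<Longrightarrow> ip x x = of_real ((seminorm x)\<^sup>2)"
  using ip_self_nonneg[of x]
  by (auto simp: seminorm_def complex_nonneg_Reals_iff complex_eq_iff)

lemma seminorm_nonneg [simp]: "x \<in> V \<Longrightarrow> seminorm x \<ge> 0"
  using ip_self_nonneg[of x] by (auto simp: seminorm_def complex_nonneg_Reals_iff)

lemma seminorm_sq: "x \<in> V \<Longrightarrow> (seminorm x)\<^sup>2 = Re (ip x x)"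
  by (simp add: ip_self)

lemma cauchy_schwarz:
  assumes "x \<in> V" "y \<in> V"
  shows "cmod (ip x y) \<le> seminorm x * seminorm y"
proof -
  have "ip y y + c * ip x y + cnj c * ip y x + c * cnj c * ip x x \<in> \<real>\<^sub>\<ge>\<^sub>0" for c
    using ip_self_nonneg[of "add (scale c x) y"] assms
    by (simp add: ip_add_left ip_add_right ip_scale_left ip_scale_right algebra_simps)
  from nonneg_quadratic_form(2)[OF this]
  have "(cmod (ip x y))\<^sup>2 \<le> (seminorm x * seminorm y)\<^sup>2"
    using assms by (simp add: power_mult_distrib seminorm_sq mult.commute)
  then show ?thesis
    by (rule power2_le_imp_le) (use assms in simp)
qed

lemma seminorm_triangle:
  assumes "x \<in> V" "y \<in> V"
  shows "seminorm (add x y) \<le> seminorm x + seminorm y"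
proof (rule power2_le_imp_le)
  have "Re (ip x y) \<le> seminorm x * seminorm y"
    using cauchy_schwarz[OF assms] complex_Re_le_cmod order_trans by blast
  moreover have "Re (ip y x) = Re (ip x y)"
    using ip_commute[OF assms] by simp
  ultimately show "(seminorm (add x y))\<^sup>2 \<le> (seminorm x + seminorm y)\<^sup>2"
    using assms by (simp add: seminorm_sq ip_simps power2_sum)
qed (use assms in simp)

lemma seminorm_scale: "x \<in> V \<Longrightarrow> seminorm (scale c x) = cmod c * seminorm x"
proof -
  assume x: "x \<in> V"
  have "ip (scale c x) (scale c x) = (c * cnj c) * ip x x"
    using x by (simp add: ip_simps)
  also have "\<dots> = of_real ((cmod c)\<^sup>2) * ip x x"
    by (simp add: mult_cnj_cmod)
  finally have "ip (scale c x) (scale c x) = of_real ((cmod c)\<^sup>2) * ip x x" .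
  then show ?thesis by (simp add: seminorm_def real_sqrt_mult)
qed

lemma seminorm_add_scale_sq:
  assumes "x \<in> V" "y \<in> V"
  shows "(seminorm (add x (scale t y)))\<^sup>2 =
    (seminorm x)\<^sup>2 + 2 * Re (cnj t * ip x y) + (cmod t)\<^sup>2 * (seminorm y)\<^sup>2"
proof -
  have "Re (t * ip y x) = Re (cnj t * ip x y)"
    using ip_commute[OF assms] by simp
  moreover have "Re (t * (cnj t * ip y y)) = (cmod t)\<^sup>2 * (seminorm y)\<^sup>2"
  proof -
    have "t * (cnj t * ip y y) = of_real ((cmod t)\<^sup>2 * (seminorm y)\<^sup>2)"
      using assms by (simp add: ip_self mult_cnj_cmod flip: mult.assoc)
    then show ?thesis by (simp only: Re_complex_of_real)
  qed
  moreover have "ip (add x (scale t y)) (add x (scale t y)) =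
      ip x x + cnj t * ip x y + t * ip y x + t * (cnj t * ip y y)"
    using assms by (simp add: ip_add_left ip_add_right ip_scale_left ip_scale_right algebra_simps)
  ultimately show ?thesis
    using assms by (simp only: seminorm_sq add_closed scale_closed plus_complex.simps)
qed

lemma seminorm_diff_commute: "\<lbrakk>x \<in> V; y \<in> V\<rbrakk> \<Longrightarrow> seminorm (diff x y) = seminorm (diff y x)"
  by (simp add: seminorm_def ip_simps)

lemma seminorm_diff_triangle:
  assumes "x \<in> V" "y \<in> V" "z \<in> V"
  shows "seminorm (diff x z) \<le> seminorm (diff x y) + seminorm (diff y z)"
proof -
  have "seminorm (diff x z) = seminorm (add (diff x y) (diff y z))"
    using assms by (simp add: seminorm_def ip_simps)
  also have "\<dots> \<le> seminorm (diff x y) + seminorm (diff y z)"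
    using assms by (intro seminorm_triangle) auto
  finally show ?thesis .
qed

lemma ip_tendsto:
  assumes u: "\<And>n. u n \<in> V" "x \<in> V" "(\<lambda>n. seminorm (diff (u n) x)) \<longlonglongrightarrow> 0"
    and w: "\<And>n. w n \<in> V" "y \<in> V" "(\<lambda>n. seminorm (diff (w n) y)) \<longlonglongrightarrow> 0"
  shows "(\<lambda>n::nat. ip (u n) (w n)) \<longlonglongrightarrow> ip x y"
proof -
  let ?d = "\<lambda>n. seminorm (diff (u n) x)" and ?e = "\<lambda>n. seminorm (diff (w n) y)"
  have bound: "\<forall>n. norm (ip (u n) (w n) - ip x y) \<le> ?d n * ?e n + ?d n * seminorm y + seminorm x * ?e n"
  proof
    fix n
    have "ip (u n) (w n) - ip x y =
      ip (diff (u n) x) (diff (w n) y) + ip (diff (u n) x) y + ip x (diff (w n) y)"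
      using u w by (simp add: ip_simps algebra_simps)
    also have "cmod \<dots> \<le> cmod (ip (diff (u n) x) (diff (w n) y)) + cmod (ip (diff (u n) x) y)
        + cmod (ip x (diff (w n) y))"
      by (rule order_trans[OF norm_triangle_ineq add_right_mono[OF norm_triangle_ineq]])
    also have "\<dots> \<le> ?d n * ?e n + ?d n * seminorm y + seminorm x * ?e n"
      using u w by (intro add_mono cauchy_schwarz) auto
    finally show "norm (ip (u n) (w n) - ip x y) \<le> ?d n * ?e n + ?d n * seminorm y + seminorm x * ?e n" .
  qed
  have "(\<lambda>n. ?d n * ?e n + ?d n * seminorm y + seminorm x * ?e n) \<longlonglongrightarrow>
      0 * 0 + 0 * seminorm y + seminorm x * 0"
    by (intro tendsto_intros u w)
  then have "(\<lambda>n. ip (u n) (w n) - ip x y) \<longlonglongrightarrow> 0"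
    using Lim_null_comparison[OF always_eventually[OF bound]] by simp
  then show ?thesis by (simp add: LIM_zero_iff)
qed

lemma ip_tendsto_left:
  assumes "\<And>n. u n \<in> V" "x \<in> V" "(\<lambda>n. seminorm (diff (u n) x)) \<longlonglongrightarrow> 0" "y \<in> V"
  shows "(\<lambda>n::nat. ip (u n) y) \<longlonglongrightarrow> ip x y"
proof -
  have "seminorm (diff y y) = 0"
    using \<open>y \<in> V\<close> by (simp add: seminorm_def ip_simps)
  then show ?thesis
    using ip_tendsto[of u x "\<lambda>_. y" y] assms by simp
qed

text \<open>The functional is given by its graph \<open>P\<close>, whose domain is neither required to be dense nor
  closed; the representing vector minimizes \<open>\<parallel>x\<parallel>\<^sup>2 - 2 Re c\<close> over \<open>P\<close>.\<close>

theorem riesz_relation: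
  assumes complete: seminorm_complete
    and ne: "P \<noteq> {}" and PV: "\<And>x c. (x, c) \<in> P \<Longrightarrow> x \<in> V"
    and lin: "\<And>x c y d t. \<lbrakk>(x, c) \<in> P; (y, d) \<in> P\<rbrakk> \<Longrightarrow> (add x (scale t y), c + t * d) \<in> P"
    and bd: "\<And>x c. (x, c) \<in> P \<Longrightarrow> cmod c \<le> K * seminorm x"
  shows "\<exists>v\<in>V. \<forall>(x, c)\<in>P. c = ip x v"
proof -
  define J where "J = (\<lambda>(x, c). (seminorm x)\<^sup>2 - 2 * Re c)"
  define j where "j = Inf (J ` P)"
  \<comment> \<open>With \<open>n = seminorm x\<close>, the bound on \<open>Re c\<close> makes
    \<open>J\<close> at least \<open>n^2 - 2 K n = (n - K)^2 - K^2\<close>.\<close>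
  have bdd: "bdd_below (J ` P)"
  proof (rule bdd_belowI2)
    fix z assume "z \<in> P"
    then obtain x c where z: "z = (x, c)" "(x, c) \<in> P" by (cases z) auto
    have "Re c \<le> K * seminorm x"
      using bd[OF z(2)] complex_Re_le_cmod order_trans by blast
    moreover have "0 \<le> (seminorm x - K)\<^sup>2" by simp
    ultimately show "- K\<^sup>2 \<le> J z"
      by (simp add: J_def z power2_diff algebra_simps)
  qed
  have jle: "j \<le> J z" if "z \<in> P" for z
    unfolding j_def using that bdd by (auto intro: cInf_lower)
  have "\<exists>z\<in>P. J z < j + 1 / (real n + 1)" for n :: nat
    using cInf_lessD[of "J ` P" "j + 1 / (real n + 1)"] ne by (auto simp: j_def)
  then obtain z where z: "\<And>n. z n \<in> P" "\<And>n. J (z n) < j + 1 / (real n + 1)"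
    by metis
  define u where "u n = fst (z n)" for n
  define c where "c n = snd (z n)" for n
  have zP: "(u n, c n) \<in> P" for n
    using z(1)[of n] by (simp add: u_def c_def)
  have uV: "u n \<in> V" for n
    using zP PV by blast
  have zJ: "(seminorm (u n))\<^sup>2 - 2 * Re (c n) < j + 1 / (real n + 1)" for n
    using z(2)[of n] by (simp add: u_def c_def J_def case_prod_beta)
  \<comment> \<open>Parallelogram law for two near-minimizers: their midpoint, written as
    \<open>u m - (u m - u n) / 2\<close>, is again paired with a scalar in \<open>P\<close>, so its
    value is at least \<open>j\<close>, which leaves little room for their distance.\<close>
  have para: "(seminorm (diff (u m) (u n)))\<^sup>2 \<le> 2 / (real m + 1) + 2 / (real n + 1)" for m n
  proof -
    have "(add (u m) (scale 1 (u n)), c m + 1 * c n) \<in> P"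
      by (intro lin zP)
    then have sP: "(add (u m) (scale 1 (u n)), c m + c n) \<in> P" by simp
    have "(add (u m) (scale (-1/2) (add (u m) (scale (- 1) (u n)))), c m + (-1/2) * (c m + (-1) * c n)) \<in> P"
      by (intro lin zP)
    from jle[OF this]
    have "j \<le> (seminorm (add (u m) (scale (-1/2) (diff (u m) (u n)))))\<^sup>2 - (Re (c m) + Re (c n))"
      by (simp add: J_def field_simps)
    moreover have "(seminorm (diff (u m) (u n)))\<^sup>2 = 2 * (seminorm (u m))\<^sup>2 + 2 * (seminorm (u n))\<^sup>2
        - 4 * (seminorm (add (u m) (scale (-1/2) (diff (u m) (u n)))))\<^sup>2"
      using uV by (simp add: seminorm_sq ip_simps field_simps)
    ultimately show ?thesis
      using zJ[of m] zJ[of n] by simp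
  qed
  have "\<exists>N. \<forall>m\<ge>N. \<forall>n\<ge>N. seminorm (diff (u m) (u n)) < \<epsilon>" if "\<epsilon> > 0" for \<epsilon>
  proof -
    obtain N :: nat where N: "4 / \<epsilon>\<^sup>2 < real N"
      using reals_Archimedean2 by blast
    have "seminorm (diff (u m) (u n)) < \<epsilon>" if "m \<ge> N" "n \<ge> N" for m n
    proof -
      have N0: "real N > 0"
      proof -
        have "0 < 4 / \<epsilon>\<^sup>2" using \<open>\<epsilon> > 0\<close> by simp
        then show ?thesis using N by linarith
      qed
      have "2 / (real m + 1) \<le> 2 / real N" "2 / (real n + 1) \<le> 2 / real N"
        using that N0 by (auto intro!: divide_left_mono)
      then have "(seminorm (diff (u m) (u n)))\<^sup>2 \<le> 4 / real N"
        using para[of m n] by simp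
      also have "\<dots> < \<epsilon>\<^sup>2"
        using N N0 \<open>\<epsilon> > 0\<close> by (simp add: field_simps)
      finally show ?thesis
        using \<open>\<epsilon> > 0\<close> by (simp add: power2_less_imp_less)
    qed
    then show ?thesis by blast
  qed
  then obtain v where v: "v \<in> V" "(\<lambda>n. seminorm (diff (u n) v)) \<longlonglongrightarrow> 0"
    using complete uV unfolding seminorm_complete_def by blast
  have "d = ip y v" if yd: "(y, d) \<in> P" for y d
  proof -
    have yV: "y \<in> V" using yd PV by blast
    have lim: "(\<lambda>n. ip (u n) y) \<longlonglongrightarrow> ip v y"
      by (rule ip_tendsto_left) (use uV v yV in auto)
    define w where "w = ip y v - d"
    have ge: "0 \<le> 2 * Re (t * w) + (cmod t)\<^sup>2 * (seminorm y)\<^sup>2" for t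
    proof -
      have "0 \<le> 1 / (real n + 1) + 2 * Re (cnj t * ip (u n) y - t * d) + (cmod t)\<^sup>2 * (seminorm y)\<^sup>2" for n
        using jle[OF lin[OF zP[of n] yd, of t]] zJ[of n] uV yV
        by (simp add: J_def seminorm_add_scale_sq algebra_simps)
      moreover have "(\<lambda>n. 1 / (real n + 1) + 2 * Re (cnj t * ip (u n) y - t * d) + (cmod t)\<^sup>2 * (seminorm y)\<^sup>2)
        \<longlonglongrightarrow> 0 + 2 * Re (cnj t * ip v y - t * d) + (cmod t)\<^sup>2 * (seminorm y)\<^sup>2"
        using LIMSEQ_inverse_real_of_nat by (intro tendsto_intros lim) (simp add: inverse_eq_divide add.commute)
      ultimately have "0 \<le> 0 + 2 * Re (cnj t * ip v y - t * d) + (cmod t)\<^sup>2 * (seminorm y)\<^sup>2"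
        by (intro LIMSEQ_le_const) auto
      moreover have "Re (cnj t * ip v y) = Re (t * ip y v)"
        using ip_commute[of v y] yV v by simp
      ultimately show ?thesis by (simp add: w_def algebra_simps)
    qed
    \<comment> \<open>At \<open>t = - r cnj w\<close> the inequality \<open>ge\<close> says that
      \<open>r |w|^2 (r n^2 - 2)\<close> is nonnegative, where \<open>n = seminorm y\<close>. The
      \<open>+ 1\<close> in the denominator gives \<open>r n^2 < 1\<close> even when
      \<open>y\<close> is a null vector, so \<open>w\<close> must vanish.\<close>
    define r where "r = 1 / ((seminorm y)\<^sup>2 + 1)"
    have r: "r > 0" "r * (seminorm y)\<^sup>2 < 1" by (auto simp: r_def field_simps add_pos_nonneg)
    have "0 \<le> 2 * Re (- r * cnj w * w) + (cmod (- r * cnj w))\<^sup>2 * (seminorm y)\<^sup>2"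
      by (rule ge)
    also have "- r * cnj w * w = - of_real (r * (cmod w)\<^sup>2)"
      by (simp add: mult_cnj_cmod[symmetric] algebra_simps)
    also have "(cmod (- r * cnj w))\<^sup>2 = r\<^sup>2 * (cmod w)\<^sup>2"
      by (simp add: norm_mult power_mult_distrib)
    finally have "0 \<le> r * (cmod w)\<^sup>2 * (r * (seminorm y)\<^sup>2 - 2)"
      by (simp add: algebra_simps power2_eq_square)
    moreover have "r * (seminorm y)\<^sup>2 - 2 < 0" using r by simp
    ultimately have "(cmod w)\<^sup>2 \<le> 0"
      using r by (simp add: zero_le_mult_iff mult_le_0_iff)
    then show ?thesis by (simp add: w_def)
  qed
  then show ?thesis using v by blast
qed

end

section \<open>Bounded operators\<close>

lemma scaleC_one [simp]: "1 *\<^sub>C (x::'a::complex_normed_vector) = x"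
  using scaleC_of_real[of 1 x] by simp

lemma scaleC_minus_one [simp]: "(- 1) *\<^sub>C (x::'a::complex_normed_vector) = - x"
  using scaleC_of_real[of "-1" x] by simp

interpretation hilbert: semi_inner_product "UNIV :: 'h::complex_hilbert set" "(+)" scaleC cinner
proof
  fix x y z :: 'h and c :: complex
  show "cinner x x \<in> \<real>\<^sub>\<ge>\<^sub>0"
    by (simp add: cinner_self complex_nonneg_Reals_iff)
qed (auto simp: cinner_add_left cinner_scaleC_left intro: cinner_commute)

lemma hilbert_seminorm [simp]: "hilbert.seminorm = (norm :: 'h::complex_hilbert \<Rightarrow> real)"
  by (rule ext) (simp add: hilbert.seminorm_def cinner_self)

lemma cinner_add_right: "cinner x (y + z) = cinner x y + cinner x (z::'h::complex_hilbert)"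
  by (rule hilbert.ip_add_right) auto

lemma cinner_scaleC_right: "cinner x (c *\<^sub>C y) = cnj c * cinner x (y::'h::complex_hilbert)"
  by (rule hilbert.ip_scale_right) auto

lemma cinner_zero [simp]: "cinner 0 (x::'h::complex_hilbert) = 0" "cinner x (0::'h) = 0"
  using cinner_scaleC_left[of 0 0 x] cinner_scaleC_right[of x 0 0] by auto

lemma cinner_minus_left: "cinner (- x) (y::'h::complex_hilbert) = - cinner x y"
  using cinner_scaleC_left[of "-1" x y] by simp

lemma cinner_minus_right: "cinner x (- y::'h::complex_hilbert) = - cinner x y"
  using cinner_scaleC_right[of x "-1" y] by simp

lemma cinner_diff_left: "cinner (x - y) (z::'h::complex_hilbert) = cinner x z - cinner y z"
  by (metis cinner_add_left cinner_minus_left diff_conv_add_uminus)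

lemma cinner_diff_right: "cinner z (x - y) = cinner z x - cinner z (y::'h::complex_hilbert)"
  by (metis cinner_add_right cinner_minus_right diff_conv_add_uminus)

lemma cinner_sum_left: "cinner (\<Sum>i\<in>I. f i) (z::'h::complex_hilbert) = (\<Sum>i\<in>I. cinner (f i) z)"
  by (induction I rule: infinite_finite_induct) (auto simp: cinner_add_left)

lemmas cinner_simps = cinner_add_left cinner_add_right cinner_scaleC_left cinner_scaleC_right
  cinner_minus_left cinner_minus_right cinner_diff_left cinner_diff_right

lemma cinner_cauchy_schwarz: "cmod (cinner x y) \<le> norm x * norm (y::'h::complex_hilbert)"
  using hilbert.cauchy_schwarz[of x y] by simp

lemma cinner_eqI:
  assumes "\<And>z. cinner x z = cinner y (z::'h::complex_hilbert)"
  shows "x = y"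
proof -
  have "cinner (x - y) (x - y) = 0"
    using assms[of "x - y"] by (simp add: cinner_diff_left)
  then show ?thesis by (simp add: cinner_self)
qed

lemma cinner_eqI_right:
  assumes "\<And>z. cinner z x = cinner z (y::'h::complex_hilbert)"
  shows "x = y"
  using assms by (metis cinner_commute cinner_eqI)

lemma hilbert_complete: "semi_inner_product.seminorm_complete (UNIV :: 'h::complex_hilbert set) (+) scaleC cinner"
proof -
  have "\<exists>x. (\<lambda>n. norm (u n + - x)) \<longlonglongrightarrow> 0"
    if "\<forall>\<epsilon>>0. \<exists>N. \<forall>m\<ge>N. \<forall>n\<ge>N. norm (u m + - u n) < \<epsilon>" for u :: "nat \<Rightarrow> 'h"
  proof -
    have "Cauchy u"
      using that by (auto simp: Cauchy_def dist_norm)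
    then obtain x where "u \<longlonglongrightarrow> x"
      using convergent_eq_Cauchy by blast
    then have "(\<lambda>n. norm (u n - x)) \<longlonglongrightarrow> 0"
      by (simp add: LIM_zero tendsto_norm_zero)
    then show ?thesis by auto
  qed
  then show ?thesis
    by (simp add: hilbert.seminorm_complete_def)
qed

lemma riesz_hilbert:
  fixes f :: "'h::complex_hilbert \<Rightarrow> complex"
  assumes "\<And>x y. f (x + y) = f x + f y" "\<And>c x. f (c *\<^sub>C x) = c * f x"
    and "\<And>x. cmod (f x) \<le> K * norm x"
  shows "\<exists>v. \<forall>x. f x = cinner x v"
proof -
  have "\<exists>v\<in>UNIV. \<forall>(x, c)\<in>range (\<lambda>x. (x, f x)). c = cinner x v"
    by (rule hilbert.riesz_relation[OF hilbert_complete, where K = K]) (auto simp: assms image_iff)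
  then show ?thesis by auto
qed

text \<open>The value carries information only if \<open>f\<close> is bounded and complex linear;
  every use goes through \<open>bop_of_apply\<close>, which asks for exactly this.\<close>

definition bop_of :: "('h::complex_hilbert \<Rightarrow> 'h) \<Rightarrow> 'h bop"
  where "bop_of f = Bop (Blinfun f)"

lemma bop_of_apply:
  assumes add: "\<And>x y. f (x + y) = f x + f y" and sc: "\<And>c x. f (c *\<^sub>C x) = c *\<^sub>C f x"
    and bd: "\<And>x. norm (f x) \<le> K * norm x"
  shows "bop_apply (bop_of f) x = f x"
proof -
  have "f (r *\<^sub>R x) = r *\<^sub>R f x" for r x
    using sc[of "of_real r" x] by (simp add: scaleC_of_real)
  then have "bounded_linear f"
    by (intro bounded_linear_intro[where K = K]) (auto simp: add bd mult.commute)
  then show ?thesis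
    unfolding bop_of_def bop_apply_def
    by (simp add: Bop_inverse bounded_linear_Blinfun_apply sc)
qed

lemma bop_apply_simps [simp]:
  fixes S T :: "'h::complex_hilbert bop"
  shows "bop_apply (S + T) x = S x + T x" "bop_apply (S - T) x = S x - T x"
    "bop_apply (- T) x = - T x" "bop_apply 0 x = 0" "bop_apply 1 x = x"
    "bop_apply (S * T) x = S (T x)" "bop_apply (c *\<^sub>C T) x = c *\<^sub>C T x"
    "bop_apply (r *\<^sub>R T) x = r *\<^sub>R T x"
  by (transfer; simp add: blinfun.add_left blinfun.diff_left blinfun.minus_left blinfun.scaleR_left
      scaleC_Blinfun_apply)+

lemma bop_add_arg: "bop_apply T (x + y) = T x + T y"
  by transfer (simp add: blinfun.add_right)

lemma bop_scaleC_arg: "bop_apply T (c *\<^sub>C x) = c *\<^sub>C T x"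
  by transfer simp

lemma bop_sum_apply: "bop_apply (\<Sum>i\<in>I. f i) x = (\<Sum>i\<in>I. f i x)"
  by (induction I rule: infinite_finite_induct) auto

lemma norm_bop_apply: "norm (bop_apply T x) \<le> norm T * norm x"
  by transfer (rule norm_blinfun)

lemma norm_bop_le: "\<lbrakk>0 \<le> C; \<And>x. norm (bop_apply T x) \<le> C * norm x\<rbrakk> \<Longrightarrow> norm T \<le> C"
  by transfer (rule norm_blinfun_bound)

lemma bop_eqI: "(\<And>x. bop_apply S x = bop_apply T x) \<Longrightarrow> S = T"
  by transfer (rule blinfun_eqI)

lemma bop_eqI_cinner: "(\<And>x y. cinner (bop_apply S x) y = cinner (bop_apply T x) y) \<Longrightarrow> S = T"
  by (rule bop_eqI, rule cinner_eqI)

text \<open>A Cauchy sequence converges among the real-linear operators, and complex linearity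
  survives the limit. Completeness of \<open>B(H)\<close> is needed for pointwise limits of
  functionals on \<open>X\<close>, hence for the completeness of \<open>X'\<close>.\<close>

instance bop :: (complex_hilbert) banach
proof
  fix u :: "nat \<Rightarrow> 'a bop"
  assume u: "Cauchy u"
  have nd: "norm (blinfun_of_bop S - blinfun_of_bop T) = norm (S - T)" for S T :: "'a bop"
    by transfer simp
  have "Cauchy (\<lambda>n. blinfun_of_bop (u n))"
    using u by (simp add: Cauchy_def dist_norm nd)
  then obtain L where L: "(\<lambda>n. blinfun_of_bop (u n)) \<longlonglongrightarrow> L"
    using convergent_eq_Cauchy by blast
  have "blinfun_apply L (c *\<^sub>C x) = c *\<^sub>C blinfun_apply L x" for c x
  proof (rule LIMSEQ_unique)
    show "(\<lambda>n. blinfun_apply (blinfun_of_bop (u n)) (c *\<^sub>C x)) \<longlonglongrightarrow> blinfun_apply L (c *\<^sub>C x)"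
      by (intro tendsto_intros L)
    have "(\<lambda>n. c *\<^sub>C blinfun_apply (blinfun_of_bop (u n)) x) \<longlonglongrightarrow> c *\<^sub>C blinfun_apply L x"
      by (intro bounded_linear.tendsto[OF bounded_linear_scaleC] tendsto_intros L)
    then show "(\<lambda>n. blinfun_apply (blinfun_of_bop (u n)) (c *\<^sub>C x)) \<longlonglongrightarrow> c *\<^sub>C blinfun_apply L x"
      using blinfun_of_bop[of "u _"] by simp
  qed
  then have "blinfun_of_bop (Bop L) = L"
    by (simp add: Bop_inverse)
  then have "norm (u n - Bop L) = norm (blinfun_of_bop (u n) - L)" for n
    using nd[of "u n" "Bop L"] by simp
  then have "(\<lambda>n. norm (u n - Bop L)) \<longlonglongrightarrow> 0"
    using L by (simp add: LIM_zero tendsto_norm_zero)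
  then have "u \<longlonglongrightarrow> Bop L"
    by (simp add: tendsto_norm_zero_iff LIM_zero_iff)
  then show "convergent u" by (auto simp: convergent_def)
qed

lemma ex_bop_of_form:
  fixes f :: "'h::complex_hilbert \<Rightarrow> 'h \<Rightarrow> complex"
  assumes "\<And>x y z. f (x + y) z = f x z + f y z" "\<And>c x z. f (c *\<^sub>C x) z = c * f x z"
    and "\<And>x y z. f z (x + y) = f z x + f z y" "\<And>c x z. f z (c *\<^sub>C x) = cnj c * f z x"
    and bd: "\<And>x y. cmod (f x y) \<le> K * norm x * norm y"
  shows "\<exists>T::'h bop. \<forall>x y. cinner (T x) y = f x y"
proof -
  \<comment> \<open>In its second variable the form is conjugate linear, so the Riesz theorem is
    applied to its conjugate.\<close>
  have "\<exists>v. \<forall>y. cnj (f x y) = cinner y v" for x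
    using bd[of x] by (intro riesz_hilbert[where K = "K * norm x"]) (auto simp: assms)
  then obtain g where g: "\<And>x y. cnj (f x y) = cinner y (g x)" by metis
  have gf: "cinner (g x) y = f x y" for x y
    using g[of x y] cinner_commute[of "g x" y] by (metis complex_cnj_cnj)
  have "bop_apply (bop_of g) x = g x" for x
  proof (rule bop_of_apply[where K = "K"])
    show "g (x + y) = g x + g y" for x y
      by (rule cinner_eqI) (simp add: gf cinner_simps assms)
    show "g (c *\<^sub>C x) = c *\<^sub>C g x" for c x
      by (rule cinner_eqI) (simp add: gf cinner_simps assms)
    show "norm (g x) \<le> K * norm x" for x
    proof (cases "g x = 0")
      case True
      \<comment> \<open>The sign of \<open>K\<close> is not given; the bound at
        \<open>(x, x)\<close> supplies what is needed.\<close>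
      have "0 \<le> K * norm x * norm x"
        using bd[of x x] norm_ge_zero order_trans by blast
      then show ?thesis using True by (auto simp: zero_le_mult_iff)
    next
      case False
      have "norm (g x) * norm (g x) = cmod (cinner (g x) (g x))"
        by (simp add: cinner_self norm_mult power2_eq_square)
      also have "\<dots> \<le> (K * norm x) * norm (g x)"
        by (simp add: gf bd)
      finally show ?thesis using False by simp
    qed
  qed
  then show ?thesis using gf by metis
qed

text \<open>\<open>bop_adj\<close> is a definite description, so both existence and uniqueness of
  the adjoint are settled here; existence comes from representing the form that sends
  \<open>x, y\<close> to \<open>cinner x (T y)\<close>.\<close>

lemma cinner_bop_adj: "cinner (T x) y = cinner x (bop_adj T y)" for T :: "'h::complex_hilbert bop"
proof -
  have "\<exists>S::'h bop. \<forall>x y. cinner (S x) y = cinner x (T y)"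
  proof (rule ex_bop_of_form[where K = "norm T"])
    show "cmod (cinner x (T y)) \<le> norm T * norm x * norm y" for x y
      using cinner_cauchy_schwarz[of x "T y"] mult_left_mono[OF norm_bop_apply[of T y] norm_ge_zero[of x]]
      by (simp add: algebra_simps)
  qed (auto simp: cinner_simps bop_add_arg bop_scaleC_arg)
  then obtain S :: "'h bop" where "\<forall>x y. cinner (S x) y = cinner x (T y)" by blast
  then have S: "\<forall>x y. cinner (T x) y = cinner x (S y)"
    by (metis cinner_commute)
  have "\<forall>x y. cinner (T x) y = cinner x (bop_adj T y)"
    unfolding bop_adj_def
  proof (rule theI[where P = "\<lambda>S. \<forall>x y. cinner (T x) y = cinner x (bop_apply S y)"])
    show "\<forall>x y. cinner (T x) y = cinner x (S y)" by fact
    show "S' = S" if "\<forall>x y. cinner (T x) y = cinner x (bop_apply S' y)" for S'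
      using S that by (metis bop_eqI cinner_eqI_right)
  qed
  then show ?thesis by blast
qed

lemma cinner_bop_adj_left: "cinner (bop_adj T x) y = cinner x (T y)" for T :: "'h::complex_hilbert bop"
  by (metis cinner_bop_adj cinner_commute)

lemma bop_adj_eqI: "(\<And>x y. cinner (S x) y = cinner x (T y)) \<Longrightarrow> bop_adj T = S"
  for S T :: "'h::complex_hilbert bop"
  by (rule bop_eqI_cinner) (simp add: cinner_bop_adj_left)

lemma bop_adj_simps:
  fixes S T :: "'h::complex_hilbert bop"
  shows "bop_adj (bop_adj T) = T" "bop_adj (S + T) = bop_adj S + bop_adj T"
    "bop_adj (c *\<^sub>C T) = cnj c *\<^sub>C bop_adj T" "bop_adj (S * T) = bop_adj T * bop_adj S"
    "bop_adj 1 = (1 :: 'h bop)" "bop_adj 0 = (0 :: 'h bop)"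
  by (rule bop_adj_eqI; simp add: cinner_bop_adj_left cinner_bop_adj cinner_simps bop_adj_eqI)+

lemma bop_mult_scaleC [simp]:
  fixes S T :: "'h::complex_hilbert bop"
  shows "(c *\<^sub>C S) * T = c *\<^sub>C (S * T)" "S * (c *\<^sub>C T) = c *\<^sub>C (S * T)"
  by (rule bop_eqI; simp add: bop_scaleC_arg)+

text \<open>For a positive operator the quadratic form controls the norm: Cauchy-Schwarz for the
  form of \<open>T\<close> at the pair \<open>T x\<close>, \<open>x\<close> bounds the fourth power
  of \<open>norm (T x)\<close> by the product of the form at \<open>T x\<close> and the form at
  \<open>x\<close>.\<close>

lemma norm_bop_positive_le:
  fixes T :: "'h::complex_hilbert bop"
  assumes "bop_positive T" and C: "0 \<le> C" "\<And>x. Re (cinner (T x) x) \<le> C * (norm x)\<^sup>2"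
  shows "norm T \<le> C"
proof (rule norm_bop_le[OF C(1)])
  fix x
  let ?y = "T x"
  have pos: "cinner (T x) x \<in> \<real>\<^sub>\<ge>\<^sub>0" for x
    using assms(1) by (simp add: bop_positive_def)
  have "cinner (T ?y) ?y + c * cinner (T x) ?y + cnj c * cinner (T ?y) x + c * cnj c * cinner (T x) x \<in> \<real>\<^sub>\<ge>\<^sub>0" for c
    using pos[of "?y + c *\<^sub>C x"] by (simp add: bop_add_arg bop_scaleC_arg cinner_simps algebra_simps)
  from nonneg_quadratic_form(2)[OF this]
  have "((norm ?y)\<^sup>2)\<^sup>2 \<le> Re (cinner (T ?y) ?y) * Re (cinner (T x) x)"
    by (simp add: cinner_self norm_power)
  also have "\<dots> \<le> (C * (norm ?y)\<^sup>2) * (C * (norm x)\<^sup>2)"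
    using pos[of x] C by (intro mult_mono) (auto simp: complex_nonneg_Reals_iff)
  finally have "(norm ?y)\<^sup>2 * (norm ?y)\<^sup>2 \<le> (C * norm x)\<^sup>2 * (norm ?y)\<^sup>2"
    by (simp add: power2_eq_square algebra_simps)
  then have "?y = 0 \<or> (norm ?y)\<^sup>2 \<le> (C * norm x)\<^sup>2"
    by (meson mult_right_le_imp_le zero_less_norm_iff zero_less_power)
  then show "norm ?y \<le> C * norm x"
    using C(1) by (auto intro: power2_le_imp_le)
qed

text \<open>A unit vector, or \<open>0\<close> when the space is trivial: \<open>\<langle>w, w\<rangle> h = h\<close> for all \<open>h\<close> in either case, so that
  the zero space needs no separate treatment.\<close>

definition unit_vec :: "'h::complex_hilbert"
  where "unit_vec = (SOME w. \<forall>h::'h. cinner w w *\<^sub>C h = h)"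

lemma unit_vec: "cinner (unit_vec::'h) unit_vec *\<^sub>C (h::'h::complex_hilbert) = h"
proof -
  have "\<exists>w::'h. \<forall>h::'h. cinner w w *\<^sub>C h = h"
  proof (cases "\<exists>x::'h. x \<noteq> 0")
    case True
    then obtain x :: 'h where "x \<noteq> 0" by blast
    then have "cinner (complex_of_real (1 / norm x) *\<^sub>C x) (complex_of_real (1 / norm x) *\<^sub>C x) = 1"
      by (simp add: cinner_self norm_scaleC norm_divide)
    then show ?thesis by (metis scaleC_one)
  next
    case False
    then show ?thesis by (metis (full_types))
  qed
  from someI_ex[OF this] show ?thesis
    unfolding unit_vec_def by (rule spec)
qed

lemma cinner_unit_vec: "cinner (unit_vec::'h) unit_vec * cinner x y = cinner x (y::'h::complex_hilbert)"
  by (metis cinner_scaleC_left unit_vec)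

lemma cinner_unit_vec_right: "cinner x y * cinner (unit_vec::'h) unit_vec = cinner x (y::'h::complex_hilbert)"
  by (metis cinner_unit_vec mult.commute)

lemma norm_unit_vec_le: "norm (unit_vec::'h::complex_hilbert) \<le> 1"
proof (cases "(unit_vec::'h) = 0")
  case False
  have "cinner (unit_vec::'h) unit_vec * cinner (unit_vec::'h) unit_vec = cinner (unit_vec::'h) unit_vec"
    by (rule cinner_unit_vec)
  then have "complex_of_real (norm (unit_vec::'h) * norm (unit_vec::'h)) = of_real 1"
    using False by (simp add: cinner_self power2_eq_square)
  then have "norm (unit_vec::'h) * norm (unit_vec::'h) = 1"
    by (simp only: of_real_eq_iff)
  then show ?thesis by (auto simp: square_eq_1_iff)
qed simp

section \<open>Rank one operators over the distinguished vector\<close>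

definition ket :: "'h::complex_hilbert \<Rightarrow> 'h bop"
  where "ket h = bop_of (\<lambda>k. cinner k unit_vec *\<^sub>C h)"

lemma ket_apply: "ket h k = cinner k unit_vec *\<^sub>C h"
  unfolding ket_def
proof (rule bop_of_apply[where K = "norm h"])
  show "norm (cinner x unit_vec *\<^sub>C h) \<le> norm h * norm x" for x
    using order_trans[OF cinner_cauchy_schwarz[of x unit_vec] mult_left_le[OF norm_unit_vec_le norm_ge_zero]]
    by (simp add: norm_scaleC mult_left_mono mult.commute)
qed (auto simp: cinner_simps scaleC_add_left scaleC_scaleC)

lemma ket_unit_vec [simp]: "ket h unit_vec = h"
  by (simp add: ket_apply unit_vec)

lemma bop_mult_ket: "T * ket h = ket (T h)"
  by (rule bop_eqI) (simp add: ket_apply bop_scaleC_arg)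

lemma ket_add: "ket (h + k) = ket h + ket k"
  by (rule bop_eqI) (simp add: ket_apply scaleC_add_right)

lemma ket_scaleC: "ket (c *\<^sub>C h) = c *\<^sub>C ket h"
  by (rule bop_eqI) (simp add: ket_apply scaleC_scaleC mult.commute)

lemma ket_adj: "bop_adj (ket h) k = cinner k h *\<^sub>C unit_vec"
  by (rule cinner_eqI) (simp add: cinner_bop_adj_left ket_apply cinner_simps, metis cinner_commute mult.commute)

lemma bop_eqI_ket: "(\<And>h. S * ket h = T * ket h) \<Longrightarrow> S = T"
  by (metis bop_eqI bop_mult_ket ket_unit_vec)

section \<open>Inner product modules\<close>

text \<open>\<^locale>\<open>hilbert_module\<close> without completeness, and with the vector space and module axioms
  replaced by their only consequence needed below: an element is determined by its inner products.\<close>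

locale ip_module =
  fixes M :: "('x, 'h::complex_hilbert bop) hmod"
  assumes carrier_hadd [simp]: "\<lbrakk>x \<in> carrier M; y \<in> carrier M\<rbrakk> \<Longrightarrow> hadd M x y \<in> carrier M"
    and carrier_hzero [simp]: "hzero M \<in> carrier M"
    and carrier_hscale [simp]: "x \<in> carrier M \<Longrightarrow> hscale M c x \<in> carrier M"
    and carrier_hact [simp]: "x \<in> carrier M \<Longrightarrow> hact M x b \<in> carrier M"
    and ip_hadd: "\<lbrakk>x \<in> carrier M; y \<in> carrier M; z \<in> carrier M\<rbrakk> \<Longrightarrow>
      hip M (hadd M x y) z = hip M x z + hip M y z"
    and ip_hscale: "\<lbrakk>x \<in> carrier M; y \<in> carrier M\<rbrakk> \<Longrightarrow>
      hip M (hscale M c x) y = c *\<^sub>C hip M x y"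
    and ip_hact: "\<lbrakk>x \<in> carrier M; y \<in> carrier M\<rbrakk> \<Longrightarrow> hip M (hact M x b) y = hip M x y * b"
    and ip_hzero [simp]: "x \<in> carrier M \<Longrightarrow> hip M (hzero M) x = 0"
    and ip_commute: "\<lbrakk>x \<in> carrier M; y \<in> carrier M\<rbrakk> \<Longrightarrow> hip M y x = bop_adj (hip M x y)"
    and ip_positive: "x \<in> carrier M \<Longrightarrow> bop_positive (hip M x x)"
    and ip_eqI: "\<lbrakk>x \<in> carrier M; y \<in> carrier M; \<And>z. z \<in> carrier M \<Longrightarrow> hip M x z = hip M y z\<rbrakk> \<Longrightarrow> x = y"

sublocale hilbert_module \<subseteq> ip_module
proof
  note cl [simp] = hadd_closed hzero_closed hscale_closed hact_closed
  fix x y assume x: "x \<in> carrier M"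
  have "hip M (hzero M) x = hip M (hzero M) x + hip M (hzero M) x"
    using hip_hadd[of "hzero M" "hzero M" x] x by (simp add: hadd_zero)
  then show "hip M (hzero M) x = 0" by simp
  assume y: "y \<in> carrier M" and eq: "\<And>z. z \<in> carrier M \<Longrightarrow> hip M x z = hip M y z"
  let ?d = "hadd M x (hscale M (-1) y)"
  have "hip M ?d ?d = 0"
    using x y by (simp add: hip_hadd hip_hscale eq)
  then have d: "?d = hzero M"
    using x y by (intro hip_definite) auto
  have "x = hadd M x (hadd M (hscale M (-1) y) y)"
    using x y by (simp add: hadd_inverse hadd_commute[of _ y] hadd_zero hadd_commute[of x "hzero M"])
  also have "\<dots> = hadd M ?d y"
    using x y by (simp add: hadd_assoc)
  also have "\<dots> = y"
    using d y by (simp add: hadd_zero)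
  finally show "x = y" .
qed (rule hadd_closed hzero_closed hscale_closed hact_closed hip_hadd hip_hscale hip_hact
    hip_commute hip_positive; assumption)+

section \<open>The scalar form and its comparison with the module norm\<close>

context ip_module
begin

lemma ip_hadd_right:
  "\<lbrakk>x \<in> carrier M; y \<in> carrier M; z \<in> carrier M\<rbrakk> \<Longrightarrow> hip M z (hadd M x y) = hip M z x + hip M z y"
  by (simp add: ip_commute[of "hadd M x y" z] ip_commute[of x z] ip_commute[of y z] ip_hadd bop_adj_simps)

lemma ip_hscale_right:
  "\<lbrakk>x \<in> carrier M; y \<in> carrier M\<rbrakk> \<Longrightarrow> hip M y (hscale M c x) = cnj c *\<^sub>C hip M y x"
  by (metis carrier_hscale ip_commute ip_hscale bop_adj_simps(3))

lemma ip_hact_right: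
  "\<lbrakk>x \<in> carrier M; y \<in> carrier M\<rbrakk> \<Longrightarrow> hip M y (hact M x b) = bop_adj b * hip M y x"
  by (metis carrier_hact ip_commute ip_hact bop_adj_simps(4))

lemma ip_hzero_right [simp]: "x \<in> carrier M \<Longrightarrow> hip M x (hzero M) = 0"
  by (metis carrier_hzero ip_commute ip_hzero bop_adj_simps(6))

lemma carrier_hdiff [simp]: "\<lbrakk>x \<in> carrier M; y \<in> carrier M\<rbrakk> \<Longrightarrow> hdiff M x y \<in> carrier M"
  by (simp add: hdiff_def)

lemma ip_hdiff:
  "\<lbrakk>x \<in> carrier M; y \<in> carrier M; z \<in> carrier M\<rbrakk> \<Longrightarrow> hip M (hdiff M x y) z = hip M x z - hip M y z"
  by (simp add: hdiff_def ip_hadd ip_hscale)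

lemma ip_hdiff_right:
  "\<lbrakk>x \<in> carrier M; y \<in> carrier M; z \<in> carrier M\<rbrakk> \<Longrightarrow> hip M z (hdiff M x y) = hip M z x - hip M z y"
  by (simp add: hdiff_def ip_hadd_right ip_hscale_right)

lemmas ip_left = ip_hadd ip_hscale ip_hact ip_hdiff
lemmas ip_right = ip_hadd_right ip_hscale_right ip_hact_right ip_hdiff_right

definition s :: "'x \<Rightarrow> 'x \<Rightarrow> complex"
  where "s x y = cinner (hip M x y unit_vec) unit_vec"

sublocale s: semi_inner_product "carrier M" "hadd M" "hscale M" s
proof
  fix x y assume "x \<in> carrier M" "y \<in> carrier M"
  then have "hip M x y = bop_adj (hip M y x)"
    by (rule ip_commute[rotated])
  then show "s x y = cnj (s y x)"
    by (simp add: s_def cinner_bop_adj_left) (rule cinner_commute)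
next
  fix x assume "x \<in> carrier M"
  then show "s x x \<in> \<real>\<^sub>\<ge>\<^sub>0"
    using ip_positive by (auto simp: s_def bop_positive_def)
qed (auto simp: s_def ip_left cinner_simps)

abbreviation (input) sn where "sn \<equiv> s.seminorm"

abbreviation (input) sdist where "sdist x y \<equiv> s.seminorm (hadd M x (hscale M (-1) y))"

lemmas s_simps = s.ip_add_left s.ip_add_right s.ip_scale_left s.ip_scale_right

lemma s_hdiff_left: "\<lbrakk>x \<in> carrier M; y \<in> carrier M; z \<in> carrier M\<rbrakk> \<Longrightarrow> s (hdiff M x y) z = s x z - s y z"
  by (simp add: hdiff_def s_simps)

lemma s_hdiff_right: "\<lbrakk>x \<in> carrier M; y \<in> carrier M; z \<in> carrier M\<rbrakk> \<Longrightarrow> s z (hdiff M x y) = s z x - s z y"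
  by (simp add: hdiff_def s_simps)

lemma s_ket: "\<lbrakk>x \<in> carrier M; y \<in> carrier M\<rbrakk> \<Longrightarrow>
    s (hact M x (ket h)) (hact M y (ket k)) = cinner (hip M x y h) k"
  by (simp add: s_def ip_left ip_right ket_adj cinner_simps cinner_unit_vec_right)

lemma s_ket_right: "\<lbrakk>x \<in> carrier M; y \<in> carrier M\<rbrakk> \<Longrightarrow>
    s x (hact M y (ket k)) = cinner (hip M x y unit_vec) k"
  by (simp add: s_def ip_left ip_right ket_adj cinner_simps cinner_unit_vec_right)

lemma s_ket_left: "\<lbrakk>x \<in> carrier M; y \<in> carrier M\<rbrakk> \<Longrightarrow>
    s (hact M x (ket h)) y = cinner (hip M x y h) unit_vec"
  by (simp add: s_def ip_left)

text \<open>\<open>ket unit_vec\<close> is the projection onto the line of \<open>unit_vec\<close>,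
  so \<open>s\<close> cannot tell \<open>x\<close> from its compression by it. A vector may
  therefore be replaced by its compression, for which the module norm is controlled by
  \<open>s\<close>.\<close>

lemma s_ket_unit [simp]:
  "\<lbrakk>x \<in> carrier M; y \<in> carrier M\<rbrakk> \<Longrightarrow> s (hact M x (ket unit_vec)) y = s x y"
  "\<lbrakk>x \<in> carrier M; y \<in> carrier M\<rbrakk> \<Longrightarrow> s y (hact M x (ket unit_vec)) = s y x"
  by (simp_all add: s_ket_left s_ket_right) (simp_all add: s_def)

lemma sn_ket_unit [simp]: "x \<in> carrier M \<Longrightarrow> sn (hact M x (ket unit_vec)) = sn x"
  by (simp add: s.seminorm_def)

text \<open>Twisting the two arguments by \<open>ket h\<close> and \<open>ket k\<close> turns
  \<open>s\<close> into the matrix coefficients of the operator-valued inner product; the second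
  twist is absorbed into \<open>z\<close>.\<close>

lemma ip_eqI_s:
  assumes "x \<in> carrier M" "y \<in> carrier M"
    and "\<And>h z. z \<in> carrier M \<Longrightarrow> s (hact M x (ket h)) z = s (hact M y (ket h)) z"
  shows "x = y"
proof (rule ip_eqI[OF assms(1,2)])
  fix z assume z: "z \<in> carrier M"
  have "cinner (hip M x z h) k = cinner (hip M y z h) k" for h k
    using assms(3)[of "hact M z (ket k)" h] z assms(1,2) by (simp add: s_ket)
  then show "hip M x z = hip M y z"
    by (rule bop_eqI_cinner)
qed

lemma hact_ket_add: "x \<in> carrier M \<Longrightarrow> hact M x (ket (h + k)) = hadd M (hact M x (ket h)) (hact M x (ket k))"
  by (rule ip_eqI) (simp_all add: ip_left ket_add distrib_left)

lemma hact_ket_scaleC: "x \<in> carrier M \<Longrightarrow> hact M x (ket (c *\<^sub>C h)) = hscale M c (hact M x (ket h))"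
  by (rule ip_eqI) (simp_all add: ip_left ket_scaleC)

lemma hact_hact: "x \<in> carrier M \<Longrightarrow> hact M (hact M x b) c = hact M x (b * c)"
  by (rule ip_eqI) (simp_all add: ip_left mult.assoc)

lemma hact_hadd_distrib:
  "\<lbrakk>x \<in> carrier M; y \<in> carrier M\<rbrakk> \<Longrightarrow> hact M (hadd M x y) b = hadd M (hact M x b) (hact M y b)"
  by (rule ip_eqI) (simp_all add: ip_left distrib_right)

lemma hact_hscale_distrib: "x \<in> carrier M \<Longrightarrow> hact M (hscale M c x) b = hscale M c (hact M x b)"
  by (rule ip_eqI) (simp_all add: ip_left)

lemma hact_hdiff_distrib:
  "\<lbrakk>x \<in> carrier M; y \<in> carrier M\<rbrakk> \<Longrightarrow> hact M (hdiff M x y) b = hdiff M (hact M x b) (hact M y b)"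
  by (rule ip_eqI) (simp_all add: ip_left left_diff_distrib)

abbreviation (input) hdist where "hdist x y \<equiv> hnorm M (hdiff M x y)"

lemma hnorm_nonneg [simp]: "hnorm M x \<ge> 0"
  by (simp add: hnorm_def)

lemma sn_hact_ket_sq: "x \<in> carrier M \<Longrightarrow> (sn (hact M x (ket h)))\<^sup>2 = Re (cinner (hip M x x h) h)"
  by (simp add: s.seminorm_sq s_ket)

lemma sn_hact_ket_le:
  assumes x: "x \<in> carrier M"
  shows "sn (hact M x (ket h)) \<le> hnorm M x * norm h"
proof (rule power2_le_imp_le)
  have "Re (cinner (hip M x x h) h) \<le> norm (hip M x x h) * norm h"
    using cinner_cauchy_schwarz complex_Re_le_cmod order_trans by blast
  also have "\<dots> \<le> norm (hip M x x) * norm h * norm h"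
    by (intro mult_right_mono norm_bop_apply) auto
  finally show "(sn (hact M x (ket h)))\<^sup>2 \<le> (hnorm M x * norm h)\<^sup>2"
    using x by (simp add: sn_hact_ket_sq hnorm_def power_mult_distrib) (simp add: power2_eq_square mult.assoc)
qed simp

text \<open>Converse of \<open>sn_hact_ket_le\<close>: the module norm is the least constant in that
  estimate. Norm inequalities in the module, the triangle inequality among them, thus reduce to
  inequalities for the seminorm of \<open>s\<close>.\<close>

lemma hnorm_le:
  assumes x: "x \<in> carrier M" and C: "0 \<le> C" "\<And>h. sn (hact M x (ket h)) \<le> C * norm h"
  shows "hnorm M x \<le> C"
proof -
  have "norm (hip M x x) \<le> C\<^sup>2"
  proof (rule norm_bop_positive_le)
    show "Re (cinner (hip M x x h) h) \<le> C\<^sup>2 * (norm h)\<^sup>2" for h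
      using power_mono[OF C(2)[of h], of 2] x by (simp add: sn_hact_ket_sq power_mult_distrib)
  qed (use x in \<open>auto simp: ip_positive\<close>)
  then show ?thesis
    using C(1) by (simp add: hnorm_def real_le_lsqrt)
qed

lemma sn_le_hnorm: "x \<in> carrier M \<Longrightarrow> sn x \<le> hnorm M x"
  using sn_hact_ket_le[of x unit_vec] mult_left_le[OF norm_unit_vec_le[where 'h = 'h], of "hnorm M x"]
  by (simp add: mult.commute)

text \<open>On compressed vectors a further twist by \<open>ket h\<close> is multiplication by the
  scalar \<open>cinner h unit_vec\<close>, so the seminorm of \<open>s\<close> already bounds the
  module norm.\<close>

lemma hnorm_ket_unit: "x \<in> carrier M \<Longrightarrow> hnorm M (hact M x (ket unit_vec)) \<le> sn x"
proof (rule hnorm_le)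
  fix h :: 'h
  assume x: "x \<in> carrier M"
  have "hact M (hact M x (ket unit_vec)) (ket h) = hscale M (cinner h unit_vec) (hact M x (ket unit_vec))"
    using x by (simp add: hact_hact bop_mult_ket ket_apply hact_ket_scaleC)
  then have "sn (hact M (hact M x (ket unit_vec)) (ket h)) = cmod (cinner h unit_vec) * sn x"
    using x by (simp add: s.seminorm_scale)
  also have "\<dots> \<le> norm h * sn x"
    using order_trans[OF cinner_cauchy_schwarz[of h unit_vec] mult_left_le[OF norm_unit_vec_le norm_ge_zero]] x
    by (intro mult_right_mono) auto
  finally show "sn (hact M (hact M x (ket unit_vec)) (ket h)) \<le> sn x * norm h"
    by (simp add: mult.commute)
qed auto

lemma hnorm_hadd:
  assumes "x \<in> carrier M" "y \<in> carrier M"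
  shows "hnorm M (hadd M x y) \<le> hnorm M x + hnorm M y"
proof (rule hnorm_le)
  fix h
  have "sn (hact M (hadd M x y) (ket h)) \<le> sn (hact M x (ket h)) + sn (hact M y (ket h))"
    using assms by (simp add: hact_hadd_distrib s.seminorm_triangle)
  also have "\<dots> \<le> hnorm M x * norm h + hnorm M y * norm h"
    using assms by (intro add_mono sn_hact_ket_le)
  finally show "sn (hact M (hadd M x y) (ket h)) \<le> (hnorm M x + hnorm M y) * norm h"
    by (simp add: distrib_right)
qed (use assms in auto)

lemma hnorm_hscale: "x \<in> carrier M \<Longrightarrow> hnorm M (hscale M c x) = cmod c * hnorm M x"
  by (simp add: hnorm_def ip_left ip_right norm_scaleC real_sqrt_mult flip: power2_eq_square mult.assoc)

lemma hnorm_hdiff_commute: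
  assumes "x \<in> carrier M" "y \<in> carrier M"
  shows "hdist x y = hdist y x"
proof -
  have "hdiff M x y = hscale M (-1) (hdiff M y x)"
    using assms by (intro ip_eqI) (auto simp: ip_left)
  then show ?thesis using assms by (simp add: hnorm_hscale)
qed

lemma hnorm_hdiff_triangle:
  assumes "x \<in> carrier M" "y \<in> carrier M" "z \<in> carrier M"
  shows "hdist x z \<le> hdist x y + hdist y z"
proof -
  have "hdiff M x z = hadd M (hdiff M x y) (hdiff M y z)"
    using assms by (intro ip_eqI) (auto simp: ip_left)
  then show ?thesis using assms by (simp add: hnorm_hadd)
qed

lemma hnorm_hzero [simp]: "hnorm M (hzero M) = 0"
  by (simp add: hnorm_def)

lemma hdiff_self [simp]: "x \<in> carrier M \<Longrightarrow> hdiff M x x = hzero M"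
  by (rule ip_eqI) (auto simp: ip_left)

lemma hnorm_eq_0:
  assumes "x \<in> carrier M" "hnorm M x = 0"
  shows "x = hzero M"
proof (rule ip_eqI_s)
  fix h z assume z: "z \<in> carrier M"
  have "sn (hact M x (ket h)) = 0"
    using sn_hact_ket_le[of x h] assms by (intro antisym) auto
  then have "s (hact M x (ket h)) z = 0"
    using s.cauchy_schwarz[of "hact M x (ket h)" z] assms z by simp
  moreover have "s (hact M (hzero M) (ket h)) z = 0"
    using z by (simp add: s_def ip_left)
  ultimately show "s (hact M x (ket h)) z = s (hact M (hzero M) (ket h)) z" by simp
qed (use assms in auto)

lemma norm_hip_le:
  assumes "x \<in> carrier M" "y \<in> carrier M"
  shows "norm (hip M x y) \<le> hnorm M x * hnorm M y"
proof (rule norm_bop_le)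
  fix h
  \<comment> \<open>Pairing \<open>x\<close> twisted by \<open>h\<close> with \<open>y\<close>
    twisted by \<open>?k\<close> yields the squared norm of \<open>?k\<close>.\<close>
  let ?k = "hip M x y h"
  have "(norm ?k)\<^sup>2 = cmod (s (hact M x (ket h)) (hact M y (ket ?k)))"
    using assms by (simp add: s_ket cinner_self norm_power)
  also have "\<dots> \<le> (hnorm M x * norm h) * (hnorm M y * norm ?k)"
    using assms by (intro order_trans[OF s.cauchy_schwarz] mult_mono sn_hact_ket_le) auto
  finally have "norm ?k * norm ?k \<le> (hnorm M x * hnorm M y * norm h) * norm ?k"
    by (simp add: power2_eq_square algebra_simps)
  then show "norm ?k \<le> hnorm M x * hnorm M y * norm h"
    by (cases "?k = 0") auto
qed simp

lemma hip_tendsto_left: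
  assumes "\<And>n. u n \<in> carrier M" "x \<in> carrier M" "(\<lambda>n. hdist (u n) x) \<longlonglongrightarrow> 0" "y \<in> carrier M"
  shows "(\<lambda>n::nat. hip M (u n) y) \<longlonglongrightarrow> hip M x y"
proof -
  have "\<forall>n. norm (hip M (u n) y - hip M x y) \<le> hdist (u n) x * hnorm M y"
    using norm_hip_le[of "hdiff M (u _) x" y] assms by (simp add: ip_left)
  moreover have "(\<lambda>n. hdist (u n) x * hnorm M y) \<longlonglongrightarrow> 0"
    using assms(3) by (rule tendsto_mult_left_zero)
  ultimately have "(\<lambda>n. hip M (u n) y - hip M x y) \<longlonglongrightarrow> 0"
    by (rule Lim_null_comparison[OF always_eventually])
  then show ?thesis by (simp add: LIM_zero_iff)
qed

lemma hip_tendsto_right: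
  assumes "\<And>n. u n \<in> carrier M" "x \<in> carrier M" "(\<lambda>n. hdist (u n) x) \<longlonglongrightarrow> 0" "y \<in> carrier M"
  shows "(\<lambda>n::nat. hip M y (u n)) \<longlonglongrightarrow> hip M y x"
proof -
  have "\<forall>n. norm (hip M y (u n) - hip M y x) \<le> hnorm M y * hdist (u n) x"
    using norm_hip_le[of y "hdiff M (u _) x"] assms by (simp add: ip_right)
  moreover have "(\<lambda>n. hnorm M y * hdist (u n) x) \<longlonglongrightarrow> 0"
    using assms(3) by (rule tendsto_mult_right_zero)
  ultimately have "(\<lambda>n. hip M y (u n) - hip M y x) \<longlonglongrightarrow> 0"
    by (rule Lim_null_comparison[OF always_eventually])
  then show ?thesis by (simp add: LIM_zero_iff)
qed

end

text \<open>Compression by \<open>ket unit_vec\<close> makes a sequence that is Cauchy for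
  \<open>s\<close> Cauchy in the module norm. The limit of the compressed sequence is also a limit
  of the original one for \<open>s\<close>, which does not notice the compression.\<close>

lemma (in hilbert_module) s_complete: "s.seminorm_complete"
  unfolding s.seminorm_complete_def
proof (intro allI impI)
  fix u :: "nat \<Rightarrow> 'x"
  assume "\<forall>n. u n \<in> carrier M"
    and C: "\<forall>\<epsilon>>0. \<exists>N. \<forall>m\<ge>N. \<forall>n\<ge>N. sn (hadd M (u m) (hscale M (- 1) (u n))) < \<epsilon>"
  then have u: "\<And>n. u n \<in> carrier M" by simp
  let ?v = "\<lambda>n. hact M (u n) (ket unit_vec)"
  have "\<exists>x\<in>carrier M. (\<lambda>n. hdist (?v n) x) \<longlonglongrightarrow> 0"
  proof (rule hcomplete)
    fix \<epsilon> :: real assume "\<epsilon> > 0"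
    moreover have "hdist (?v m) (?v n) \<le> sn (hdiff M (u m) (u n))" for m n
      using u hnorm_ket_unit[of "hdiff M (u m) (u n)"] by (simp add: hact_hdiff_distrib)
    ultimately show "\<exists>N. \<forall>m\<ge>N. \<forall>n\<ge>N. hdist (?v m) (?v n) < \<epsilon>"
      using C unfolding hdiff_def by (meson le_less_trans)
  qed (use u in auto)
  then obtain x where x: "x \<in> carrier M" "(\<lambda>n. hdist (?v n) x) \<longlonglongrightarrow> 0" by blast
  have "sn (hdiff M (u n) x) \<le> hdist (?v n) x" for n
  proof -
    have "sn (hdiff M (u n) x) = sn (hdiff M (?v n) x)"
      using u x by (simp add: s.seminorm_def s_hdiff_left s_hdiff_right)
    then show ?thesis using u x by (simp add: sn_le_hnorm)
  qed
  then have "(\<lambda>n. sn (hdiff M (u n) x)) \<longlonglongrightarrow> 0"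
    using u x by (intro tendsto_sandwich[OF _ _ tendsto_const x(2)]) auto
  then show "\<exists>x\<in>carrier M. (\<lambda>n. sn (hadd M (u n) (hscale M (- 1) x))) \<longlonglongrightarrow> 0"
    using x unfolding hdiff_def by blast
qed

subsection \<open>Adjointable operators\<close>

context ip_module
begin

lemma op_eqI:
  assumes "S \<in> carrier M \<rightarrow>\<^sub>E carrier M" "T \<in> carrier M \<rightarrow>\<^sub>E carrier M"
    and "\<And>x y. \<lbrakk>x \<in> carrier M; y \<in> carrier M\<rbrakk> \<Longrightarrow> hip M (S x) y = hip M (T x) y"
  shows "S = T"
  using assms by (intro PiE_ext[OF assms(1,2)] ip_eqI) auto

lemma ip_eqI_right:
  assumes "x \<in> carrier M" "y \<in> carrier M" "\<And>z. z \<in> carrier M \<Longrightarrow> hip M z x = hip M z y"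
  shows "x = y"
  using assms by (metis ip_commute ip_eqI)

lemma hadj_eqI:
  assumes "is_adjoint M T S"
  shows "hadj M T = S"
  unfolding hadj_def
proof (rule the_equality[where P = "is_adjoint M T", OF assms])
  fix S' assume "is_adjoint M T S'"
  then show "S' = S"
    using assms unfolding is_adjoint_def by (intro PiE_ext[of _ "carrier M" "\<lambda>_. carrier M"] ip_eqI_right) (auto dest: PiE_mem)
qed

lemma is_adjoint_hadj: "T \<in> adjointable M \<Longrightarrow> is_adjoint M T (hadj M T)"
  unfolding adjointable_def using hadj_eqI by blast

lemma adjointable_closed [simp]: "\<lbrakk>T \<in> adjointable M; x \<in> carrier M\<rbrakk> \<Longrightarrow> T x \<in> carrier M"
  by (auto simp: adjointable_def)

lemma adjointable_PiE: "T \<in> adjointable M \<Longrightarrow> T \<in> carrier M \<rightarrow>\<^sub>E carrier M"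
  by (auto simp: adjointable_def)

lemma ip_hadj: "\<lbrakk>T \<in> adjointable M; x \<in> carrier M; y \<in> carrier M\<rbrakk> \<Longrightarrow> hip M (T x) y = hip M x (hadj M T y)"
  using is_adjoint_hadj by (auto simp: is_adjoint_def)

lemma adjointableI:
  assumes "T \<in> carrier M \<rightarrow>\<^sub>E carrier M" "S \<in> carrier M \<rightarrow>\<^sub>E carrier M"
    and "\<And>x y. \<lbrakk>x \<in> carrier M; y \<in> carrier M\<rbrakk> \<Longrightarrow> hip M (T x) y = hip M x (S y)"
  shows "T \<in> adjointable M" and "hadj M T = S"
proof -
  have "is_adjoint M T S" using assms by (simp add: is_adjoint_def)
  then show "T \<in> adjointable M" "hadj M T = S"
    using assms(1) hadj_eqI by (auto simp: adjointable_def)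
qed

lemma hadj_adjointable [simp]: "T \<in> adjointable M \<Longrightarrow> hadj M T \<in> adjointable M"
  and hadj_hadj [simp]: "T \<in> adjointable M \<Longrightarrow> hadj M (hadj M T) = T"
proof -
  assume T: "T \<in> adjointable M"
  have mem: "hadj M T \<in> carrier M \<rightarrow>\<^sub>E carrier M"
    using is_adjoint_hadj[OF T] by (simp add: is_adjoint_def)
  have *: "hip M (hadj M T x) y = hip M x (T y)" if "x \<in> carrier M" "y \<in> carrier M" for x y
    using ip_hadj[OF T that(2,1)] mem that T PiE_mem[OF mem that(1)]
    by (metis adjointable_closed ip_commute)
  show "hadj M T \<in> adjointable M" "hadj M (hadj M T) = T"
    using adjointableI[OF mem adjointable_PiE[OF T] *] by auto
qed

lemma ip_hadj_left: "\<lbrakk>T \<in> adjointable M; x \<in> carrier M; y \<in> carrier M\<rbrakk> \<Longrightarrow> hip M (hadj M T x) y = hip M x (T y)"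
  by (simp add: ip_hadj)

lemma s_hadj: "\<lbrakk>T \<in> adjointable M; x \<in> carrier M; y \<in> carrier M\<rbrakk> \<Longrightarrow> s (T x) y = s x (hadj M T y)"
  by (simp add: s_def ip_hadj)

text \<open>\<open>adjointable\<close> demands only an adjoint. Additivity, homogeneity and
  compatibility with the module action follow by moving \<open>T\<close> to the other side of the
  inner product.\<close>

lemma adjointable_hadd: "\<lbrakk>T \<in> adjointable M; x \<in> carrier M; y \<in> carrier M\<rbrakk> \<Longrightarrow> T (hadd M x y) = hadd M (T x) (T y)"
  by (rule ip_eqI) (simp_all add: ip_hadj ip_left)

lemma adjointable_hscale: "\<lbrakk>T \<in> adjointable M; x \<in> carrier M\<rbrakk> \<Longrightarrow> T (hscale M c x) = hscale M c (T x)"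
  by (rule ip_eqI) (simp_all add: ip_hadj ip_left)

lemma adjointable_hact: "\<lbrakk>T \<in> adjointable M; x \<in> carrier M\<rbrakk> \<Longrightarrow> T (hact M x b) = hact M (T x) b"
  by (rule ip_eqI) (simp_all add: ip_hadj ip_left)

lemma adjointable_hzero: "T \<in> adjointable M \<Longrightarrow> T (hzero M) = hzero M"
  by (rule ip_eqI) (simp_all add: ip_hadj ip_left)

lemma op_one_adjointable [simp]: "op_one M \<in> adjointable M"
  and op_zero_adjointable [simp]: "op_zero M \<in> adjointable M"
  by (rule adjointableI[where S = "op_one M"] adjointableI[where S = "op_zero M"];
      auto simp: op_one_def op_zero_def)+

lemma op_add_adjointable [simp]:
  assumes "S \<in> adjointable M" "T \<in> adjointable M"
  shows "op_add M S T \<in> adjointable M"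
  by (rule adjointableI[where S = "op_add M (hadj M S) (hadj M T)"])
    (use assms in \<open>auto simp: op_add_def ip_left ip_right ip_hadj\<close>)

lemma op_scale_adjointable [simp]:
  assumes "T \<in> adjointable M"
  shows "op_scale M c T \<in> adjointable M"
  by (rule adjointableI[where S = "op_scale M (cnj c) (hadj M T)"])
    (use assms in \<open>auto simp: op_scale_def ip_left ip_right ip_hadj\<close>)

lemma op_mult_adjointable [simp]:
  assumes "S \<in> adjointable M" "T \<in> adjointable M"
  shows "op_mult M S T \<in> adjointable M"
  by (rule adjointableI[where S = "op_mult M (hadj M T) (hadj M S)"])
    (use assms in \<open>auto simp: op_mult_def compose_def ip_hadj\<close>)

lemma op_apply [simp]:
  assumes "x \<in> carrier M"
  shows "op_one M x = x" "op_zero M x = hzero M" "op_add M S T x = hadd M (S x) (T x)"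
    "op_scale M c T x = hscale M c (T x)" "op_mult M S T x = S (T x)"
  using assms by (auto simp: op_one_def op_zero_def op_add_def op_scale_def op_mult_def compose_def)

lemma op_positive_ip:
  assumes "op_positive M T" "x \<in> carrier M"
  shows "bop_positive (hip M (T x) x)"
  using assms by (auto simp: op_positive_def ip_hadj_left intro!: ip_positive)

end

subsection \<open>Square roots\<close>

text \<open>For \<open>0 \<le> U \<le> 1\<close> and \<open>Y = 1 - U\<close> the iteration \<open>F\<^sub>0 = 0\<close>, \<open>F\<^sub>n\<^sub>+\<^sub>1 = (Y + F\<^sub>n\<^sup>2) / 2\<close> converges in norm to a
  solution of \<open>F = (Y + F\<^sup>2) / 2\<close>, that is, of \<open>(1 - F)\<^sup>2 = U\<close>.  It is dominated by the same iteration
  for the number \<open>1\<close> in place of \<open>Y\<close>.\<close>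

primrec sqrt_bound :: "nat \<Rightarrow> real"
  where "sqrt_bound 0 = 0"
  | "sqrt_bound (Suc n) = (1 + (sqrt_bound n)\<^sup>2) / 2"

primrec sqrt_iter :: "('x, 'b) hmod \<Rightarrow> ('x \<Rightarrow> 'x) \<Rightarrow> nat \<Rightarrow> 'x \<Rightarrow> 'x"
  where "sqrt_iter M Y 0 x = hzero M"
  | "sqrt_iter M Y (Suc n) x = hscale M (1/2) (hadd M (Y x) (sqrt_iter M Y n (sqrt_iter M Y n x)))"

lemma sqrt_bound_range: "0 \<le> sqrt_bound n" "sqrt_bound n \<le> 1"
proof (induction n)
  case (Suc n)
  { case 1 then show ?case by simp }
  { case 2 with Suc show ?case by (simp add: power_le_one) }
qed auto

lemma sqrt_bound_incr: "sqrt_bound n \<le> sqrt_bound (Suc n)"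
proof -
  have "0 \<le> (1 - sqrt_bound n)\<^sup>2" by simp
  then show ?thesis by (simp add: power2_diff)
qed

lemma sqrt_bound_Cauchy: "Cauchy sqrt_bound"
proof (intro convergent_Cauchy Bseq_monoseq_convergent)
  show "Bseq sqrt_bound"
    using sqrt_bound_range by (intro BseqI'[where K = 1]) auto
  show "monoseq sqrt_bound"
    using sqrt_bound_incr by (intro mono_SucI1) auto
qed

context ip_module
begin

text \<open>Module analogue of \<open>norm_bop_positive_le\<close>: after twisting by
  \<open>ket h\<close>, Cauchy-Schwarz for the form of \<open>Y\<close> is used at the pair
  \<open>Y z\<close>, \<open>z\<close>.\<close>

lemma contraction_of_ip_bounds:
  assumes Y: "Y \<in> adjointable M" "hadj M Y = Y"
    and pos: "\<And>x. x \<in> carrier M \<Longrightarrow> s (Y x) x \<in> \<real>\<^sub>\<ge>\<^sub>0"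
    and le: "\<And>x. x \<in> carrier M \<Longrightarrow> Re (s (Y x) x) \<le> Re (s x x)"
    and x: "x \<in> carrier M"
  shows "hnorm M (Y x) \<le> hnorm M x"
proof (rule hnorm_le)
  fix h
  define z where "z = hact M x (ket h)"
  have z: "z \<in> carrier M" "Y z \<in> carrier M" "Y (Y z) \<in> carrier M"
    using x Y by (auto simp: z_def)
  have "s (Y (Y z)) (Y z) + c * s (Y z) (Y z) + cnj c * s (Y (Y z)) z + c * cnj c * s (Y z) z \<in> \<real>\<^sub>\<ge>\<^sub>0" for c
    using pos[of "hadd M (Y z) (hscale M c z)"] z
    by (simp add: adjointable_hadd[OF Y(1)] adjointable_hscale[OF Y(1)] s_simps algebra_simps)
  from nonneg_quadratic_form(2)[OF this]
  have "((sn (Y z))\<^sup>2)\<^sup>2 \<le> Re (s (Y (Y z)) (Y z)) * Re (s (Y z) z)"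
    using z by (simp add: s.ip_self norm_power)
  also have "\<dots> \<le> (sn (Y z))\<^sup>2 * (sn z)\<^sup>2"
    using pos[of z] le s.ip_self_nonneg[of "Y z"] z by (intro mult_mono) (auto simp: s.seminorm_sq complex_nonneg_Reals_iff)
  finally have "sn (Y z) = 0 \<or> (sn (Y z))\<^sup>2 \<le> (sn z)\<^sup>2"
    by (metis mult_left_le_imp_le power2_eq_square zero_eq_power2 zero_less_power2)
  then have "sn (Y z) \<le> sn z"
    using z by (auto intro: power2_le_imp_le)
  then show "sn (hact M (Y x) (ket h)) \<le> hnorm M x * norm h"
    using sn_hact_ket_le[OF x, of h] x Y by (simp add: z_def adjointable_hact)
qed (use x Y in auto)

text \<open>Nonnegativity on all vectors gives hermitian symmetry of the scalar form by
  polarization; twisting by kets lifts it to the operator-valued inner product.\<close>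

lemma form_selfadjoint:
  assumes U: "U \<in> adjointable M" and pos: "\<And>x. x \<in> carrier M \<Longrightarrow> s (U x) x \<in> \<real>\<^sub>\<ge>\<^sub>0"
  shows "hadj M U = U"
proof (rule adjointableI(2)[OF adjointable_PiE[OF U] adjointable_PiE[OF U]])
  fix x y assume xy: "x \<in> carrier M" "y \<in> carrier M"
  have *: "s (U x) y = s x (U y)" if xy: "x \<in> carrier M" "y \<in> carrier M" for x y
  proof -
    have "s (U y) y + c * s (U x) y + cnj c * s (U y) x + c * cnj c * s (U x) x \<in> \<real>\<^sub>\<ge>\<^sub>0" for c
      using pos[of "hadd M y (hscale M c x)"] U xy
      by (simp add: adjointable_hadd[OF U] adjointable_hscale[OF U] s_simps algebra_simps)
    from nonneg_quadratic_form(1)[OF this] show ?thesis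
      using s.ip_commute[of x "U y"] xy U by simp
  qed
  have "cinner (hip M (U x) y h) k = cinner (hip M x (U y) h) k" for h k
    using *[of "hact M x (ket h)" "hact M y (ket k)"] xy U
    by (simp add: adjointable_hact[OF U] s_ket)
  then show "hip M (U x) y = hip M x (U y)" by (rule bop_eqI_cinner)
qed

end

context hilbert_module
begin

text \<open>The iterates are plain functions with values outside the carrier as well, so
  self-adjointness is stated as an identity of inner products. The increments are measured against
  those of \<open>sqrt_bound\<close>, whose convergence then carries over.\<close>

lemma
  assumes Y: "Y \<in> adjointable M" "hadj M Y = Y" "\<And>x. x \<in> carrier M \<Longrightarrow> hnorm M (Y x) \<le> hnorm M x"
  shows sqrt_iter_closed [simp]: "x \<in> carrier M \<Longrightarrow> sqrt_iter M Y n x \<in> carrier M"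
    and sqrt_iter_ip: "\<lbrakk>x \<in> carrier M; y \<in> carrier M\<rbrakk> \<Longrightarrow>
      hip M (sqrt_iter M Y n x) y = hip M x (sqrt_iter M Y n y)"
    and sqrt_iter_le: "x \<in> carrier M \<Longrightarrow> hnorm M (sqrt_iter M Y n x) \<le> sqrt_bound n * hnorm M x"
    and sqrt_iter_step: "x \<in> carrier M \<Longrightarrow> hdist (sqrt_iter M Y (Suc n) x) (sqrt_iter M Y n x)
      \<le> (sqrt_bound (Suc n) - sqrt_bound n) * hnorm M x"
proof -
  let ?F = "sqrt_iter M Y"
  show cl: "?F n x \<in> carrier M" if "x \<in> carrier M" for n x
    using that by (induction n arbitrary: x) (auto simp: Y)
  show ip: "hip M (?F n x) y = hip M x (?F n y)" if "x \<in> carrier M" "y \<in> carrier M" for n x y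
    using that by (induction n arbitrary: x y) (auto simp: Y cl ip_left ip_right ip_hadj)
  show le: "hnorm M (?F n x) \<le> sqrt_bound n * hnorm M x" if "x \<in> carrier M" for n x
    using that
  proof (induction n arbitrary: x)
    case (Suc n)
    have "hnorm M (?F (Suc n) x) \<le> (hnorm M (Y x) + hnorm M (?F n (?F n x))) / 2"
      using Suc.prems hnorm_hadd[of "Y x" "?F n (?F n x)"] by (simp add: hnorm_hscale Y cl)
    also have "hnorm M (?F n (?F n x)) \<le> sqrt_bound n * (sqrt_bound n * hnorm M x)"
      using Suc.IH[of "?F n x"] Suc.IH[of x] Suc.prems mult_left_mono[OF _ sqrt_bound_range(1)]
      by (meson cl order_trans)
    also have "hnorm M (Y x) \<le> hnorm M x"
      using Suc.prems Y by blast
    finally show ?case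
      by (simp add: power2_eq_square algebra_simps add_divide_distrib)
  qed auto
  have diff: "?F n (hdiff M x y) = hdiff M (?F n x) (?F n y)" if "x \<in> carrier M" "y \<in> carrier M" for n x y
    using that by (intro ip_eqI) (auto simp: cl ip ip_left)
  show "hdist (?F (Suc n) x) (?F n x) \<le> (sqrt_bound (Suc n) - sqrt_bound n) * hnorm M x"
    if "x \<in> carrier M" for n x
    using that
  proof (induction n arbitrary: x)
    case 0
    then have "hdiff M (?F (Suc 0) x) (?F 0 x) = hscale M (1/2) (Y x)"
      by (intro ip_eqI) (auto simp: Y ip_left)
    then show ?case
      using 0 Y(3)[of x] by (simp add: hnorm_hscale Y)
  next
    case (Suc n)
    let ?A = "?F (Suc n)" and ?B = "?F n" and ?a = "sqrt_bound (Suc n)" and ?b = "sqrt_bound n"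
    have cl': "?A x \<in> carrier M" "?B x \<in> carrier M" "hdiff M (?A x) (?B x) \<in> carrier M"
      using Suc.prems cl[of x] by (auto simp del: sqrt_iter.simps)
    \<comment> \<open>This is \<open>A^2 - B^2 = A (A - B) + (A - B) B\<close>. The induction
      hypothesis bounds the two summands by \<open>a (a - b)\<close> and \<open>(a - b) b\<close>,
      whose sum is \<open>a^2 - b^2\<close>; half of it is the next increment of
      \<open>sqrt_bound\<close>.\<close>
    have "hdiff M (?F (Suc (Suc n)) x) (?A x)
      = hscale M (1/2) (hadd M (?A (hdiff M (?A x) (?B x))) (hdiff M (?A (?B x)) (?B (?B x))))"
    proof (rule ip_eqI)
      fix z assume z: "z \<in> carrier M"
      have A: "hip M (?A x) z = (1/2) *\<^sub>C (hip M (Y x) z + hip M (?B (?B x)) z)"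
        using z Suc.prems by (simp add: ip_left cl Y)
      have A2: "hip M (?F (Suc (Suc n)) x) z = (1/2) *\<^sub>C (hip M (Y x) z + hip M (?A (?A x)) z)"
        using z Suc.prems by (simp only: sqrt_iter.simps(2)[of M Y "Suc n"])
          (simp add: ip_left cl Y del: sqrt_iter.simps)
      show "hip M (hdiff M (?F (Suc (Suc n)) x) (?A x)) z
        = hip M (hscale M (1/2) (hadd M (?A (hdiff M (?A x) (?B x))) (hdiff M (?A (?B x)) (?B (?B x))))) z"
        using z Suc.prems cl'
        by (simp add: ip_left cl A A2 diff scaleC_add_right scaleC_diff_right del: sqrt_iter.simps)
    qed (use Suc.prems cl' in \<open>auto simp: cl simp del: sqrt_iter.simps\<close>)
    then have "hdist (?F (Suc (Suc n)) x) (?A x)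
      \<le> (hnorm M (?A (hdiff M (?A x) (?B x))) + hdist (?A (?B x)) (?B (?B x))) / 2"
      using hnorm_hadd[of "?A (hdiff M (?A x) (?B x))" "hdiff M (?A (?B x)) (?B (?B x))"] cl'
      by (simp add: hnorm_hscale cl del: sqrt_iter.simps)
    also have "hnorm M (?A (hdiff M (?A x) (?B x))) \<le> ?a * hdist (?A x) (?B x)"
      by (rule le[OF cl'(3)])
    also have "\<dots> \<le> ?a * ((?a - ?b) * hnorm M x)"
      by (rule mult_left_mono[OF Suc.IH[OF Suc.prems] sqrt_bound_range(1)])
    also have "hdist (?A (?B x)) (?B (?B x)) \<le> (?a - ?b) * hnorm M (?B x)"
      by (rule Suc.IH[OF cl'(2)])
    also have "\<dots> \<le> (?a - ?b) * (?b * hnorm M x)"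
      using sqrt_bound_incr[of n] by (intro mult_left_mono le Suc.prems) auto
    finally show ?case
      by (simp add: power2_eq_square algebra_simps add_divide_distrib diff_divide_distrib)
  qed
qed

text \<open>\<open>op_positive\<close> asks for a factorization, and the self-adjoint square root
  \<open>S = 1 - F\<close> of \<open>U\<close> provides one. The upper bound on the form is the
  normalization \<open>U \<le> 1\<close>, which makes \<open>Y = 1 - U\<close> a positive
  contraction and lets the iteration converge.\<close>

theorem op_positive_if_bounded_form:
  assumes U: "U \<in> adjointable M"
    and pos: "\<And>x. x \<in> carrier M \<Longrightarrow> s (U x) x \<in> \<real>\<^sub>\<ge>\<^sub>0"
    and le: "\<And>x. x \<in> carrier M \<Longrightarrow> Re (s (U x) x) \<le> Re (s x x)"
  shows "op_positive M U"
proof -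
  define Y where "Y = op_add M (op_one M) (op_scale M (-1) U)"
  have Yx: "Y x = hdiff M x (U x)" if "x \<in> carrier M" for x
    using that by (simp add: Y_def hdiff_def)
  have Y1: "Y \<in> adjointable M"
    using U by (simp add: Y_def)
  have sY: "s (Y x) x = s x x - s (U x) x" if "x \<in> carrier M" for x
    using that U by (simp add: Yx s_hdiff_left)
  have posY: "s (Y x) x \<in> \<real>\<^sub>\<ge>\<^sub>0" if "x \<in> carrier M" for x
    using pos[OF that] le[OF that] s.ip_self_nonneg[OF that] by (simp add: sY that complex_nonneg_Reals_iff)
  have leY: "Re (s (Y x) x) \<le> Re (s x x)" if "x \<in> carrier M" for x
    using pos[OF that] by (simp add: sY that complex_nonneg_Reals_iff)
  have Y2: "hadj M Y = Y"
    by (rule form_selfadjoint[OF Y1 posY])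
  have Y3: "hnorm M (Y x) \<le> hnorm M x" if "x \<in> carrier M" for x
    by (rule contraction_of_ip_bounds[OF Y1 Y2 posY leY that])
  note Y = Y1 Y2 Y3
  let ?F = "sqrt_iter M Y"
  note cl [simp] = sqrt_iter_closed[OF Y]
  note F_ip = sqrt_iter_ip[OF Y]
  have step: "hdist (?F (n + k) x) (?F n x) \<le> (sqrt_bound (n + k) - sqrt_bound n) * hnorm M x"
    if x: "x \<in> carrier M" for n k x
  proof (induction k)
    case (Suc k)
    have "hdist (?F (n + Suc k) x) (?F n x) \<le>
      hdist (?F (Suc (n + k)) x) (?F (n + k) x) + hdist (?F (n + k) x) (?F n x)"
      using x hnorm_hdiff_triangle[OF cl cl cl, of x x x] by (simp del: sqrt_iter.simps)
    also have "\<dots> \<le> (sqrt_bound (Suc (n + k)) - sqrt_bound (n + k)) * hnorm M x +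
      (sqrt_bound (n + k) - sqrt_bound n) * hnorm M x"
      by (intro add_mono Suc.IH sqrt_iter_step[OF Y] x)
    finally show ?case by (simp add: algebra_simps del: sqrt_bound.simps)
  qed (use x in simp)
  have dist: "hdist (?F m x) (?F n x) \<le> \<bar>sqrt_bound m - sqrt_bound n\<bar> * hnorm M x"
    if x: "x \<in> carrier M" for m n x
  proof -
    consider k where "m = n + k" | k where "n = m + k" by (metis le_iff_add linear)
    then show ?thesis
    proof cases
      case 1
      then show ?thesis
        by (simp add: order_trans[OF step[OF x]] mult_right_mono)
    next
      case 2
      have "hdist (?F n x) (?F m x) \<le> \<bar>sqrt_bound m - sqrt_bound n\<bar> * hnorm M x"
        using order_trans[OF step[OF x, of m k] mult_right_mono[OF abs_ge_self hnorm_nonneg]]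
        by (simp add: 2 abs_minus_commute)
      then show ?thesis
        using x by (simp add: hnorm_hdiff_commute[of "?F m x"])
    qed
  qed
  have "\<exists>y\<in>carrier M. (\<lambda>n. hdist (?F n x) y) \<longlonglongrightarrow> 0" if x: "x \<in> carrier M" for x
  proof (rule hcomplete)
    fix \<epsilon> :: real assume "\<epsilon> > 0"
    then have "\<epsilon> / (hnorm M x + 1) > 0"
      by (simp add: add_nonneg_pos)
    then obtain N where N: "\<And>m n. m \<ge> N \<Longrightarrow> n \<ge> N \<Longrightarrow> \<bar>sqrt_bound m - sqrt_bound n\<bar> < \<epsilon> / (hnorm M x + 1)"
      using sqrt_bound_Cauchy by (metis CauchyD real_norm_def)
    have "hdist (?F m x) (?F n x) < \<epsilon>" if "m \<ge> N" "n \<ge> N" for m n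
    proof -
      have "\<bar>sqrt_bound m - sqrt_bound n\<bar> * hnorm M x \<le> \<bar>sqrt_bound m - sqrt_bound n\<bar> * (hnorm M x + 1)"
        by (intro mult_left_mono) auto
      also have "\<dots> < \<epsilon>"
        using N[OF that] by (simp add: pos_less_divide_eq add_nonneg_pos)
      finally show ?thesis using dist[OF x, of m n] by linarith
    qed
    then show "\<exists>N. \<forall>m\<ge>N. \<forall>n\<ge>N. hdist (?F m x) (?F n x) < \<epsilon>" by blast
  qed (use x in auto)
  then obtain F where Fc: "\<And>x. x \<in> carrier M \<Longrightarrow> F x \<in> carrier M"
    and Fl: "\<And>x. x \<in> carrier M \<Longrightarrow> (\<lambda>n. hdist (?F n x) (F x)) \<longlonglongrightarrow> 0" by metis
  have lim: "(\<lambda>n. hip M (?F n x) y) \<longlonglongrightarrow> hip M (F x) y" if "x \<in> carrier M" "y \<in> carrier M" for x y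
    using that Fl Fc by (intro hip_tendsto_left) auto
  have lim2: "(\<lambda>n. hip M x (?F n y)) \<longlonglongrightarrow> hip M (F x) y" if "x \<in> carrier M" "y \<in> carrier M" for x y
    using lim[OF that] F_ip that by simp
  have lim_right: "(\<lambda>n. hip M x (?F n y)) \<longlonglongrightarrow> hip M x (F y)" if "x \<in> carrier M" "y \<in> carrier M" for x y
    using that Fl Fc by (intro hip_tendsto_right) auto
  have F_sym: "hip M (F x) y = hip M x (F y)" if "x \<in> carrier M" "y \<in> carrier M" for x y
    by (rule LIMSEQ_unique[OF lim2 lim_right]) (use that in auto)
  have F_eq: "hip M (F x) y = (1/2) *\<^sub>C (hip M (Y x) y + hip M (F (F x)) y)"
    if xy: "x \<in> carrier M" "y \<in> carrier M" for x y
  proof (rule LIMSEQ_unique)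
    show "(\<lambda>n. hip M (?F (Suc n) x) y) \<longlonglongrightarrow> hip M (F x) y"
      using lim[OF xy] by (rule LIMSEQ_Suc)
    \<comment> \<open>Both arguments move with \<open>n\<close>. Replacing the left one by its limit
      costs a null sequence, because the iterates are uniformly bounded by 1.\<close>
    have "(\<lambda>n. hip M (?F n x) (?F n y)) \<longlonglongrightarrow> hip M (F x) (F y)"
    proof -
      have "norm (hip M (?F n x) (?F n y) - hip M (F x) (?F n y)) \<le> hdist (?F n x) (F x) * hnorm M y" for n
      proof -
        have "norm (hip M (hdiff M (?F n x) (F x)) (?F n y)) \<le> hdist (?F n x) (F x) * hnorm M (?F n y)"
          using xy Fc by (intro norm_hip_le) auto
        also have "hnorm M (?F n y) \<le> 1 * hnorm M y"
          using sqrt_iter_le[OF Y xy(2), of n] mult_right_mono[OF sqrt_bound_range(2) hnorm_nonneg]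
          by (meson order_trans)
        finally show ?thesis using xy Fc by (simp add: ip_left mult_left_mono)
      qed
      moreover have "(\<lambda>n. hdist (?F n x) (F x) * hnorm M y) \<longlonglongrightarrow> 0"
        using Fl[OF xy(1)] by (rule tendsto_mult_left_zero)
      ultimately have "(\<lambda>n. hip M (?F n x) (?F n y) - hip M (F x) (?F n y)) \<longlonglongrightarrow> 0"
        by (rule Lim_null_comparison[OF always_eventually[OF allI]])
      from tendsto_add[OF this lim_right[OF Fc[OF xy(1)] xy(2)]] show ?thesis by simp
    qed
    then have "(\<lambda>n. hip M (?F n (?F n x)) y) \<longlonglongrightarrow> hip M (F (F x)) y"
      using xy Fc by (simp add: F_ip F_sym)
    then have "(\<lambda>n. (1/2) *\<^sub>C (hip M (Y x) y + hip M (?F n (?F n x)) y)) \<longlonglongrightarrow>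
      (1/2) *\<^sub>C (hip M (Y x) y + hip M (F (F x)) y)"
      by (intro bounded_linear.tendsto[OF bounded_linear_scaleC] tendsto_intros)
    then show "(\<lambda>n. hip M (?F (Suc n) x) y) \<longlonglongrightarrow> (1/2) *\<^sub>C (hip M (Y x) y + hip M (F (F x)) y)"
      using xy Y1 by (simp add: ip_left)
  qed
  define S where "S = (\<lambda>x\<in>carrier M. hdiff M x (F x))"
  have S: "S \<in> adjointable M" "hadj M S = S"
    by (rule adjointableI[where S = S]; auto simp: S_def Fc ip_left ip_right F_sym)+
  have "U = op_mult M S S"
  proof (rule op_eqI)
    fix x y assume xy: "x \<in> carrier M" "y \<in> carrier M"
    have "2 *\<^sub>C hip M (F x) y = hip M (Y x) y + hip M (F (F x)) y"
      by (subst F_eq[OF xy]) (simp add: scaleC_scaleC)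
    moreover have "2 *\<^sub>C b = b + b" for b :: "'h bop"
      using scaleC_add_left[of 1 1 b] by simp
    ultimately have *: "hip M (F x) y + hip M (F x) y = hip M x y - hip M (U x) y + hip M (F (F x)) y"
      using xy U by (simp add: Yx ip_left)
    have "hip M (S (S x)) y = hip M x y - (hip M (F x) y + hip M (F x) y) + hip M (F (F x)) y"
      using xy by (simp add: S_def Fc ip_left F_sym)
    then show "hip M (U x) y = hip M (op_mult M S S x) y"
      using xy S unfolding * by simp
  qed (use U S in \<open>auto intro!: adjointable_PiE\<close>)
  then show ?thesis
    using S unfolding op_positive_def by metis
qed

end

subsection \<open>Adjointable operators are bounded\<close>

context hilbert_module
begin

text \<open>The constant \<open>3/2\<close> is the sum of the geometric series with ratio
  \<open>1/3\<close>; it bounds the total of all moves from index \<open>n\<close> on.\<close>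

lemma geometric_limit:
  assumes u: "\<And>n. u n \<in> carrier M"
    and step: "\<And>n::nat. hdist (u (Suc n)) (u n) \<le> (1/3) ^ n"
  obtains y where "y \<in> carrier M" "\<And>n. hdist (u n) y \<le> 3/2 * (1/3) ^ n"
proof -
  have far: "hdist (u (n + k)) (u n) \<le> 3/2 * (1/3) ^ n" for n k
  proof -
    \<comment> \<open>The subtracted tail is what makes the induction on \<open>k\<close>
      close.\<close>
    have "hdist (u (n + k)) (u n) \<le> 3/2 * ((1/3) ^ n - (1/3) ^ (n + k))"
    proof (induction k)
      case (Suc k)
      show ?case
        using hnorm_hdiff_triangle[of "u (n + Suc k)" "u (n + k)" "u n"] u Suc step[of "n + k"]
        by simp
    qed (use u in simp)
    also have "\<dots> \<le> 3/2 * (1/3) ^ n" by simp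
    finally show ?thesis .
  qed
  have "\<exists>y\<in>carrier M. (\<lambda>n. hdist (u n) y) \<longlonglongrightarrow> 0"
  proof (rule hcomplete[OF u])
    fix \<epsilon> :: real assume "\<epsilon> > 0"
    then obtain N where N: "(1/3) ^ N < \<epsilon> / 3"
      using real_arch_pow_inv[of "\<epsilon> / 3" "1/3"] by auto
    have "hdist (u m) (u n) < \<epsilon>" if "m \<ge> N" "n \<ge> N" for m n
    proof -
      have "hdist (u m) (u n) \<le> hdist (u m) (u N) + hdist (u n) (u N)"
        using hnorm_hdiff_triangle[of "u m" "u N" "u n"] u by (simp add: hnorm_hdiff_commute[OF u u, of N n])
      then show ?thesis
        using far[of N "m - N"] far[of N "n - N"] that N by simp
    qed
    then show "\<exists>N. \<forall>m\<ge>N. \<forall>n\<ge>N. hdist (u m) (u n) < \<epsilon>" by blast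
  qed
  then obtain y where y: "y \<in> carrier M" "(\<lambda>n. hdist (u n) y) \<longlonglongrightarrow> 0" by blast
  have "hdist (u n) y \<le> 3/2 * (1/3) ^ n" for n
  proof (rule LIMSEQ_le_const)
    show "(\<lambda>k. 3/2 * (1/3) ^ n + hdist (u (n + k)) y) \<longlonglongrightarrow> 3/2 * (1/3) ^ n"
      using tendsto_add[OF tendsto_const LIMSEQ_ignore_initial_segment[OF y(2), of n], of "3/2 * (1/3) ^ n"]
      by (simp add: add.commute)
    have "hdist (u n) y \<le> 3/2 * (1/3) ^ n + hdist (u (n + k)) y" for k
      using hnorm_hdiff_triangle[of "u n" "u (n + k)" y] u y(1) far[of n k]
      by (simp add: hnorm_hdiff_commute[OF u u, of n "n + k"])
    then show "\<exists>N. \<forall>k\<ge>N. hdist (u n) y \<le> 3/2 * (1/3) ^ n + hdist (u (n + k)) y" by blast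
  qed
  with y(1) that show thesis by blast
qed

text \<open>Sokal's proof of the uniform boundedness principle, applied to the functionals
  \<open>y \<mapsto> \<langle>y, T z\<rangle> = \<langle>T\<^sup>* y, z\<rangle>\<close> with \<open>z\<close> in the unit ball.\<close>

theorem adjointable_bounded:
  assumes T: "T \<in> adjointable M"
  obtains C where "0 \<le> C" "\<And>x. x \<in> carrier M \<Longrightarrow> hnorm M (T x) \<le> C * hnorm M x"
proof (rule ccontr)
  assume no: "\<not> thesis"
  \<comment> \<open>The growth \<open>4^n\<close> is chosen to beat the step lengths
    \<open>(1/3)^n\<close> used for moving \<open>y\<close>.\<close>
  have "\<exists>z\<in>carrier M. hnorm M z \<le> 1 \<and> 4 ^ n \<le> hnorm M (T z)" for n :: nat
  proof -
    have "\<not> (\<forall>x\<in>carrier M. hnorm M (T x) \<le> 4 ^ n * hnorm M x)"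
      using no that[of "4 ^ n"] by auto
    then obtain x where x: "x \<in> carrier M" "4 ^ n * hnorm M x < hnorm M (T x)"
      by (auto simp: not_le)
    then have "hnorm M x \<noteq> 0"
      using hnorm_eq_0 adjointable_hzero[OF T] by fastforce
    then have pos: "hnorm M x > 0"
      using hnorm_nonneg[of x] by linarith
    let ?z = "hscale M (of_real (1 / hnorm M x)) x"
    have "4 ^ n \<le> hnorm M (T x) / hnorm M x"
      using x pos by (simp add: pos_le_divide_eq)
    then have "hnorm M ?z \<le> 1 \<and> 4 ^ n \<le> hnorm M (T ?z)"
      using x pos T by (simp add: adjointable_hscale[OF T] hnorm_hscale norm_divide)
    then show ?thesis using x(1) by (intro bexI[of _ ?z]) auto
  qed
  then obtain z where z: "\<And>n. z n \<in> carrier M" "\<And>n. hnorm M (z n) \<le> 1" "\<And>n. 4 ^ n \<le> hnorm M (T (z n))"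
    by metis
  have Tz: "T (z n) \<in> carrier M" for n using z T by simp
  have "\<exists>y'\<in>carrier M. hdist y' y \<le> (1/3) ^ n \<and>
      (1/3) ^ n * hnorm M (T (z n)) \<le> norm (hip M y' (T (z n)))" if y: "y \<in> carrier M" for y n
  proof -
    let ?v = "T (z n)"
    have pos: "hnorm M ?v > 0"
      using z(3)[of n] by (meson less_le_trans zero_less_numeral zero_less_power)
    \<comment> \<open>A move of length \<open>(1/3)^n\<close> in the direction of
      \<open>T (z n)\<close> changes the pairing with that vector by the largest possible amount.
      Since twice this change is the difference of the pairings at \<open>y + u\<close> and
      \<open>y - u\<close>, one of the two is large.\<close>
    define u where "u = hscale M (of_real ((1/3) ^ n / hnorm M ?v)) ?v"
    have u: "u \<in> carrier M" "hnorm M u = (1/3) ^ n"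
      using Tz pos by (auto simp: u_def hnorm_hscale norm_divide norm_power)
    have "norm (hip M ?v ?v) = (hnorm M ?v)\<^sup>2"
      by (simp add: hnorm_def)
    then have "norm (hip M u ?v) = (1/3) ^ n * hnorm M ?v"
      using Tz pos by (simp add: u_def ip_left norm_scaleC norm_divide norm_power power2_eq_square)
    moreover have "2 *\<^sub>R hip M u ?v = hip M (hadd M y u) ?v - hip M (hdiff M y u) ?v"
      using y u Tz by (simp add: ip_left scaleR_2)
    then have "2 * norm (hip M u ?v) \<le> norm (hip M (hadd M y u) ?v) + norm (hip M (hdiff M y u) ?v)"
      by (metis norm_triangle_ineq4 norm_scaleR abs_numeral)
    ultimately have "(1/3) ^ n * hnorm M ?v \<le> norm (hip M (hadd M y u) ?v) \<or>
        (1/3) ^ n * hnorm M ?v \<le> norm (hip M (hdiff M y u) ?v)"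
      by linarith
    moreover have "hdiff M (hadd M y u) y = u" "hdiff M (hdiff M y u) y = hscale M (-1) u"
      using y u by (auto intro!: ip_eqI simp: ip_left)
    ultimately show ?thesis
      using y u by (metis carrier_hadd carrier_hdiff hnorm_hscale mult_1 norm_minus_cancel norm_one order_refl)
  qed
  then have "\<forall>n y. \<exists>y'. y \<in> carrier M \<longrightarrow> y' \<in> carrier M \<and> hdist y' y \<le> (1/3) ^ n \<and>
      (1/3) ^ n * hnorm M (T (z n)) \<le> norm (hip M y' (T (z n)))" by blast
  then obtain f where f: "\<And>y n. y \<in> carrier M \<Longrightarrow> f n y \<in> carrier M"
      "\<And>y n. y \<in> carrier M \<Longrightarrow> hdist (f n y) y \<le> (1/3) ^ n"
      "\<And>y n. y \<in> carrier M \<Longrightarrow> (1/3) ^ n * hnorm M (T (z n)) \<le> norm (hip M (f n y) (T (z n)))"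
    unfolding choice_iff by blast
  define u where "u = rec_nat (hzero M) f"
  have u: "u n \<in> carrier M" for n
    by (induction n) (auto simp: u_def f)
  have uS: "u (Suc n) = f n (u n)" for n
    by (simp add: u_def)
  obtain y where y: "y \<in> carrier M" "\<And>n. hdist (u n) y \<le> 3/2 * (1/3) ^ n"
    by (rule geometric_limit[of u]) (auto simp: u uS f)
  \<comment> \<open>Moves after the \<open>n\<close>-th have total length at most
    \<open>3/2 * (1/3)^(n+1)\<close>, which is half of \<open>(1/3)^n\<close>. Hence half of the
    gain at stage \<open>n\<close> survives in the limit \<open>y\<close>, and the norm of the
    adjoint at \<open>y\<close> would exceed every \<open>(4/3)^n / 2\<close>.\<close>
  have bound: "(4/3) ^ n / 2 \<le> hnorm M (hadj M T y)" for n
  proof -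
    let ?v = "T (z n)"
    have "(1/3) ^ n * hnorm M ?v \<le> norm (hip M (u (Suc n)) ?v)"
      using f(3)[OF u] by (simp add: uS)
    also have "hip M (u (Suc n)) ?v = hip M y ?v + hip M (hdiff M (u (Suc n)) y) ?v"
      using u y Tz by (simp add: ip_left)
    also have "norm \<dots> \<le> norm (hip M y ?v) + norm (hip M (hdiff M (u (Suc n)) y) ?v)"
      by (rule norm_triangle_ineq)
    also have "norm (hip M (hdiff M (u (Suc n)) y) ?v) \<le> hdist (u (Suc n)) y * hnorm M ?v"
      using u y Tz by (intro norm_hip_le) auto
    also have "\<dots> \<le> (3/2 * (1/3) ^ Suc n) * hnorm M ?v"
      by (intro mult_right_mono y) simp
    finally have "(1/3) ^ n * hnorm M ?v / 2 \<le> norm (hip M y ?v)"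
      by simp
    moreover have "norm (hip M y ?v) \<le> hnorm M (hadj M T y)"
    proof -
      have "hip M y ?v = hip M (hadj M T y) (z n)"
        using y z T by (simp add: ip_hadj)
      also have "norm \<dots> \<le> hnorm M (hadj M T y) * hnorm M (z n)"
        using y z T by (intro norm_hip_le) auto
      also have "\<dots> \<le> hnorm M (hadj M T y)"
        using mult_left_le[OF z(2) hnorm_nonneg] .
      finally show ?thesis .
    qed
    moreover have "(4/3) ^ n / 2 \<le> (1/3) ^ n * hnorm M ?v / 2"
      using mult_left_mono[OF z(3)[of n], of "(1/3) ^ n"] by (simp flip: power_mult_distrib)
    ultimately show ?thesis by linarith
  qed
  obtain n where "2 * hnorm M (hadj M T y) < (4/3) ^ n"
    using real_arch_pow[of "4/3"] by auto
  with bound[of n] show False by simp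
qed

end

subsection \<open>The inner product on the dual\<close>

lemma dual_with_simps [simp]:
  "carrier (dual_with M p) = dual_carrier M"
  "hadd (dual_with M p) = (\<lambda>\<eta> \<zeta>. \<lambda>x\<in>carrier M. \<eta> x + \<zeta> x)"
  "hzero (dual_with M p) = (\<lambda>x\<in>carrier M. 0)"
  "hscale (dual_with M p) = (\<lambda>c \<eta>. \<lambda>x\<in>carrier M. cnj c *\<^sub>C \<eta> x)"
  "hact (dual_with M p) = (\<lambda>\<eta> b. \<lambda>x\<in>carrier M. bop_adj b * \<eta> x)"
  "hip (dual_with M p) = p"
  by (simp_all add: dual_with_def)

context hilbert_module
begin

abbreviation (input) dual where "dual \<equiv> dual_module M"

lemma dualD:
  assumes "\<eta> \<in> dual_carrier M"
  shows dual_extensional: "\<eta> \<in> extensional (carrier M)"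
    and dual_hadd: "\<And>x y. \<lbrakk>x \<in> carrier M; y \<in> carrier M\<rbrakk> \<Longrightarrow> \<eta> (hadd M x y) = \<eta> x + \<eta> y"
    and dual_hscale: "\<And>x c. x \<in> carrier M \<Longrightarrow> \<eta> (hscale M c x) = c *\<^sub>C \<eta> x"
    and dual_hact: "\<And>x b. x \<in> carrier M \<Longrightarrow> \<eta> (hact M x b) = \<eta> x * b"
  using assms by (auto simp: dual_carrier_def)

lemma dual_hdiff:
  "\<lbrakk>\<eta> \<in> dual_carrier M; x \<in> carrier M; y \<in> carrier M\<rbrakk> \<Longrightarrow> \<eta> (hdiff M x y) = \<eta> x - \<eta> y"
  by (simp add: hdiff_def dual_hadd dual_hscale)

lemma dual_bound:
  assumes "\<eta> \<in> dual_carrier M"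
  obtains C where "0 \<le> C" "\<And>x. x \<in> carrier M \<Longrightarrow> norm (\<eta> x) \<le> C * hnorm M x"
proof -
  obtain C where "\<And>x. x \<in> carrier M \<Longrightarrow> norm (\<eta> x) \<le> C * hnorm M x"
    using assms unfolding dual_carrier_def by blast
  then have "norm (\<eta> x) \<le> max C 0 * hnorm M x" if "x \<in> carrier M" for x
    using that mult_right_mono[of C "max C 0" "hnorm M x"] order_trans by fastforce
  then show thesis by (rule that[rotated]) auto
qed

lemma dualI:
  assumes "\<eta> \<in> extensional (carrier M)"
    "\<And>x y. \<lbrakk>x \<in> carrier M; y \<in> carrier M\<rbrakk> \<Longrightarrow> \<eta> (hadd M x y) = \<eta> x + \<eta> y"
    "\<And>x c. x \<in> carrier M \<Longrightarrow> \<eta> (hscale M c x) = c *\<^sub>C \<eta> x"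
    "\<And>x b. x \<in> carrier M \<Longrightarrow> \<eta> (hact M x b) = \<eta> x * b"
    "\<And>x. x \<in> carrier M \<Longrightarrow> norm (\<eta> x) \<le> C * hnorm M x"
  shows "\<eta> \<in> dual_carrier M"
  using assms unfolding dual_carrier_def by blast

text \<open>A functional is bounded for the module norm, yet its value applied to
  \<open>unit_vec\<close> is controlled by the smaller seminorm of \<open>s\<close>: that value does
  not change when \<open>x\<close> is compressed by \<open>ket unit_vec\<close>. This is the
  estimate that admits the Riesz theorem.\<close>

lemma dual_unit_vec_le:
  assumes \<eta>: "\<eta> \<in> dual_carrier M" and C: "0 \<le> C" "\<And>x. x \<in> carrier M \<Longrightarrow> norm (\<eta> x) \<le> C * hnorm M x"
    and x: "x \<in> carrier M"
  shows "norm (\<eta> x unit_vec) \<le> C * sn x"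
proof -
  let ?p = "ket unit_vec"
  have "\<eta> x unit_vec = \<eta> (hact M x ?p) unit_vec"
    using x by (simp add: dual_hact[OF \<eta>])
  also have "norm \<dots> \<le> norm (\<eta> (hact M x ?p)) * norm (unit_vec :: 'h)"
    by (rule norm_bop_apply)
  also have "\<dots> \<le> norm (\<eta> (hact M x ?p))"
    by (rule mult_left_le[OF norm_unit_vec_le norm_ge_zero])
  also have "\<dots> \<le> C * hnorm M (hact M x ?p)"
    using x by (intro C) auto
  also have "\<dots> \<le> C * sn x"
    by (intro mult_left_mono hnorm_ket_unit x C)
  finally show ?thesis .
qed

text \<open>Evaluation at \<open>unit_vec\<close> annihilates the null vectors of \<open>s\<close>.
  Expressions that contain a chosen Riesz vector are well defined for this reason.\<close>

lemma dual_cong_s: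
  assumes \<eta>: "\<eta> \<in> dual_carrier M" and xy: "x \<in> carrier M" "y \<in> carrier M"
    and eq: "\<And>z. z \<in> carrier M \<Longrightarrow> s z x = s z y"
  shows "\<eta> x unit_vec = \<eta> y unit_vec"
proof -
  obtain C where C: "0 \<le> C" "\<And>x. x \<in> carrier M \<Longrightarrow> norm (\<eta> x) \<le> C * hnorm M x"
    using dual_bound[OF \<eta>] by metis
  have "s (hdiff M x y) (hdiff M x y) = 0"
    using xy by (simp add: s_hdiff_right eq)
  then have "sn (hdiff M x y) = 0"
    by (simp add: s.seminorm_def)
  then have "norm (\<eta> (hdiff M x y) unit_vec) \<le> 0"
    using dual_unit_vec_le[OF \<eta> C, of "hdiff M x y"] xy by simp
  then show ?thesis
    using xy by (simp add: dual_hdiff[OF \<eta>])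
qed

lemma dual_riesz:
  assumes \<eta>: "\<eta> \<in> dual_carrier M"
  shows "\<exists>v\<in>carrier M. \<forall>x\<in>carrier M. cinner (\<eta> x unit_vec) h = s x v"
proof -
  obtain C where C: "0 \<le> C" "\<And>x. x \<in> carrier M \<Longrightarrow> norm (\<eta> x) \<le> C * hnorm M x"
    using dual_bound[OF \<eta>] by metis
  let ?P = "(\<lambda>x. (x, cinner (\<eta> x unit_vec) h)) ` carrier M"
  have "\<exists>v\<in>carrier M. \<forall>(x, c)\<in>?P. c = s x v"
  proof (rule s.riesz_relation[OF s_complete, where K = "C * norm h"])
    show "?P \<noteq> {}" using carrier_hzero by blast
    fix x c assume xc: "(x, c) \<in> ?P"
    then show "x \<in> carrier M" by auto
    with xc have "cmod c \<le> norm (\<eta> x unit_vec) * norm h"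
      using cinner_cauchy_schwarz by auto
    also have "\<dots> \<le> C * sn x * norm h"
      using \<open>x \<in> carrier M\<close> by (intro mult_right_mono dual_unit_vec_le[OF \<eta> C]) auto
    finally show "cmod c \<le> C * norm h * sn x" by (simp add: mult_ac)
  qed (auto simp: dual_hadd[OF \<eta>] dual_hscale[OF \<eta>] cinner_simps image_iff)
  then show ?thesis by auto
qed

text \<open>Stands for \<open>\<eta>\<close> acted on by \<open>ket h\<close>: for
  \<open>\<eta> = hat M y\<close> the vector \<open>y\<close> acted on by \<open>ket h\<close> has
  the defining property. The choice is free up to null vectors, so linearity in \<open>h\<close>
  holds only modulo these.\<close>

definition drep :: "('x \<Rightarrow> 'h bop) \<Rightarrow> 'h \<Rightarrow> 'x"
  where "drep \<eta> h = (SOME v. v \<in> carrier M \<and> (\<forall>x\<in>carrier M. cinner (\<eta> x unit_vec) h = s x v))"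

lemma
  assumes "\<eta> \<in> dual_carrier M"
  shows drep_closed [simp]: "drep \<eta> h \<in> carrier M"
    and s_drep: "x \<in> carrier M \<Longrightarrow> s x (drep \<eta> h) = cinner (\<eta> x unit_vec) h"
  using someI_ex[OF dual_riesz[OF assms, of h, unfolded Bex_def]] unfolding drep_def by auto

lemma sn_drep_le:
  assumes \<eta>: "\<eta> \<in> dual_carrier M" and C: "0 \<le> C" "\<And>x. x \<in> carrier M \<Longrightarrow> norm (\<eta> x) \<le> C * hnorm M x"
  shows "sn (drep \<eta> h) \<le> C * norm h"
proof -
  let ?v = "drep \<eta> h"
  have v: "?v \<in> carrier M" using \<eta> by simp
  have "sn ?v * sn ?v = cmod (cinner (\<eta> ?v unit_vec) h)"
    using v s.ip_self[OF v] \<eta> by (simp add: s_drep[symmetric] norm_power power2_eq_square norm_mult)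
  also have "\<dots> \<le> (C * sn ?v) * norm h"
    by (rule order_trans[OF cinner_cauchy_schwarz mult_right_mono[OF dual_unit_vec_le[OF \<eta> C v]]]) auto
  finally have "sn ?v * sn ?v \<le> (C * norm h) * sn ?v" by (simp add: mult_ac)
  then show ?thesis
    using v C(1) by (cases "sn ?v = 0") (auto simp: mult_le_cancel_right not_less order_less_le)
qed

text \<open>Forced by the requirement that pairing \<open>hat M x\<close> with
  \<open>\<zeta>\<close> gives \<open>\<zeta> x\<close>, read with \<open>drep \<eta> h\<close> in
  the place of \<open>x\<close>.\<close>

definition dual_ip :: "('x \<Rightarrow> 'h bop) \<Rightarrow> ('x \<Rightarrow> 'h bop) \<Rightarrow> 'h bop"
  where "dual_ip \<eta> \<zeta> = bop_of (\<lambda>h. \<zeta> (drep \<eta> h) unit_vec)"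

lemma dual_ip_apply:
  assumes \<eta>: "\<eta> \<in> dual_carrier M" and \<zeta>: "\<zeta> \<in> dual_carrier M"
  shows "dual_ip \<eta> \<zeta> h = \<zeta> (drep \<eta> h) unit_vec"
proof -
  obtain C where C: "0 \<le> C" "\<And>x. x \<in> carrier M \<Longrightarrow> norm (\<eta> x) \<le> C * hnorm M x"
    using dual_bound[OF \<eta>] by metis
  obtain C' where C': "0 \<le> C'" "\<And>x. x \<in> carrier M \<Longrightarrow> norm (\<zeta> x) \<le> C' * hnorm M x"
    using dual_bound[OF \<zeta>] by metis
  show ?thesis unfolding dual_ip_def
  proof (rule bop_of_apply[where K = "C' * C"])
    fix h k c
    have "\<zeta> (drep \<eta> (h + k)) unit_vec = \<zeta> (hadd M (drep \<eta> h) (drep \<eta> k)) unit_vec"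
      by (rule dual_cong_s[OF \<zeta>]) (auto simp: \<eta> s_simps s_drep cinner_simps)
    then show "\<zeta> (drep \<eta> (h + k)) unit_vec = \<zeta> (drep \<eta> h) unit_vec + \<zeta> (drep \<eta> k) unit_vec"
      by (simp add: dual_hadd[OF \<zeta>] \<eta>)
    have "\<zeta> (drep \<eta> (c *\<^sub>C h)) unit_vec = \<zeta> (hscale M c (drep \<eta> h)) unit_vec"
      by (rule dual_cong_s[OF \<zeta>]) (auto simp: \<eta> s_simps s_drep cinner_simps)
    then show "\<zeta> (drep \<eta> (c *\<^sub>C h)) unit_vec = c *\<^sub>C \<zeta> (drep \<eta> h) unit_vec"
      by (simp add: dual_hscale[OF \<zeta>] \<eta>)
    show "norm (\<zeta> (drep \<eta> h) unit_vec) \<le> C' * C * norm h"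
      using dual_unit_vec_le[OF \<zeta> C', of "drep \<eta> h"] mult_left_mono[OF sn_drep_le[OF \<eta> C] C'(1)] \<eta>
      by (simp add: mult.assoc) (meson order_trans)
  qed
qed

text \<open>The first form makes hermitian symmetry and positivity visible, the second one linearity
  and the module rule in \<open>\<eta>\<close>.\<close>

lemma cinner_dual_ip:
  assumes "\<eta> \<in> dual_carrier M" "\<zeta> \<in> dual_carrier M"
  shows "cinner (dual_ip \<eta> \<zeta> h) k = s (drep \<eta> h) (drep \<zeta> k)"
    and "cinner (dual_ip \<eta> \<zeta> h) k = cinner h (\<eta> (drep \<zeta> k) unit_vec)"
proof -
  show *: "cinner (dual_ip \<eta> \<zeta> h) k = s (drep \<eta> h) (drep \<zeta> k)"
    using assms by (simp add: dual_ip_apply s_drep)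
  show "cinner (dual_ip \<eta> \<zeta> h) k = cinner h (\<eta> (drep \<zeta> k) unit_vec)"
    unfolding * using assms s.ip_commute[of "drep \<eta> h" "drep \<zeta> k"]
    by (simp add: s_drep) (metis cinner_commute)
qed

lemma hat_apply [simp]: "y \<in> carrier M \<Longrightarrow> hat M x y = hip M y x"
  by (simp add: hat_def)

lemma hat_closed [simp]: "x \<in> carrier M \<Longrightarrow> hat M x \<in> dual_carrier M"
proof (rule dualI[where C = "hnorm M x"])
  show "norm (hat M x y) \<le> hnorm M x * hnorm M y" if "x \<in> carrier M" "y \<in> carrier M" for y
    using that norm_hip_le[of y x] by (simp add: mult.commute)
qed (auto simp: hat_def ip_left)

lemma dual_ip_hat:
  assumes x: "x \<in> carrier M" and \<eta>: "\<eta> \<in> dual_carrier M"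
  shows "dual_ip (hat M x) \<eta> = \<eta> x"
proof (rule bop_eqI_cinner)
  fix h k
  let ?v = "drep \<eta> k"
  have "cinner (dual_ip (hat M x) \<eta> h) k = cinner h (hip M ?v x unit_vec)"
    using x \<eta> by (simp add: cinner_dual_ip(2))
  also have "\<dots> = cnj (s ?v (hact M x (ket h)))"
    using x \<eta> by (simp add: s_ket_right) (metis cinner_commute)
  also have "\<dots> = s (hact M x (ket h)) ?v"
    using x \<eta> by (metis carrier_hact drep_closed s.ip_commute)
  also have "\<dots> = cinner (\<eta> x h) k"
    using x \<eta> by (simp add: s_drep dual_hact)
  finally show "cinner (dual_ip (hat M x) \<eta> h) k = cinner (\<eta> x h) k" .
qed

lemma dual_zero [simp]: "(\<lambda>x\<in>carrier M. 0) \<in> dual_carrier M"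
  by (rule dualI[where C = 0]) auto

lemma dual_closed [simp]:
  assumes \<eta>: "\<eta> \<in> dual_carrier M"
  shows "\<zeta> \<in> dual_carrier M \<Longrightarrow> (\<lambda>x\<in>carrier M. \<eta> x + \<zeta> x) \<in> dual_carrier M"
    and "(\<lambda>x\<in>carrier M. c *\<^sub>C \<eta> x) \<in> dual_carrier M"
    and "(\<lambda>x\<in>carrier M. b * \<eta> x) \<in> dual_carrier M"
proof -
  obtain C where C: "0 \<le> C" "\<And>x. x \<in> carrier M \<Longrightarrow> norm (\<eta> x) \<le> C * hnorm M x"
    using dual_bound[OF \<eta>] by metis
  show "(\<lambda>x\<in>carrier M. \<eta> x + \<zeta> x) \<in> dual_carrier M" if \<zeta>: "\<zeta> \<in> dual_carrier M"
  proof -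
    obtain C' where C': "0 \<le> C'" "\<And>x. x \<in> carrier M \<Longrightarrow> norm (\<zeta> x) \<le> C' * hnorm M x"
      using dual_bound[OF \<zeta>] by metis
    show ?thesis
      by (rule dualI[where C = "C + C'"])
        (auto simp: dual_hadd \<eta> \<zeta> dual_hscale dual_hact scaleC_add_right distrib_right
          intro!: order_trans[OF norm_triangle_ineq] add_mono C C')
  qed
  show "(\<lambda>x\<in>carrier M. c *\<^sub>C \<eta> x) \<in> dual_carrier M"
    by (rule dualI[where C = "cmod c * C"])
      (auto simp: dual_hadd \<eta> dual_hscale dual_hact scaleC_add_right scaleC_scaleC
          mult.commute[of c] norm_scaleC mult.assoc
        intro!: mult_left_mono C)
  show "(\<lambda>x\<in>carrier M. b * \<eta> x) \<in> dual_carrier M"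
    by (rule dualI[where C = "norm b * C"])
      (auto simp: dual_hadd \<eta> dual_hscale dual_hact distrib_left mult.assoc
        intro!: order_trans[OF norm_mult_ineq] mult_left_mono C)
qed

lemma dual_eqI:
  "\<lbrakk>\<eta> \<in> dual_carrier M; \<zeta> \<in> dual_carrier M; \<And>x. x \<in> carrier M \<Longrightarrow> \<eta> x = \<zeta> x\<rbrakk> \<Longrightarrow> \<eta> = \<zeta>"
  using dual_extensional by (blast intro: extensionalityI)

text \<open>The module action does not involve the inner product on the dual, so this applies to every one of them.\<close>

lemma dual_ket_hat:
  assumes \<eta>: "\<eta> \<in> dual_carrier M"
  shows "\<exists>v\<in>carrier M. (\<lambda>x\<in>carrier M. bop_adj (ket h) * \<eta> x) = hat M v"
proof (intro bexI dual_eqI)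
  \<comment> \<open>The compressed representative is needed: the operators
    \<open>bop_adj (ket h) * \<eta> y\<close> have their range in the line of
    \<open>unit_vec\<close>, and compression gives \<open>hip M y ?v\<close> the same
    property.\<close>
  let ?v = "hact M (drep \<eta> h) (ket unit_vec)"
  show v: "?v \<in> carrier M" using \<eta> by simp
  fix y assume y: "y \<in> carrier M"
  have "bop_adj (ket h) * \<eta> y = hip M y ?v"
  proof (rule bop_eqI)
    fix k
    have "cinner (\<eta> y k) h = cinner (\<eta> (hact M y (ket k)) unit_vec) h"
      using y by (simp add: dual_hact[OF \<eta>])
    also have "\<dots> = cinner (hip M y (drep \<eta> h) k) unit_vec"
      using y \<eta> by (simp add: s_drep[symmetric] s_ket_left)
    finally show "bop_apply (bop_adj (ket h) * \<eta> y) k = hip M y ?v k"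
      using y \<eta> by (simp add: ip_right ket_adj)
  qed
  then show "(\<lambda>x\<in>carrier M. bop_adj (ket h) * \<eta> x) y = hat M ?v y"
    using y by simp
qed (use \<eta> in simp_all)

lemma ip_module_dual: "ip_module (dual_with M dual_ip)"
proof (unfold_locales, goal_cases)
  case 1 then show ?case by simp
next
  case 2 show ?case by simp
next
  case 3 then show ?case by simp
next
  case 4 then show ?case by simp
next
  case 5 then show ?case
    by (intro bop_eqI_cinner) (simp add: cinner_dual_ip(2) cinner_simps)
next
  case 6 then show ?case
    by (intro bop_eqI_cinner) (simp add: cinner_dual_ip(2) cinner_simps)
next
  case 7 then show ?case
    by (intro bop_eqI_cinner) (simp add: cinner_dual_ip(2) cinner_bop_adj[symmetric])
next
  case (8 \<eta>)
  then have "(\<lambda>x\<in>carrier M. 0) \<in> dual_carrier M" by simp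
  with 8 show ?case
    by (intro bop_eqI_cinner) (simp add: cinner_dual_ip(2) cinner_simps)
next
  case (9 \<eta> \<zeta>)
  then show ?case
    by (intro bop_eqI_cinner) (simp add: cinner_bop_adj_left cinner_dual_ip(1) cinner_commute[of _ "bop_apply (dual_ip _ _) _"] flip: s.ip_commute)
next
  case (10 \<eta>)
  then show ?case
    by (simp add: bop_positive_def cinner_dual_ip(1) s.ip_self_nonneg)
next
  case (11 \<eta> \<zeta>)
  then have c: "\<eta> \<in> dual_carrier M" "\<zeta> \<in> dual_carrier M" by auto
  \<comment> \<open>Elements are separated already by the vectors \<open>hat M x\<close>, whose
    pairing with a functional recovers its value at \<open>x\<close>.\<close>
  have "cinner h (\<eta> x k) = cinner h (\<zeta> x k)" if x: "x \<in> carrier M" for x h k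
  proof -
    have "dual_ip \<eta> (hat M x) = dual_ip \<zeta> (hat M x)"
      using 11(3)[of "hat M x"] x by simp
    moreover have "cinner (dual_ip \<xi> (hat M x) h) k = cinner h (\<xi> x k)" if "\<xi> \<in> dual_carrier M" for \<xi>
    proof -
      have "cinner (dual_ip \<xi> (hat M x) h) k = cnj (cinner (dual_ip (hat M x) \<xi> k) h)"
        using that x s.ip_commute[of "drep \<xi> h" "drep (hat M x) k"] by (simp add: cinner_dual_ip(1))
      then show ?thesis
        using that x by (simp add: dual_ip_hat) (metis cinner_commute)
    qed
    ultimately show ?thesis using c by metis
  qed
  then show ?case
    by (intro dual_eqI c bop_eqI cinner_eqI_right)
qed

end

text \<open>The vector space and module axioms hold because both sides have the same inner products
  with every element; completeness is the only additional input.\<close>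

lemma (in ip_module) hilbert_moduleI:
  assumes "\<And>u. \<lbrakk>\<And>n::nat. u n \<in> carrier M;
        \<And>\<epsilon>. \<epsilon> > 0 \<Longrightarrow> \<exists>N. \<forall>m\<ge>N. \<forall>n\<ge>N. hdist (u m) (u n) < \<epsilon>\<rbrakk> \<Longrightarrow>
      \<exists>x\<in>carrier M. (\<lambda>n. hdist (u n) x) \<longlonglongrightarrow> 0"
  shows "hilbert_module M"
proof
  fix x assume "x \<in> carrier M" "hip M x x = 0"
  then show "x = hzero M"
    by (intro hnorm_eq_0) (simp_all add: hnorm_def)
next
  show "\<And>x y. x \<in> carrier M \<Longrightarrow> y \<in> carrier M \<Longrightarrow> hip M y x = bop_adj (hip M x y)"
    by (rule ip_commute)
  show "\<And>x. x \<in> carrier M \<Longrightarrow> bop_positive (hip M x x)"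
    by (rule ip_positive)
qed (rule assms; assumption | (rule ip_eqI)?; simp add: ip_left add_ac algebra_simps scaleC_add_right scaleC_add_left scaleC_scaleC)+

context hilbert_module
begin

text \<open>The norm of the new inner product is the operator norm of functionals:
  \<open>eval_le\<close> and \<open>norm_le\<close> are the two inequalities. Completeness is then
  the usual argument for bounded functionals, with pointwise limits in \<open>B(H)\<close>.\<close>

lemma hilbert_module_dual: "hilbert_module (dual_with M dual_ip)"
proof -
  interpret N: ip_module "dual_with M dual_ip" by (rule ip_module_dual)
  let ?N = "dual_with M dual_ip"
  have hat_norm: "hnorm ?N (hat M x) = hnorm M x" if "x \<in> carrier M" for x
    using that by (simp add: hnorm_def dual_ip_hat)
  have eval_le: "norm (\<eta> x) \<le> hnorm ?N \<eta> * hnorm M x" if "\<eta> \<in> dual_carrier M" "x \<in> carrier M" for \<eta> x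
    using that N.norm_hip_le[of "hat M x" \<eta>] by (simp add: hat_norm dual_ip_hat mult.commute)
  have norm_le: "hnorm ?N \<eta> \<le> C"
    if \<eta>: "\<eta> \<in> dual_carrier M" and C: "0 \<le> C" "\<And>x. x \<in> carrier M \<Longrightarrow> norm (\<eta> x) \<le> C * hnorm M x" for \<eta> C
  proof -
    have "norm (dual_ip \<eta> \<eta>) \<le> C\<^sup>2"
    proof (rule norm_bop_positive_le)
      show "bop_positive (dual_ip \<eta> \<eta>)"
        using \<eta> N.ip_positive[of \<eta>] by simp
      show "Re (cinner (dual_ip \<eta> \<eta> h) h) \<le> C\<^sup>2 * (norm h)\<^sup>2" for h
        using \<eta> power_mono[OF sn_drep_le[OF \<eta> C, of h], of 2]
        by (simp add: cinner_dual_ip(1) s.seminorm_sq power_mult_distrib)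
    qed simp
    then show ?thesis using C(1) by (simp add: hnorm_def real_le_lsqrt)
  qed
  show ?thesis
  proof (rule N.hilbert_moduleI)
    fix u :: "nat \<Rightarrow> 'x \<Rightarrow> 'h bop"
    assume "\<And>n. u n \<in> carrier ?N"
      and C: "\<And>\<epsilon>. \<epsilon> > 0 \<Longrightarrow> \<exists>N. \<forall>m\<ge>N. \<forall>n\<ge>N. N.hdist (u m) (u n) < \<epsilon>"
    then have u: "\<And>n. u n \<in> dual_carrier M" by simp
    have diff_apply: "hdiff ?N \<eta> \<zeta> x = \<eta> x - \<zeta> x" if "x \<in> carrier M" for \<eta> \<zeta> x
      using that by (simp add: hdiff_def)
    have u_diff: "norm (u m x - u n x) \<le> N.hdist (u m) (u n) * hnorm M x"
      if "x \<in> carrier M" for m n x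
      using eval_le[of "hdiff ?N (u m) (u n)" x] N.carrier_hdiff[of "u m" "u n"] u that
      by (simp add: diff_apply)
    have "Cauchy (\<lambda>n. u n x)" if x: "x \<in> carrier M" for x
    proof (rule CauchyI)
      fix \<epsilon> :: real assume "\<epsilon> > 0"
      then have "\<epsilon> / (hnorm M x + 1) > 0" by (simp add: add_nonneg_pos)
      then obtain N where N: "\<forall>m\<ge>N. \<forall>n\<ge>N. N.hdist (u m) (u n) < \<epsilon> / (hnorm M x + 1)"
        using C by blast
      have "norm (u m x - u n x) < \<epsilon>" if "m \<ge> N" "n \<ge> N" for m n
      proof -
        have "N.hdist (u m) (u n) * hnorm M x \<le> N.hdist (u m) (u n) * (hnorm M x + 1)"
          by (intro mult_left_mono) auto
        also have "\<dots> < \<epsilon>"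
          using N that by (simp add: pos_less_divide_eq add_nonneg_pos)
        finally show ?thesis using u_diff[OF x, of m n] by linarith
      qed
      then show "\<exists>N. \<forall>m\<ge>N. \<forall>n\<ge>N. norm (u m x - u n x) < \<epsilon>" by blast
    qed
    then have "\<exists>L. (\<lambda>n. u n x) \<longlonglongrightarrow> L" if "x \<in> carrier M" for x
      using that convergent_eq_Cauchy by blast
    then obtain L0 where L0: "\<And>x. x \<in> carrier M \<Longrightarrow> (\<lambda>n. u n x) \<longlonglongrightarrow> L0 x" by metis
    define L where "L = (\<lambda>x\<in>carrier M. L0 x)"
    have L: "(\<lambda>n. u n x) \<longlonglongrightarrow> L x" if "x \<in> carrier M" for x
      using L0 that by (simp add: L_def)
    \<comment> \<open>Letting \<open>m\<close> tend to infinity in \<open>u_diff\<close> keeps the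
      estimate uniform in \<open>x\<close>, which upgrades pointwise convergence to norm
      convergence.\<close>
    have close: "norm (u n x - L x) \<le> \<epsilon> * hnorm M x"
      if N: "\<forall>m\<ge>N. \<forall>n\<ge>N. N.hdist (u m) (u n) < \<epsilon>" and "n \<ge> N" "x \<in> carrier M" for N \<epsilon> n x
    proof (rule LIMSEQ_le_const2)
      show "(\<lambda>m. norm (u n x - u m x)) \<longlonglongrightarrow> norm (u n x - L x)"
        using that by (intro tendsto_intros L)
      show "\<exists>N. \<forall>m\<ge>N. norm (u n x - u m x) \<le> \<epsilon> * hnorm M x"
      proof (intro exI[of _ N] allI impI)
        fix m assume "N \<le> m"
        then have "N.hdist (u n) (u m) \<le> \<epsilon>"
          using N \<open>n \<ge> N\<close> by (auto intro: less_imp_le)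
        then show "norm (u n x - u m x) \<le> \<epsilon> * hnorm M x"
          using u_diff[OF that(3), of n m] by (meson hnorm_nonneg mult_right_mono order_trans)
      qed
    qed
    obtain N where N: "\<forall>m\<ge>N. \<forall>n\<ge>N. N.hdist (u m) (u n) < 1"
      using C[of 1] by auto
    have Ld: "L \<in> dual_carrier M"
    proof (rule dualI[where C = "hnorm ?N (u N) + 1"])
      show "L \<in> extensional (carrier M)" by (simp add: L_def)
      fix x y b and c :: complex assume x: "x \<in> carrier M"
      show "L (hadd M x y) = L x + L y" if y: "y \<in> carrier M"
        using tendsto_add[OF L[OF x] L[OF y]] L[of "hadd M x y"] x y u
        by (intro LIMSEQ_unique) (auto simp: dual_hadd)
      show "L (hscale M c x) = c *\<^sub>C L x"
        using bounded_linear.tendsto[OF bounded_linear_scaleC L[OF x], of c] L[of "hscale M c x"] x u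
        by (intro LIMSEQ_unique) (auto simp: dual_hscale)
      show "L (hact M x b) = L x * b"
        using tendsto_mult[OF L[OF x] tendsto_const, of b] L[of "hact M x b"] x u
        by (intro LIMSEQ_unique) (auto simp: dual_hact)
      have "norm (L x) \<le> norm (u N x) + norm (u N x - L x)"
        by (metis norm_triangle_sub norm_minus_commute)
      also have "\<dots> \<le> hnorm ?N (u N) * hnorm M x + 1 * hnorm M x"
        using x u by (intro add_mono eval_le close[OF N]) auto
      finally show "norm (L x) \<le> (hnorm ?N (u N) + 1) * hnorm M x"
        by (simp add: distrib_right)
    qed
    have "(\<lambda>n. N.hdist (u n) L) \<longlonglongrightarrow> 0"
    proof (rule LIMSEQ_I)
      fix \<epsilon> :: real assume "\<epsilon> > 0"
      then obtain N where N: "\<forall>m\<ge>N. \<forall>n\<ge>N. N.hdist (u m) (u n) < \<epsilon> / 2"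
        using C[of "\<epsilon> / 2"] by auto
      have "N.hdist (u n) L \<le> \<epsilon> / 2" if "n \<ge> N" for n
        using N.carrier_hdiff[of "u n" L] u Ld \<open>\<epsilon> > 0\<close> close[OF N that]
        by (intro norm_le) (auto simp: diff_apply)
      then have "\<forall>n\<ge>N. norm (N.hdist (u n) L - 0) < \<epsilon>"
        using \<open>\<epsilon> > 0\<close> by (fastforce simp: abs_of_nonneg[OF N.hnorm_nonneg])
      then show "\<exists>N. \<forall>n\<ge>N. norm (N.hdist (u n) L - 0) < \<epsilon>" by blast
    qed
    then show "\<exists>x\<in>carrier ?N. (\<lambda>n. N.hdist (u n) x) \<longlonglongrightarrow> 0"
      using Ld by auto
  qed
qed

lemma hat_hadd: "\<lbrakk>x \<in> carrier M; y \<in> carrier M\<rbrakk> \<Longrightarrow> hat M (hadd M x y) = hadd (dual_with M p) (hat M x) (hat M y)"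
  and hat_hscale: "x \<in> carrier M \<Longrightarrow> hat M (hscale M c x) = hscale (dual_with M p) c (hat M x)"
  and hat_hact: "x \<in> carrier M \<Longrightarrow> hat M (hact M x b) = hact (dual_with M p) (hat M x) b"
  by (rule ext; simp add: hat_def restrict_def ip_right)+

text \<open>A functional on \<open>X'\<close> is restricted to \<open>X\<close>, where it is an
  element \<open>\<eta>\<close> of \<open>X'\<close>. It agrees with the pairing against
  \<open>\<eta>\<close> everywhere, since the action of \<open>ket h\<close> moves each
  \<open>\<zeta>\<close> into the image of \<open>X\<close> and the kets separate operators.\<close>

lemma self_dual_dual: "self_dual (dual_with M dual_ip)"
  unfolding self_dual_def
proof
  interpret N: hilbert_module "dual_with M dual_ip" by (rule hilbert_module_dual)
  let ?N = "dual_with M dual_ip"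
  fix \<Phi> assume \<Phi>: "\<Phi> \<in> dual_carrier ?N"
  obtain C where C: "\<And>\<eta>. \<eta> \<in> dual_carrier M \<Longrightarrow> norm (\<Phi> \<eta>) \<le> C * hnorm ?N \<eta>"
    using N.dual_bound[OF \<Phi>] by (metis dual_with_simps(1))
  define \<eta> where "\<eta> = (\<lambda>x\<in>carrier M. \<Phi> (hat M x))"
  have \<eta>: "\<eta> \<in> dual_carrier M"
  proof (rule dualI[where C = C])
    fix x y b and c :: complex assume x: "x \<in> carrier M"
    show "\<eta> (hadd M x y) = \<eta> x + \<eta> y" if "y \<in> carrier M"
      using x that N.dual_hadd[OF \<Phi>, of "hat M x" "hat M y"]
      by (simp add: \<eta>_def hat_hadd[of _ _ dual_ip] del: dual_with_simps(2))
    show "\<eta> (hscale M c x) = c *\<^sub>C \<eta> x"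
      using x N.dual_hscale[OF \<Phi>, of "hat M x"]
      by (simp add: \<eta>_def hat_hscale[of _ _ dual_ip] del: dual_with_simps(4))
    show "\<eta> (hact M x b) = \<eta> x * b"
      using x N.dual_hact[OF \<Phi>, of "hat M x"]
      by (simp add: \<eta>_def hat_hact[of _ _ dual_ip] del: dual_with_simps(5))
    have "hnorm ?N (hat M x) = hnorm M x"
      using x by (simp add: hnorm_def dual_ip_hat)
    then show "norm (\<eta> x) \<le> C * hnorm M x"
      using x C[of "hat M x"] by (simp add: \<eta>_def)
  qed (simp add: \<eta>_def)
  have "\<Phi> = hat ?N \<eta>"
  proof (rule N.dual_eqI[OF \<Phi>])
    show "hat ?N \<eta> \<in> dual_carrier ?N"
      using \<eta> by (intro N.hat_closed) simp
    fix \<zeta> assume "\<zeta> \<in> carrier ?N"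
    then have \<zeta>: "\<zeta> \<in> dual_carrier M" by simp
    have "\<Phi> \<zeta> * ket h = dual_ip \<zeta> \<eta> * ket h" for h
    proof -
      obtain v where v: "v \<in> carrier M" "hact ?N \<zeta> (ket h) = hat M v"
        using dual_ket_hat[OF \<zeta>, of h] by auto
      have "\<Phi> \<zeta> * ket h = \<eta> v"
        using N.dual_hact[OF \<Phi>, of \<zeta> "ket h"] \<zeta> v unfolding v(2) by (simp add: \<eta>_def)
      also have "\<dots> = dual_ip \<zeta> \<eta> * ket h"
        using N.ip_hact[of \<zeta> \<eta> "ket h"] \<zeta> \<eta> v(1) unfolding v(2) by (simp add: dual_ip_hat)
      finally show ?thesis .
    qed
    then show "\<Phi> \<zeta> = hat ?N \<eta> \<zeta>"
      using \<zeta> by (simp add: bop_eqI_ket)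
  qed
  then show "\<exists>y\<in>carrier ?N. \<Phi> = hat ?N y" using \<eta> by auto
qed

theorem is_dual_ip_dual_ip: "is_dual_ip M dual_ip"
  unfolding is_dual_ip_def
  using hilbert_module_dual self_dual_dual by (auto simp: dual_ip_hat)

text \<open>From here on the inner product of the dual is the chosen one, known only through its
  specification; \<open>dual_ip\<close> has served as the witness.\<close>

lemma is_dual_ip_dual_module: "is_dual_ip M (SOME p. is_dual_ip M p)"
  by (rule someI[of "is_dual_ip M", OF is_dual_ip_dual_ip])

lemma hilbert_module_dual_module: "hilbert_module dual"
  using is_dual_ip_dual_module by (simp add: is_dual_ip_def dual_module_def)

lemma carrier_dual_module [simp]: "carrier dual = dual_carrier M"
  by (simp add: dual_module_def)

lemma ip_hat: "\<lbrakk>x \<in> carrier M; \<eta> \<in> dual_carrier M\<rbrakk> \<Longrightarrow> hip dual (hat M x) \<eta> = \<eta> x"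
  using is_dual_ip_dual_module by (simp add: is_dual_ip_def dual_module_def)

lemma hact_dual_module: "hact dual \<eta> b = (\<lambda>x\<in>carrier M. bop_adj b * \<eta> x)"
  by (simp add: dual_module_def)

end

section \<open>Operators on the dual, read off from the image of the module\<close>

context hilbert_module
begin

interpretation D: hilbert_module dual
  by (rule hilbert_module_dual_module)

lemma s_hat: "\<lbrakk>x \<in> carrier M; y \<in> carrier M\<rbrakk> \<Longrightarrow> D.s (hat M x) (hat M y) = s x y"
  by (simp add: D.s_def s_def ip_hat)

lemma hact_ket_hat:
  assumes "\<eta> \<in> dual_carrier M"
  obtains x where "x \<in> carrier M" "hact dual \<eta> (ket h) = hat M x"
  using dual_ket_hat[OF assms, of h] by (auto simp: hact_dual_module)

lemma hadd_dual_closed [simp]: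
  "\<lbrakk>\<eta> \<in> dual_carrier M; \<zeta> \<in> dual_carrier M\<rbrakk> \<Longrightarrow> hadd dual \<eta> \<zeta> \<in> dual_carrier M"
  by (simp add: dual_module_def)

lemma hscale_dual_closed [simp]: "\<eta> \<in> dual_carrier M \<Longrightarrow> hscale dual c \<eta> \<in> dual_carrier M"
  by (simp add: dual_module_def)

lemma hdiff_dual_closed [simp]:
  "\<lbrakk>\<eta> \<in> dual_carrier M; \<zeta> \<in> dual_carrier M\<rbrakk> \<Longrightarrow> hdiff dual \<eta> \<zeta> \<in> dual_carrier M"
  by (simp add: hdiff_def)

lemma hzero_dual_closed [simp]: "hzero dual \<in> dual_carrier M"
  by (simp add: dual_module_def)

lemma hact_dual_closed [simp]: "\<eta> \<in> dual_carrier M \<Longrightarrow> hact dual \<eta> b \<in> dual_carrier M"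
  by (simp add: hact_dual_module)

lemma hat_hact_dual: "x \<in> carrier M \<Longrightarrow> hat M (hact M x b) = hact dual (hat M x) b"
  by (simp add: hat_hact dual_module_def del: dual_with_simps)

lemma hat_hadd_dual:
  "\<lbrakk>x \<in> carrier M; y \<in> carrier M\<rbrakk> \<Longrightarrow> hat M (hadd M x y) = hadd dual (hat M x) (hat M y)"
  by (simp add: hat_hadd dual_module_def del: dual_with_simps)

lemma hat_hscale_dual: "x \<in> carrier M \<Longrightarrow> hat M (hscale M c x) = hscale dual c (hat M x)"
  by (simp add: hat_hscale dual_module_def del: dual_with_simps)

lemma hat_hzero_dual: "hat M (hzero M) = hzero dual"
  by (rule ext) (simp add: dual_module_def hat_def restrict_def)

lemma hact_ket_hat_pair:
  assumes "\<eta> \<in> dual_carrier M" "\<zeta> \<in> dual_carrier M"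
  obtains x y where "x \<in> carrier M" "y \<in> carrier M"
    "hact dual \<eta> (ket h) = hat M x" "hact dual \<zeta> (ket k) = hat M y"
  using hact_ket_hat[OF assms(1)] hact_ket_hat[OF assms(2)] by metis

text \<open>A matrix coefficient of an adjointable \<open>R\<close> at \<open>\<eta>, h\<close> and
  \<open>\<zeta>, k\<close> is the scalar form of \<open>R\<close> at the two functionals twisted by
  \<open>ket h\<close> and \<open>ket k\<close>, and these twists lie in the image of
  \<open>X\<close>.\<close>

lemma dual_op_eqI:
  assumes S: "S \<in> adjointable dual" and T: "T \<in> adjointable dual"
    and eq: "\<And>x y. \<lbrakk>x \<in> carrier M; y \<in> carrier M\<rbrakk> \<Longrightarrow> D.s (S (hat M x)) (hat M y) = D.s (T (hat M x)) (hat M y)"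
  shows "S = T"
proof (rule D.op_eqI[OF D.adjointable_PiE[OF S] D.adjointable_PiE[OF T]])
  fix \<eta> \<zeta> assume "\<eta> \<in> carrier dual" "\<zeta> \<in> carrier dual"
  then have c: "\<eta> \<in> dual_carrier M" "\<zeta> \<in> dual_carrier M" by auto
  show "hip dual (S \<eta>) \<zeta> = hip dual (T \<eta>) \<zeta>"
  proof (rule bop_eqI_cinner)
    fix h k
    obtain x y where xy: "x \<in> carrier M" "y \<in> carrier M"
      "hact dual \<eta> (ket h) = hat M x" "hact dual \<zeta> (ket k) = hat M y"
      using hact_ket_hat_pair[OF c] by metis
    have "cinner (hip dual (R \<eta>) \<zeta> h) k = D.s (R (hat M x)) (hat M y)"
      if R: "R \<in> adjointable dual" for R
      using c D.s_ket[of "R \<eta>" \<zeta> h k] D.adjointable_hact[OF R, of \<eta> "ket h"] D.adjointable_closed[OF R, of \<eta>] xy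
      by simp
    then show "cinner (hip dual (S \<eta>) \<zeta> h) k = cinner (hip dual (T \<eta>) \<zeta> h) k"
      using S T eq xy by simp
  qed
qed

text \<open>The compression of \<open>\<eta>\<close> by \<open>ket unit_vec\<close> is
  \<open>hat M x\<close> for some \<open>x\<close>, and the scalar form does not see the
  compression. One \<open>x\<close> serves all \<open>T\<close>, so bounds that compare different
  operators carry over from \<open>X\<close>.\<close>

lemma dual_form_hat:
  assumes "\<eta> \<in> dual_carrier M"
  obtains x where "x \<in> carrier M" "D.s \<eta> \<eta> = s x x"
    "\<And>T. T \<in> adjointable dual \<Longrightarrow> D.s (T \<eta>) \<eta> = D.s (T (hat M x)) (hat M x)"
proof -
  obtain x where x: "x \<in> carrier M" "hact dual \<eta> (ket unit_vec) = hat M x"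
    using hact_ket_hat[OF assms] by metis
  have "D.s \<eta> \<eta> = D.s (hat M x) (hat M x)"
    using assms by (simp flip: x(2))
  then have 1: "D.s \<eta> \<eta> = s x x" using x by (simp add: s_hat)
  have "D.s (T \<eta>) \<eta> = D.s (T (hat M x)) (hat M x)" if "T \<in> adjointable dual" for T
    using assms that D.adjointable_closed[OF that, of \<eta>]
    by (simp add: D.adjointable_hact flip: x(2))
  with x 1 that show thesis by blast
qed

text \<open>The extension \<open>E T\<close> composes a functional with the adjoint of
  \<open>T\<close>; the composite is bounded by \<open>adjointable_bounded\<close>. Its adjoint is
  the extension of \<open>hadj M T\<close>, checked on kets, where only vectors of \<open>X\<close>
  enter, and \<open>dual_op_eqI\<close> gives the uniqueness that the definite description
  needs.\<close>

lemma op_extend: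
  assumes T: "T \<in> adjointable M"
  shows op_extend_adjointable [simp]: "op_extend M T \<in> adjointable dual"
    and op_extend_hat [simp]: "x \<in> carrier M \<Longrightarrow> op_extend M T (hat M x) = hat M (T x)"
    and hadj_op_extend: "hadj dual (op_extend M T) = op_extend M (hadj M T)"
proof -
  define E where "E = (\<lambda>T. \<lambda>\<eta>\<in>dual_carrier M. \<lambda>x\<in>carrier M. \<eta> (hadj M T x))"
  have E_closed: "E T \<eta> \<in> dual_carrier M" if T: "T \<in> adjointable M" and \<eta>: "\<eta> \<in> dual_carrier M" for T \<eta>
  proof -
    obtain C where C: "0 \<le> C" "\<And>x. x \<in> carrier M \<Longrightarrow> norm (\<eta> x) \<le> C * hnorm M x"
      using dual_bound[OF \<eta>] by metis
    obtain K where K: "\<And>x. x \<in> carrier M \<Longrightarrow> hnorm M (hadj M T x) \<le> K * hnorm M x"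
      using adjointable_bounded[OF hadj_adjointable[OF T]] by metis
    have "norm (\<eta> (hadj M T x)) \<le> C * K * hnorm M x" if "x \<in> carrier M" for x
      using C(2)[of "hadj M T x"] mult_left_mono[OF K[OF that] C(1)] that T by (simp add: mult.assoc)
    then show ?thesis
      using T \<eta> hadj_adjointable[OF T] by (intro dualI[where C = "C * K"])
        (auto simp: E_def dual_hadd dual_hscale dual_hact adjointable_hadd adjointable_hscale adjointable_hact)
  qed
  have E_PiE: "E T \<in> carrier dual \<rightarrow>\<^sub>E carrier dual" if "T \<in> adjointable M" for T
    using E_closed[OF that] by (auto simp: E_def)
  have E_hat: "E T (hat M x) = hat M (T x)" if "T \<in> adjointable M" "x \<in> carrier M" for T x
    using that by (intro dual_eqI E_closed) (auto simp: E_def ip_hadj_left)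
  have E_hact: "hact dual (E T \<eta>) b = E T (hact dual \<eta> b)"
    if "T \<in> adjointable M" "\<eta> \<in> dual_carrier M" for T \<eta> b
  proof (rule dual_eqI)
    fix x assume "x \<in> carrier M"
    then show "hact dual (E T \<eta>) b x = E T (hact dual \<eta> b) x"
      using that hact_dual_closed[OF that(2), of b] by (simp add: E_def hact_dual_module)
  qed (use that E_closed in auto)
  have E_ip: "hip dual (E T \<eta>) \<zeta> = hip dual \<eta> (E (hadj M T) \<zeta>)"
    if T: "T \<in> adjointable M" and c: "\<eta> \<in> dual_carrier M" "\<zeta> \<in> dual_carrier M" for T \<eta> \<zeta>
  proof (rule bop_eqI_cinner)
    fix h k
    obtain x y where xy: "x \<in> carrier M" "y \<in> carrier M"
      "hact dual \<eta> (ket h) = hat M x" "hact dual \<zeta> (ket k) = hat M y"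
      using hact_ket_hat_pair[OF c] by metis
    have "cinner (hip dual (E T \<eta>) \<zeta> h) k = s (T x) y"
      using c E_closed[OF T c(1)] D.s_ket[of "E T \<eta>" \<zeta> h k] T xy by (simp add: E_hact E_hat s_hat)
    moreover have "cinner (hip dual \<eta> (E (hadj M T) \<zeta>) h) k = s x (hadj M T y)"
      using c E_closed[OF hadj_adjointable[OF T] c(2)] D.s_ket[of \<eta> "E (hadj M T) \<zeta>" h k] T xy
      by (simp add: E_hact E_hat s_hat)
    ultimately show "cinner (hip dual (E T \<eta>) \<zeta> h) k = cinner (hip dual \<eta> (E (hadj M T) \<zeta>) h) k"
      using T xy by (simp add: s_hadj)
  qed
  have E_adj: "E T \<in> adjointable dual" "hadj dual (E T) = E (hadj M T)"
    if "T \<in> adjointable M" for T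
    using D.adjointableI[OF E_PiE[OF that] E_PiE[OF hadj_adjointable[OF that]]] E_ip[OF that] by auto
  have eq: "op_extend M T = E T" if T: "T \<in> adjointable M" for T
    unfolding op_extend_def
  proof (rule the_equality)
    show "E T \<in> adjointable dual \<and> (\<forall>x\<in>carrier M. E T (hat M x) = hat M (T x))"
      using E_adj E_hat T by auto
    show "T' = E T" if "T' \<in> adjointable dual \<and> (\<forall>x\<in>carrier M. T' (hat M x) = hat M (T x))" for T'
      using that E_adj E_hat T by (intro dual_op_eqI) auto
  qed
  show "op_extend M T \<in> adjointable dual"
    "x \<in> carrier M \<Longrightarrow> op_extend M T (hat M x) = hat M (T x)"
    "hadj dual (op_extend M T) = op_extend M (hadj M T)"
    using T E_adj E_hat by (auto simp: eq)
qed

lemma op_positive_dual: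
  assumes U: "U \<in> adjointable dual"
    and pos: "\<And>x. x \<in> carrier M \<Longrightarrow> D.s (U (hat M x)) (hat M x) \<in> \<real>\<^sub>\<ge>\<^sub>0"
    and le: "\<And>x. x \<in> carrier M \<Longrightarrow> Re (D.s (U (hat M x)) (hat M x)) \<le> Re (s x x)"
  shows "op_positive dual U"
proof (rule D.op_positive_if_bounded_form[OF U])
  fix \<eta> assume "\<eta> \<in> carrier dual"
  then have "\<eta> \<in> dual_carrier M" by simp
  from dual_form_hat[OF this] obtain x where x: "x \<in> carrier M" "D.s \<eta> \<eta> = s x x"
    "\<And>T. T \<in> adjointable dual \<Longrightarrow> D.s (T \<eta>) \<eta> = D.s (T (hat M x)) (hat M x)"
    by metis
  show "D.s (U \<eta>) \<eta> \<in> \<real>\<^sub>\<ge>\<^sub>0" "Re (D.s (U \<eta>) \<eta>) \<le> Re (D.s \<eta> \<eta>)"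
    using x pos[OF x(1)] le[OF x(1)] U by auto
qed

end

section \<open>Completely positive maps as positive forms\<close>

text \<open>The semi-inner product of the Stinespring space \<open>A \<otimes> H\<close> of \<open>\<psi>\<close>, evaluated on
  \<open>\<Sum> a \<otimes> b w\<close> and \<open>\<Sum> a' \<otimes> b' w\<close> where \<open>w\<close> is \<^const>\<open>unit_vec\<close>.\<close>

definition cp_form :: "('a::unital_cstar_algebra \<Rightarrow> 'h::complex_hilbert bop) \<Rightarrow>
    ('a \<times> 'h bop) list \<Rightarrow> ('a \<times> 'h bop) list \<Rightarrow> complex"
  where "cp_form \<psi> l m =
    (\<Sum>p\<leftarrow>l. \<Sum>q\<leftarrow>m. cinner (\<psi> (star (fst q) * fst p) (bop_apply (snd p) unit_vec)) (bop_apply (snd q) unit_vec))"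

lemma cp_form_simps [simp]:
  "cp_form \<psi> [] m = 0"
  "cp_form \<psi> l [] = 0"
  by (simp_all add: cp_form_def)

lemma cp_form_append [simp]:
  "cp_form \<psi> (l @ l') m = cp_form \<psi> l m + cp_form \<psi> l' m"
  "cp_form \<psi> l (m @ m') = cp_form \<psi> l m + cp_form \<psi> l m'"
  by (simp_all add: cp_form_def sum_list_addf)

lemma cp_form_Cons: "cp_form \<psi> (p # l) m = cp_form \<psi> [p] m + cp_form \<psi> l m"
  using cp_form_append(1)[of \<psi> "[p]" l m] by simp

lemma cp_form_Cons_right: "cp_form \<psi> l (q # m) = cp_form \<psi> l [q] + cp_form \<psi> l m"
  using cp_form_append(2)[of \<psi> l "[q]" m] by simp

lemma cp_form_single:
  "cp_form \<psi> [p] [q] = cinner (\<psi> (star (fst q) * fst p) (bop_apply (snd p) unit_vec)) (bop_apply (snd q) unit_vec)"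
  by (simp add: cp_form_def)

lemma cp_form_diff: "cp_form (\<lambda>a. \<psi> a - \<psi>' a) l m = cp_form \<psi> l m - cp_form \<psi>' l m"
  by (simp add: cp_form_def cinner_simps sum_list_subtractf)

definition scale_list :: "complex \<Rightarrow> ('a::unital_cstar_algebra \<times> 'b) list \<Rightarrow> ('a \<times> 'b) list"
  where "scale_list c l = map (\<lambda>(a, b). (c *\<^sub>C a, b)) l"

lemma complex_linear_zero:
  assumes "complex_linear \<psi>"
  shows "\<psi> 0 = 0"
proof -
  have "\<psi> (0 + 0) = \<psi> 0 + \<psi> 0"
    using assms unfolding complex_linear_def by blast
  then show ?thesis by simp
qed

lemma complex_linear_sum: "complex_linear \<psi> \<Longrightarrow> \<psi> (\<Sum>i\<in>I. f i) = (\<Sum>i\<in>I. \<psi> (f i))"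
  by (induction I rule: infinite_finite_induct) (auto simp: complex_linear_zero complex_linear_def)

lemma cp_form_scale:
  assumes "complex_linear \<psi>"
  shows "cp_form \<psi> (scale_list c l) m = c * cp_form \<psi> l m"
    and "cp_form \<psi> l (scale_list c m) = cnj c * cp_form \<psi> l m"
  using assms
  by (simp_all add: cp_form_def scale_list_def complex_linear_def scaleC_mult_right scaleC_mult_left
      star_scaleC cinner_simps case_prod_beta o_def sum_list_const_mult)

lemma cp_form_nth:
  "cp_form \<psi> l m = (\<Sum>j<length l. \<Sum>i<length m.
    cinner (\<psi> (star (fst (m ! i)) * fst (l ! j)) (bop_apply (snd (l ! j)) unit_vec)) (bop_apply (snd (m ! i)) unit_vec))"
  by (simp add: cp_form_def sum_list_sum_nth atLeast0LessThan)

lemma nonneg_Reals_sum: "(\<And>i. i \<in> I \<Longrightarrow> f i \<in> \<real>\<^sub>\<ge>\<^sub>0) \<Longrightarrow> (\<Sum>i\<in>I. f i) \<in> (\<real>\<^sub>\<ge>\<^sub>0 :: complex set)"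
  by (induction I rule: infinite_finite_induct) auto

lemma star_zero [simp]: "star 0 = (0::'a::unital_cstar_algebra)"
  using star_add[of 0 "0::'a"] by simp

lemma star_one [simp]: "star 1 = (1::'a::unital_cstar_algebra)"
  by (metis mult.right_neutral star_mult star_star)

text \<open>A positive matrix over \<open>A\<close> is the sum, over the rows \<open>k\<close> of a
  factor \<open>x\<close>, of the matrices with entries \<open>star (x k i) * x k j\<close>. Only
  these matrices have to be tested, and each of them produces one value of
  \<open>cp_form\<close>.\<close>

theorem completely_positive_iff_cp_form:
  fixes \<psi> :: "'a::unital_cstar_algebra \<Rightarrow> 'h::complex_hilbert bop"
  assumes lin: "complex_linear \<psi>"
  shows "completely_positive \<psi> \<longleftrightarrow> (\<forall>l. cp_form \<psi> l l \<in> \<real>\<^sub>\<ge>\<^sub>0)"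
proof
  assume cp: "completely_positive \<psi>"
  show "\<forall>l. cp_form \<psi> l l \<in> \<real>\<^sub>\<ge>\<^sub>0"
  proof
    fix l :: "('a \<times> 'h bop) list"
    let ?n = "length l" and ?a = "\<lambda>i. fst (l ! i)" and ?h = "\<lambda>i. bop_apply (snd (l ! i)) unit_vec"
    have "matrix_positive ?n (\<lambda>i j. star (?a i) * ?a j)"
      unfolding matrix_positive_def
    \<comment> \<open>The factor has the single nonzero row 0, which exists because
      \<open>i < ?n\<close>.\<close>
    proof (intro exI[of _ "\<lambda>k i. if k = 0 then ?a i else 0"] allI impI)
      fix i j assume "i < ?n"
      have "(\<Sum>k<?n. star (if k = 0 then ?a i else 0) * (if k = 0 then ?a j else 0)) =
        (\<Sum>k<?n. if k = 0 then star (?a i) * ?a j else 0)"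
        by (intro sum.cong) auto
      also have "\<dots> = star (?a i) * ?a j"
        using \<open>i < ?n\<close> by (subst sum.delta) auto
      finally show "star (?a i) * ?a j = (\<Sum>k<?n. star (if k = 0 then ?a i else 0) * (if k = 0 then ?a j else 0))"
        by simp
    qed
    then have "bop_matrix_positive ?n (\<lambda>i j. \<psi> (star (?a i) * ?a j))"
      using cp unfolding completely_positive_def by blast
    from this[unfolded bop_matrix_positive_def, rule_format, of ?h]
    have "(\<Sum>i<?n. cinner (\<Sum>j<?n. \<psi> (star (?a i) * ?a j) (?h j)) (?h i)) \<in> \<real>\<^sub>\<ge>\<^sub>0" .
    then show "cp_form \<psi> l l \<in> \<real>\<^sub>\<ge>\<^sub>0"
      unfolding cp_form_nth by (subst sum.swap) (simp add: cinner_sum_left)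
  qed
next
  assume pos: "\<forall>l. cp_form \<psi> l l \<in> \<real>\<^sub>\<ge>\<^sub>0"
  have "bop_matrix_positive n (\<lambda>i j. \<psi> (m i j))" if mp: "matrix_positive n m" for n and m :: "nat \<Rightarrow> nat \<Rightarrow> 'a"
    unfolding bop_matrix_positive_def
  proof
    fix h :: "nat \<Rightarrow> 'h"
    obtain x where "\<forall>i<n. \<forall>j<n. m i j = (\<Sum>k<n. star (x k i) * x k j)"
      using mp unfolding matrix_positive_def by blast
    then have x: "m i j = (\<Sum>k<n. star (x k i) * x k j)" if "i < n" "j < n" for i j
      using that by blast
    \<comment> \<open>One list for each row; arbitrary vectors \<open>h j\<close> are reached since
      \<open>ket (h j)\<close> sends \<open>unit_vec\<close> to \<open>h j\<close>.\<close>
    define l where "l k = map (\<lambda>j. (x k j, ket (h j))) [0..<n]" for k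
    have l: "length (l k) = n" "j < n \<Longrightarrow> l k ! j = (x k j, ket (h j))" for k j
      by (simp_all add: l_def)
    have "(\<Sum>i<n. cinner (\<Sum>j<n. \<psi> (m i j) (h j)) (h i)) =
      (\<Sum>i<n. \<Sum>j<n. \<Sum>k<n. cinner (\<psi> (star (x k i) * x k j) (h j)) (h i))"
      by (simp add: cinner_sum_left x complex_linear_sum[OF lin] bop_sum_apply)
    also have "\<dots> = (\<Sum>i<n. \<Sum>k<n. \<Sum>j<n. cinner (\<psi> (star (x k i) * x k j) (h j)) (h i))"
      by (intro sum.cong refl sum.swap)
    also have "\<dots> = (\<Sum>k<n. \<Sum>i<n. \<Sum>j<n. cinner (\<psi> (star (x k i) * x k j) (h j)) (h i))"
      by (rule sum.swap)
    also have "\<dots> = (\<Sum>k<n. \<Sum>j<n. \<Sum>i<n. cinner (\<psi> (star (x k i) * x k j) (h j)) (h i))"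
      by (intro sum.cong refl sum.swap)
    also have "\<dots> = (\<Sum>k<n. cp_form \<psi> (l k) (l k))"
      by (simp add: cp_form_nth l)
    also have "\<dots> \<in> \<real>\<^sub>\<ge>\<^sub>0"
      using pos by (intro nonneg_Reals_sum) auto
    finally show "(\<Sum>i<n. cinner (\<Sum>j<n. \<psi> (m i j) (h j)) (h i)) \<in> \<real>\<^sub>\<ge>\<^sub>0" .
  qed
  then show "completely_positive \<psi>"
    using lin by (auto simp: completely_positive_def)
qed

lemma cp_form_commute:
  assumes "completely_positive \<psi>"
  shows "cp_form \<psi> m l = cnj (cp_form \<psi> l m)"
    and "(cmod (cp_form \<psi> l m))\<^sup>2 \<le> Re (cp_form \<psi> m m) * Re (cp_form \<psi> l l)"
proof -
  have lin: "complex_linear \<psi>" using assms by (simp add: completely_positive_def)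
  have "cp_form \<psi> m m + c * cp_form \<psi> l m + cnj c * cp_form \<psi> m l + c * cnj c * cp_form \<psi> l l \<in> \<real>\<^sub>\<ge>\<^sub>0" for c
    using assms[unfolded completely_positive_iff_cp_form[OF lin], rule_format, of "m @ scale_list c l"]
    by (simp add: cp_form_scale[OF lin] algebra_simps)
  from nonneg_quadratic_form[OF this] show "cp_form \<psi> m l = cnj (cp_form \<psi> l m)"
    "(cmod (cp_form \<psi> l m))\<^sup>2 \<le> Re (cp_form \<psi> m m) * Re (cp_form \<psi> l l)" by auto
qed

section \<open>The Paschke dilation\<close>

text \<open>Stated for families \<open>u\<close>, \<open>v\<close> over an index set because
  \<open>u i \<mapsto> v i\<close> is not known to be a function, and for pseudometrics because
  \<open>s\<close> has null vectors. The one sequence \<open>l\<close> that serves both limits is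
  what later proofs use to carry identities from the family to \<open>f\<close>. It is applied to
  the unitaries in the module norm and to the Radon-Nikodym derivative in the seminorm of
  \<open>s\<close>.\<close>

lemma contraction_extension:
  fixes u :: "'i \<Rightarrow> 'p" and v :: "'i \<Rightarrow> 'q" and d :: "'p \<Rightarrow> 'p \<Rightarrow> real" and d' :: "'q \<Rightarrow> 'q \<Rightarrow> real"
  assumes uS: "\<And>i. u i \<in> S" and vS: "\<And>i. v i \<in> S'"
    and contr: "\<And>i j. d' (v i) (v j) \<le> d (u i) (u j)"
    and tri: "\<And>x y z. \<lbrakk>x \<in> S; y \<in> S; z \<in> S\<rbrakk> \<Longrightarrow> d x y \<le> d x z + d y z"
    and nonneg: "\<And>x y. \<lbrakk>x \<in> S; y \<in> S\<rbrakk> \<Longrightarrow> 0 \<le> d x y"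
    and dense: "\<And>x \<epsilon>. \<lbrakk>x \<in> S; \<epsilon> > 0\<rbrakk> \<Longrightarrow> \<exists>i. d (u i) x < \<epsilon>"
    and complete: "\<And>w. \<lbrakk>\<And>n::nat. w n \<in> S';
        \<And>\<epsilon>. \<epsilon> > 0 \<Longrightarrow> \<exists>N. \<forall>m\<ge>N. \<forall>n\<ge>N. d' (w m) (w n) < \<epsilon>\<rbrakk> \<Longrightarrow>
      \<exists>y\<in>S'. (\<lambda>n. d' (w n) y) \<longlonglongrightarrow> 0"
  shows "\<exists>f. \<forall>x\<in>S. f x \<in> S' \<and>
    (\<exists>l. (\<lambda>n::nat. d (u (l n)) x) \<longlonglongrightarrow> 0 \<and> (\<lambda>n. d' (v (l n)) (f x)) \<longlonglongrightarrow> 0)"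
proof (rule bchoice, rule ballI)
  fix x assume x: "x \<in> S"
  have "\<exists>i. d (u i) x < 1 / real (Suc n)" for n
    using dense[OF x, of "1 / real (Suc n)"] by simp
  then obtain l where l: "\<And>n. d (u (l n)) x < 1 / real (Suc n)" by metis
  have lim: "(\<lambda>n. d (u (l n)) x) \<longlonglongrightarrow> 0"
    by (rule tendsto_sandwich[OF _ _ tendsto_const LIMSEQ_inverse_real_of_nat])
      (auto intro!: always_eventually nonneg uS x less_imp_le[OF l] simp: inverse_eq_divide simp del: of_nat_Suc)
  have "\<exists>y\<in>S'. (\<lambda>n. d' (v (l n)) y) \<longlonglongrightarrow> 0"
  proof (rule complete[OF vS])
    fix \<epsilon> :: real assume "\<epsilon> > 0"
    then obtain N where N: "\<And>n. n \<ge> N \<Longrightarrow> \<bar>d (u (l n)) x\<bar> < \<epsilon> / 2"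
      using LIMSEQ_D[OF lim, of "\<epsilon> / 2"] by auto
    have "d' (v (l m)) (v (l n)) < \<epsilon>" if "m \<ge> N" "n \<ge> N" for m n
      using contr[of "l m" "l n"] tri[OF uS uS x, of "l m" "l n"] N[OF that(1)] N[OF that(2)] by linarith
    then show "\<exists>N. \<forall>m\<ge>N. \<forall>n\<ge>N. d' (v (l m)) (v (l n)) < \<epsilon>" by blast
  qed
  then show "\<exists>y. y \<in> S' \<and> (\<exists>l. (\<lambda>n::nat. d (u (l n)) x) \<longlonglongrightarrow> 0 \<and> (\<lambda>n. d' (v (l n)) y) \<longlonglongrightarrow> 0)"
    using lim by blast
qed

locale paschke = hilbert_module X
  for X :: "('x, 'h::complex_hilbert bop) hmod" +
  fixes \<phi> :: "'a::unital_cstar_algebra \<Rightarrow> 'h bop" and \<sigma> :: "'a \<Rightarrow> 'x \<Rightarrow> 'x" and e :: 'x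
  assumes dilation: "paschke_dilation \<phi> X \<sigma> e"
begin

interpretation D: hilbert_module dual
  by (rule hilbert_module_dual_module)

lemma e_closed [simp]: "e \<in> carrier X"
  using dilation by (simp add: paschke_dilation_def)

lemma \<phi>_eq: "\<phi> a = hip X (\<sigma> a e) e"
  using dilation unfolding paschke_dilation_def by blast

lemma \<sigma>_adjointable [simp]: "\<sigma> a \<in> adjointable X"
  and hadj_\<sigma>: "hadj X (\<sigma> a) = \<sigma> (star a)"
  using dilation by (auto simp: paschke_dilation_def star_representation_def)

lemma
  assumes "x \<in> carrier X"
  shows \<sigma>_add: "\<sigma> (a + b) x = hadd X (\<sigma> a x) (\<sigma> b x)"
    and \<sigma>_scaleC: "\<sigma> (c *\<^sub>C a) x = hscale X c (\<sigma> a x)"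
    and \<sigma>_mult: "\<sigma> (a * b) x = \<sigma> a (\<sigma> b x)"
  using assms dilation by (simp_all add: paschke_dilation_def star_representation_def)

text \<open>Lists of coefficients replace the vectors of the span: the group action and the forms
  below are given by formulas in the coefficients, which need no well-definedness check on
  lists.\<close>

primrec elem :: "('a \<times> 'h bop) list \<Rightarrow> 'x"
  where "elem [] = hzero X"
  | "elem (p # l) = hadd X (\<sigma> (fst p) (hact X e (snd p))) (elem l)"

lemma elem_closed [simp]: "elem l \<in> carrier X"
  by (induction l) auto

lemma elem_append: "elem (l @ m) = hadd X (elem l) (elem m)"
  by (induction l) (auto intro!: ip_eqI simp: ip_left add.assoc)

lemma elem_scale: "elem (scale_list c l) = hscale X c (elem l)"
proof (induction l)
  case Nil
  show ?case by (rule ip_eqI) (auto simp: scale_list_def ip_left)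
next
  case (Cons p l)
  then show ?case
    by (intro ip_eqI) (auto simp: scale_list_def \<sigma>_scaleC ip_left scaleC_add_right case_prod_beta)
qed

lemma \<sigma>_elem: "\<sigma> a (elem l) = elem (map (\<lambda>(a', b). (a * a', b)) l)"
  by (induction l) (auto simp: adjointable_hzero adjointable_hadd \<sigma>_mult case_prod_beta)

lemma hspan_elem: "y \<in> hspan X {\<sigma> a (hact X e b) | a b. True} \<Longrightarrow> \<exists>l. y = elem l"
proof (induction rule: hspan.induct)
  case 1
  show ?case by (rule exI[of _ "[]"]) simp
next
  case (2 x y c)
  then obtain a b l where "x = \<sigma> a (hact X e b)" "y = elem l" by blast
  then show ?case
    by (intro exI[of _ "(c *\<^sub>C a, b) # l"]) (simp add: \<sigma>_scaleC)
qed

lemma elem_dense: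
  assumes "x \<in> carrier X" "\<epsilon> > 0"
  obtains l where "hdist (elem l) x < \<epsilon>"
proof -
  obtain y where y: "y \<in> hspan X {\<sigma> a (hact X e b) | a b. True}" "hdist x y < \<epsilon>"
    using dilation assms unfolding paschke_dilation_def hdense_def by blast
  then obtain l where "y = elem l" using hspan_elem by blast
  then show thesis using y(2) assms by (intro that[of l]) (simp add: hnorm_hdiff_commute)
qed

lemma elem_sequence:
  assumes x: "x \<in> carrier X"
  obtains l where "(\<lambda>n. hdist (elem (l n)) x) \<longlonglongrightarrow> 0"
    "(\<lambda>n. sdist (elem (l n)) x) \<longlonglongrightarrow> 0"
proof -
  have "\<exists>l. hdist (elem l) x < inverse (real (Suc n))" for n
    using elem_dense[OF x, of "inverse (real (Suc n))"] by auto
  then obtain l where l: "\<And>n. hdist (elem (l n)) x < inverse (real (Suc n))" by metis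
  have 1: "(\<lambda>n. hdist (elem (l n)) x) \<longlonglongrightarrow> 0"
    by (rule tendsto_sandwich[OF _ _ tendsto_const LIMSEQ_inverse_real_of_nat])
      (auto intro!: always_eventually less_imp_le[OF l] simp del: of_nat_Suc)
  have "(\<lambda>n. s.seminorm (hdiff X (elem (l n)) x)) \<longlonglongrightarrow> 0"
    using x by (intro tendsto_sandwich[OF _ _ tendsto_const 1] always_eventually) (auto intro!: sn_le_hnorm)
  with 1 show thesis using that by (simp add: hdiff_def)
qed

lemma elem_eqI:
  assumes x: "x \<in> carrier X" and y: "y \<in> carrier X" and eq: "\<And>m. hip X (elem m) x = hip X (elem m) y"
  shows "x = y"
proof (rule ip_eqI_right[OF x y])
  fix z assume z: "z \<in> carrier X"
  obtain l where l: "(\<lambda>n. hdist (elem (l n)) z) \<longlonglongrightarrow> 0"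
    using elem_sequence[OF z] by metis
  show "hip X z x = hip X z y"
    using hip_tendsto_left[OF _ z l x] hip_tendsto_left[OF _ z l y] by (intro LIMSEQ_unique) (auto simp: eq)
qed

text \<open>Density is used on the side of the adjoints: \<open>hadj X S y\<close> is determined by
  its inner products with the dense span, so continuity of \<open>S\<close> and \<open>T\<close>
  does not enter.\<close>

lemma op_eqI_elem:
  assumes S: "S \<in> adjointable X" and T: "T \<in> adjointable X" and eq: "\<And>l. S (elem l) = T (elem l)"
  shows "S = T"
proof -
  have "hadj X S y = hadj X T y" if "y \<in> carrier X" for y
  proof (rule elem_eqI)
    show "hip X (elem m) (hadj X S y) = hip X (elem m) (hadj X T y)" for m
      using that S T eq[of m] by (metis elem_closed ip_hadj)
  qed (use that S T in auto)
  then show ?thesis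
    using S T by (intro op_eqI adjointable_PiE) (auto simp: ip_hadj)
qed

text \<open>A star representation need not be unital by definition; here \<open>\<sigma> 1\<close>
  fixes every generator, and the generators span densely.\<close>

lemma \<sigma>_one: "x \<in> carrier X \<Longrightarrow> \<sigma> 1 x = x"
proof -
  have "\<sigma> 1 = op_one X"
    by (rule op_eqI_elem) (auto simp: \<sigma>_elem case_prod_beta)
  then show "x \<in> carrier X \<Longrightarrow> \<sigma> 1 x = x" by simp
qed

lemma elem_unit: "elem [(1, 1)] = e"
proof -
  have "hact X e 1 = e" by (rule ip_eqI) (auto simp: ip_left)
  then show ?thesis
    by (intro ip_eqI) (auto simp: \<sigma>_one ip_left)
qed

abbreviation (input) \<Phi> where "\<Phi> \<equiv> compressed_map X \<sigma> e"

lemma compressed_map_eq: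
  "\<Phi> T a = hip dual (T (hat X (\<sigma> a e))) (hat X e)"
  by (simp add: compressed_map_def dual_rep_def)

lemma dual_adjointable_closed [simp]:
  "\<lbrakk>T \<in> adjointable dual; \<eta> \<in> dual_carrier X\<rbrakk> \<Longrightarrow> T \<eta> \<in> dual_carrier X"
  using D.adjointable_closed[of T \<eta>] by simp

lemma compressed_map_linear:
  assumes "T \<in> adjointable dual"
  shows "complex_linear (\<Phi> T)"
  unfolding complex_linear_def
proof (intro conjI allI)
  fix a b c
  show "\<Phi> T (a + b) = \<Phi> T a + \<Phi> T b"
    using assms by (simp add: compressed_map_eq \<sigma>_add hat_hadd_dual D.adjointable_hadd D.ip_left)
  show "\<Phi> T (c *\<^sub>C a) = c *\<^sub>C \<Phi> T a"
    using assms by (simp add: compressed_map_eq \<sigma>_scaleC hat_hscale_dual D.adjointable_hscale D.ip_left)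
qed

definition commutes :: "(('x \<Rightarrow> 'h bop) \<Rightarrow> 'x \<Rightarrow> 'h bop) \<Rightarrow> bool"
  where "commutes T \<longleftrightarrow> T \<in> adjointable dual \<and>
    (\<forall>a. op_mult dual T (dual_rep X \<sigma> a) = op_mult dual (dual_rep X \<sigma> a) T)"

lemma commutes_apply:
  assumes "commutes T" "\<eta> \<in> dual_carrier X"
  shows "T (op_extend X (\<sigma> a) \<eta>) = op_extend X (\<sigma> a) (T \<eta>)"
proof -
  have "op_mult dual T (dual_rep X \<sigma> a) \<eta> = op_mult dual (dual_rep X \<sigma> a) T \<eta>"
    using assms by (simp add: commutes_def)
  then show ?thesis using assms(2) by (simp add: dual_rep_def)
qed

text \<open>For single generators, \<open>\<sigma> a'\<close> is moved to the left as
  \<open>\<sigma> (star a')\<close>, carried past \<open>T\<close> by commutation, and multiplied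
  there with \<open>\<sigma> a\<close>. The general case is additivity on both sides.\<close>

lemma s_elem_compressed:
  assumes T: "commutes T"
  shows "D.s (T (hat X (elem l))) (hat X (elem m)) = cp_form (\<Phi> T) l m"
proof -
  have Ta: "T \<in> adjointable dual" using T by (simp add: commutes_def)
  have Tc [simp]: "T (hat X x) \<in> dual_carrier X" if "x \<in> carrier X" for x
    using Ta that by simp
  have single: "D.s (T (hat X (\<sigma> (fst p) (hact X e (snd p))))) (hat X (\<sigma> (fst q) (hact X e (snd q)))) =
    cp_form (\<Phi> T) [p] [q]" for p q
  proof -
    obtain a b a' b' where pq: "p = (a, b)" "q = (a', b')" by (cases p, cases q) auto
    have "D.s (T (hat X (\<sigma> a (hact X e b)))) (hat X (\<sigma> a' (hact X e b')))
      = D.s (T (hat X (\<sigma> a (hact X e b)))) (op_extend X (\<sigma> a') (hat X (hact X e b')))"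
      by simp
    also have "\<dots> = D.s (op_extend X (\<sigma> (star a')) (T (hat X (\<sigma> a (hact X e b))))) (hat X (hact X e b'))"
      by (simp add: D.s_hadj hadj_op_extend hadj_\<sigma> star_star)
    also have "\<dots> = D.s (T (hat X (hact X (\<sigma> (star a' * a) e) b))) (hat X (hact X e b'))"
      by (simp add: commutes_apply[OF T, symmetric] \<sigma>_mult adjointable_hact)
    also have "\<dots> = cinner (bop_adj b' (\<Phi> T (star a' * a) (b unit_vec))) unit_vec"
      by (simp add: hat_hact_dual D.adjointable_hact[OF Ta] D.s_def D.ip_left D.ip_right compressed_map_eq)
    finally show ?thesis
      by (simp add: pq cp_form_single cinner_bop_adj_left)
  qed
  have right: "D.s (T (hat X (\<sigma> (fst p) (hact X e (snd p))))) (hat X (elem m)) =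
    cp_form (\<Phi> T) [p] m" for p m
  proof (induction m)
    case Nil
    then show ?case by (simp add: hat_hzero_dual D.s_def)
  next
    case (Cons q m)
    then show ?case
      by (subst cp_form_Cons_right) (simp add: hat_hadd_dual D.s_simps single)
  qed
  show ?thesis
  proof (induction l)
    case Nil
    then show ?case
      using D.ip_hzero[of "hat X (elem m)"] by (simp add: hat_hzero_dual D.adjointable_hzero[OF Ta] D.s_def)
  next
    case (Cons p l)
    then show ?case
      using right[of p m]
      by (subst cp_form_Cons) (simp add: hat_hadd_dual D.adjointable_hadd[OF Ta] D.s_simps)
  qed
qed

lemma commutes_one: "commutes (op_one dual)"
  unfolding commutes_def dual_rep_def
  by (intro conjI allI D.op_eqI D.adjointable_PiE) auto

lemma compressed_map_one: "\<Phi> (op_one dual) = \<phi>"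
  by (rule ext) (simp add: compressed_map_eq \<phi>_eq ip_hat)

lemma s_elem: "s (elem l) (elem m) = cp_form \<phi> l m"
  using s_elem_compressed[OF commutes_one, of l m] by (simp add: compressed_map_one s_hat)

end

subsection \<open>The unitaries implementing the group action\<close>

locale paschke_action = paschke X \<phi> \<sigma> e + G: group G
  for X :: "('x, 'h::complex_hilbert bop) hmod"
    and \<phi> :: "'a::unital_cstar_algebra \<Rightarrow> 'h bop" and \<sigma> :: "'a \<Rightarrow> 'x \<Rightarrow> 'x" and e :: 'x
    and G :: "('g, 'm) monoid_scheme" +
  fixes \<tau> :: "'g \<Rightarrow> 'a \<Rightarrow> 'a"
  assumes action: "star_action G \<tau>"
    and invariant: "g \<in> carrier G \<Longrightarrow> \<phi> (\<tau> g a) = \<phi> a"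
begin

lemma
  assumes "g \<in> carrier G"
  shows \<tau>_mult: "\<tau> g (a * b) = \<tau> g a * \<tau> g b"
    and \<tau>_star: "\<tau> g (star a) = star (\<tau> g a)"
    and \<tau>_bij: "bij (\<tau> g)"
  using action assms by (auto simp: star_action_def star_automorphism_def)

lemma \<tau>_comp: "\<lbrakk>g \<in> carrier G; h \<in> carrier G\<rbrakk> \<Longrightarrow> \<tau> (g \<otimes>\<^bsub>G\<^esub> h) a = \<tau> g (\<tau> h a)"
  using action by (auto simp: star_action_def)

text \<open>\<open>star_action\<close> contains only multiplicativity; the map at the neutral
  element is idempotent and injective, hence the identity.\<close>

lemma \<tau>_group_one: "\<tau> \<one>\<^bsub>G\<^esub> a = a"
proof -
  have "\<tau> \<one>\<^bsub>G\<^esub> (\<tau> \<one>\<^bsub>G\<^esub> a) = \<tau> \<one>\<^bsub>G\<^esub> a"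
    using \<tau>_comp[of "\<one>\<^bsub>G\<^esub>" "\<one>\<^bsub>G\<^esub>" a] by simp
  then show ?thesis
    using \<tau>_bij[of "\<one>\<^bsub>G\<^esub>"] by (auto simp: bij_def dest: injD)
qed

lemma \<tau>_inv:
  assumes "g \<in> carrier G"
  shows "\<tau> g (\<tau> (inv\<^bsub>G\<^esub> g) a) = a" and "\<tau> (inv\<^bsub>G\<^esub> g) (\<tau> g a) = a"
  using \<tau>_comp[of g "inv\<^bsub>G\<^esub> g" a] \<tau>_comp[of "inv\<^bsub>G\<^esub> g" g a] assms
  by (simp_all add: \<tau>_group_one)

lemma \<tau>_one: "g \<in> carrier G \<Longrightarrow> \<tau> g 1 = 1"
  by (metis \<tau>_inv(1) \<tau>_mult mult.left_neutral mult.right_neutral)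

definition act_list :: "'g \<Rightarrow> ('a \<times> 'h bop) list \<Rightarrow> ('a \<times> 'h bop) list"
  where "act_list g l = map (\<lambda>(a, b). (\<tau> g a, b)) l"

lemma act_list_simps [simp]:
  "act_list g [] = []" "act_list g (p # l) = (\<tau> g (fst p), snd p) # act_list g l"
  by (simp_all add: act_list_def case_prod_beta)

lemma act_list_inv:
  assumes "g \<in> carrier G"
  shows "act_list g (act_list (inv\<^bsub>G\<^esub> g) l) = l" and "act_list (inv\<^bsub>G\<^esub> g) (act_list g l) = l"
  by (induction l) (simp_all add: \<tau>_inv assms)

lemma cp_form_act_list:
  assumes g: "g \<in> carrier G" and inv: "\<And>a. \<psi> (\<tau> g a) = \<psi> a"
  shows "cp_form \<psi> (act_list g l) (act_list g m) = cp_form \<psi> l m"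
  by (simp add: cp_form_def act_list_def o_def case_prod_beta inv flip: \<tau>_star[OF g] \<tau>_mult[OF g])

lemma ip_generators:
  "hip X (\<sigma> a (hact X e b)) (\<sigma> a' (hact X e b')) = bop_adj b' * \<phi> (star a' * a) * b"
proof -
  have "hip X (\<sigma> a (hact X e b)) (\<sigma> a' (hact X e b')) = hip X (\<sigma> (star a') (\<sigma> a (hact X e b))) (hact X e b')"
    by (simp add: ip_hadj hadj_\<sigma> star_star)
  also have "\<dots> = hip X (hact X (\<sigma> (star a' * a) e) b) (hact X e b')"
    by (simp add: \<sigma>_mult adjointable_hact)
  finally show ?thesis
    by (simp add: ip_left ip_right \<phi>_eq mult.assoc)
qed

text \<open>Inner products of generators involve the algebra only through
  \<open>\<phi> (star a' * a)\<close>, which is invariant. The operator-valued version is needed so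
  that the action is isometric in the module norm.\<close>

lemma ip_act_list:
  assumes g: "g \<in> carrier G"
  shows "hip X (elem (act_list g l)) (elem (act_list g m)) = hip X (elem l) (elem m)"
proof -
  have "hip X (\<sigma> (\<tau> g a) (hact X e b)) (elem (act_list g m)) = hip X (\<sigma> a (hact X e b)) (elem m)" for a b
    using g by (induction m) (simp_all add: ip_right ip_generators invariant flip: \<tau>_star \<tau>_mult)
  then show ?thesis
    by (induction l) (simp_all add: ip_left)
qed

lemma ip_act_list_inv:
  assumes g: "g \<in> carrier G"
  shows "hip X (elem (act_list g l)) (elem m) = hip X (elem l) (elem (act_list (inv\<^bsub>G\<^esub> g) m))"
  using ip_act_list[OF g, of l "act_list (inv\<^bsub>G\<^esub> g) m"] g by (simp add: act_list_inv)

lemma ex_extension: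
  assumes g: "g \<in> carrier G"
  shows "\<exists>w. \<forall>x\<in>carrier X. w x \<in> carrier X \<and> (\<exists>l. (\<lambda>n::nat. hdist (elem (l n)) x) \<longlonglongrightarrow> 0 \<and>
    (\<lambda>n. hdist (elem (act_list g (l n))) (w x)) \<longlonglongrightarrow> 0)"
proof (rule contraction_extension)
  show "hdist (elem (act_list g l)) (elem (act_list g m)) \<le> hdist (elem l) (elem m)" for l m
    by (simp add: hnorm_def ip_left ip_right ip_act_list[OF g])
  show "hdist x y \<le> hdist x z + hdist y z"
    if "x \<in> carrier X" "y \<in> carrier X" "z \<in> carrier X" for x y z
    using that hnorm_hdiff_triangle[of x z y] by (simp add: hnorm_hdiff_commute[of z y])
  show "\<exists>l. hdist (elem l) x < \<epsilon>" if x: "x \<in> carrier X" "\<epsilon> > 0" for x \<epsilon>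
    using elem_dense[OF x] by blast
qed (auto intro: hcomplete)

text \<open>This validates the choice in \<open>paschke_unitaries\<close>. The limit map at
  \<open>g\<close> has the one at the inverse of \<open>g\<close> as its adjoint, which makes it
  adjointable; unitarity, multiplicativity and covariance are then identities between lists, by
  \<open>op_eqI_elem\<close>.\<close>

lemma ex_paschke_unitaries:
  "\<exists>W. unitary_representation G X W \<and> (\<forall>g\<in>carrier G. W g e = e \<and>
    (\<forall>a. op_mult X (op_mult X (W g) (\<sigma> a)) (hadj X (W g)) = \<sigma> (\<tau> g a)))"
proof -
  have "\<forall>g\<in>carrier G. \<exists>w. \<forall>x\<in>carrier X. w x \<in> carrier X \<and> (\<exists>l. (\<lambda>n. hdist (elem (l n)) x) \<longlonglongrightarrow> 0 \<and>
    (\<lambda>n. hdist (elem (act_list g (l n))) (w x)) \<longlonglongrightarrow> 0)"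
    using ex_extension by blast
  from bchoice[OF this] obtain w where w: "\<forall>g\<in>carrier G. \<forall>x\<in>carrier X. w g x \<in> carrier X \<and>
    (\<exists>l. (\<lambda>n. hdist (elem (l n)) x) \<longlonglongrightarrow> 0 \<and>
    (\<lambda>n. hdist (elem (act_list g (l n))) (w g x)) \<longlonglongrightarrow> 0)"
    by blast
  have w_elem: "hip X (w g x) (elem m) = hip X x (elem (act_list (inv\<^bsub>G\<^esub> g) m))"
    if g: "g \<in> carrier G" and x: "x \<in> carrier X" for g x m
  proof -
    obtain l where l: "(\<lambda>n. hdist (elem (l n)) x) \<longlonglongrightarrow> 0"
      "(\<lambda>n. hdist (elem (act_list g (l n))) (w g x)) \<longlonglongrightarrow> 0"
      using w g x by blast
    show ?thesis
    proof (rule LIMSEQ_unique)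
      show "(\<lambda>n. hip X (elem (act_list g (l n))) (elem m)) \<longlonglongrightarrow> hip X (w g x) (elem m)"
        using w g x by (intro hip_tendsto_left l) auto
      show "(\<lambda>n. hip X (elem (act_list g (l n))) (elem m)) \<longlonglongrightarrow> hip X x (elem (act_list (inv\<^bsub>G\<^esub> g) m))"
        unfolding ip_act_list_inv[OF g] using x by (intro hip_tendsto_left l) auto
    qed
  qed
  have w_inv: "hip X (w g x) y = hip X x (w (inv\<^bsub>G\<^esub> g) y)"
    if g: "g \<in> carrier G" and xy: "x \<in> carrier X" "y \<in> carrier X" for g x y
  proof -
    obtain m where m: "(\<lambda>n. hdist (elem (m n)) y) \<longlonglongrightarrow> 0"
      "(\<lambda>n. hdist (elem (act_list (inv\<^bsub>G\<^esub> g) (m n))) (w (inv\<^bsub>G\<^esub> g) y)) \<longlonglongrightarrow> 0"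
      using w G.inv_closed[OF g] xy(2) by blast
    show ?thesis
    proof (rule LIMSEQ_unique)
      show "(\<lambda>n. hip X (w g x) (elem (m n))) \<longlonglongrightarrow> hip X (w g x) y"
        using w g xy by (intro hip_tendsto_right m) auto
      show "(\<lambda>n. hip X (w g x) (elem (m n))) \<longlonglongrightarrow> hip X x (w (inv\<^bsub>G\<^esub> g) y)"
        unfolding w_elem[OF g xy(1)] using w G.inv_closed[OF g] xy by (intro hip_tendsto_right m) auto
    qed
  qed
  define W where "W g = (\<lambda>x\<in>carrier X. w g x)" for g
  have W_PiE: "W g \<in> carrier X \<rightarrow>\<^sub>E carrier X" if "g \<in> carrier G" for g
    using w that by (auto simp: W_def)
  have W: "W g \<in> adjointable X" "hadj X (W g) = W (inv\<^bsub>G\<^esub> g)" if g: "g \<in> carrier G" for g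
    using adjointableI[OF W_PiE[OF g] W_PiE[OF G.inv_closed[OF g]]] w_inv[OF g]
    by (auto simp: W_def)
  have W_elem: "W g (elem l) = elem (act_list g l)" if g: "g \<in> carrier G" for g l
  proof (rule elem_eqI)
    fix m
    have "hip X (W g (elem l)) (elem m) = hip X (elem (act_list g l)) (elem m)"
      using w_elem[OF g elem_closed, of l m] ip_act_list_inv[OF g, of l m] by (simp add: W_def)
    then show "hip X (elem m) (W g (elem l)) = hip X (elem m) (elem (act_list g l))"
      using W(1)[OF g] by (metis adjointable_closed elem_closed ip_commute)
  qed (use W(1)[OF g] in auto)
  have "unitary_representation G X W"
    unfolding unitary_representation_def op_unitary_def
  proof (intro conjI ballI)
    fix g assume g: "g \<in> carrier G"
    show "W g \<in> adjointable X" by (rule W(1)[OF g])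
    show "op_mult X (hadj X (W g)) (W g) = op_one X" "op_mult X (W g) (hadj X (W g)) = op_one X"
      by (rule op_eqI_elem; use g W W_elem G.inv_closed[OF g] in \<open>simp add: act_list_inv\<close>)+
    fix h assume h: "h \<in> carrier G"
    have "act_list g (act_list h l) = act_list (g \<otimes>\<^bsub>G\<^esub> h) l" for l
      by (induction l) (simp_all add: \<tau>_comp g h)
    then show "W (g \<otimes>\<^bsub>G\<^esub> h) = op_mult X (W g) (W h)"
      using g h W W_elem by (intro op_eqI_elem) simp_all
  qed
  moreover have "W g e = e" if g: "g \<in> carrier G" for g
    using W_elem[OF g, of "[(1, 1)]"] g by (simp only: elem_unit act_list_simps) (simp add: \<tau>_one elem_unit del: elem.simps)
  moreover have "op_mult X (op_mult X (W g) (\<sigma> a)) (hadj X (W g)) = \<sigma> (\<tau> g a)" if g: "g \<in> carrier G" for g a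
  proof (rule op_eqI_elem)
    fix l
    have "act_list g (map (\<lambda>(a', b). (a * a', b)) (act_list (inv\<^bsub>G\<^esub> g) l)) = map (\<lambda>(a', b). (\<tau> g a * a', b)) l"
      by (induction l) (simp_all add: g \<tau>_mult \<tau>_inv case_prod_beta)
    then show "op_mult X (op_mult X (W g) (\<sigma> a)) (hadj X (W g)) (elem l) = \<sigma> (\<tau> g a) (elem l)"
      using g W G.inv_closed[OF g] by (simp add: W_elem \<sigma>_elem)
  qed (use g W in auto)
  ultimately show ?thesis by blast
qed

definition W :: "'g \<Rightarrow> 'x \<Rightarrow> 'x"
  where "W = paschke_unitaries G \<tau> X \<sigma> e"

lemma
  assumes g: "g \<in> carrier G"
  shows W_adjointable [simp]: "W g \<in> adjointable X"
    and W_unitary: "x \<in> carrier X \<Longrightarrow> hadj X (W g) (W g x) = x" "x \<in> carrier X \<Longrightarrow> W g (hadj X (W g) x) = x"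
    and W_e: "W g e = e"
    and W_\<sigma>: "x \<in> carrier X \<Longrightarrow> W g (\<sigma> a x) = \<sigma> (\<tau> g a) (W g x)"
proof -
  have "unitary_representation G X W \<and> (\<forall>g\<in>carrier G. W g e = e \<and>
    (\<forall>a. op_mult X (op_mult X (W g) (\<sigma> a)) (hadj X (W g)) = \<sigma> (\<tau> g a)))"
    unfolding W_def paschke_unitaries_def by (rule someI_ex[OF ex_paschke_unitaries])
  with g have W: "W g \<in> adjointable X" "op_mult X (hadj X (W g)) (W g) = op_one X"
    "op_mult X (W g) (hadj X (W g)) = op_one X" "W g e = e"
    "\<And>a. op_mult X (op_mult X (W g) (\<sigma> a)) (hadj X (W g)) = \<sigma> (\<tau> g a)"
    unfolding unitary_representation_def op_unitary_def by blast+
  show "W g \<in> adjointable X" "W g e = e" by (fact W)+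
  show *: "hadj X (W g) (W g x) = x" "W g (hadj X (W g) x) = x" if "x \<in> carrier X" for x
    using that fun_cong[OF W(2), of x] fun_cong[OF W(3), of x] by simp_all
  show "W g (\<sigma> a x) = \<sigma> (\<tau> g a) (W g x)" if "x \<in> carrier X"
    using that fun_cong[OF W(5)[of a], of "W g x"] W(1) by (simp add: *)
qed

lemma W_elem: "g \<in> carrier G \<Longrightarrow> W g (elem l) = elem (act_list g l)"
  by (induction l) (simp_all add: adjointable_hzero adjointable_hadd adjointable_hact W_\<sigma> W_e)

end

subsection \<open>The Radon-Nikodym derivative\<close>

context hilbert_module
begin

interpretation D: hilbert_module dual
  by (rule hilbert_module_dual_module)

text \<open>\<open>t\<close> is a mere function, linear modulo null vectors. The formula for
  \<open>T \<eta>\<close> comes from symmetry: the pairing of \<open>x\<close> with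
  \<open>T \<eta>\<close>, applied to \<open>h\<close>, should be that of \<open>t\<close>, at
  \<open>x\<close> twisted by \<open>ket h\<close>, with \<open>\<eta>\<close>, applied to
  \<open>unit_vec\<close>.\<close>

lemma dual_op_of_symmetric_contraction:
  assumes t [simp]: "\<And>x. x \<in> carrier M \<Longrightarrow> t x \<in> carrier M"
    and sym: "\<And>x y. \<lbrakk>x \<in> carrier M; y \<in> carrier M\<rbrakk> \<Longrightarrow> s x (t y) = s (t x) y"
    and contr: "\<And>x. x \<in> carrier M \<Longrightarrow> sn (t x) \<le> sn x"
  obtains T where "T \<in> adjointable dual"
    "\<And>x y. \<lbrakk>x \<in> carrier M; y \<in> carrier M\<rbrakk> \<Longrightarrow> D.s (T (hat M x)) (hat M y) = s (t x) y"
proof -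
  define T where "T = (\<lambda>\<eta>\<in>dual_carrier M. \<lambda>x\<in>carrier M. bop_of (\<lambda>h. bop_apply (\<eta> (t (hact M x (ket h)))) unit_vec))"
  \<comment> \<open>Symmetry of \<open>t\<close> shows that both arguments have the same
    \<open>s\<close>-products with every vector, and \<open>dual_cong_s\<close> turns this into
    equality of the values at \<open>unit_vec\<close>.\<close>
  have t_add: "\<eta> (t (hadd M x y)) unit_vec = \<eta> (t x) unit_vec + \<eta> (t y) unit_vec"
    if "\<eta> \<in> dual_carrier M" "x \<in> carrier M" "y \<in> carrier M" for \<eta> x y
    using that dual_cong_s[OF that(1), of "t (hadd M x y)" "hadd M (t x) (t y)"]
    by (simp add: sym s_simps dual_hadd)
  have t_scale: "\<eta> (t (hscale M c x)) unit_vec = c *\<^sub>C \<eta> (t x) unit_vec"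
    if "\<eta> \<in> dual_carrier M" "x \<in> carrier M" for \<eta> x c
    using that dual_cong_s[OF that(1), of "t (hscale M c x)" "hscale M c (t x)"]
    by (simp add: sym s_simps dual_hscale)
  have bound: "norm (\<eta> (t (hact M x (ket h))) unit_vec) \<le> C * hnorm M x * norm h"
    if \<eta>: "\<eta> \<in> dual_carrier M" and C: "0 \<le> C" "\<And>x. x \<in> carrier M \<Longrightarrow> norm (\<eta> x) \<le> C * hnorm M x"
      and x: "x \<in> carrier M" for \<eta> C x h
  proof -
    have "norm (\<eta> (t (hact M x (ket h))) unit_vec) \<le> C * sn (t (hact M x (ket h)))"
      using x by (intro dual_unit_vec_le[OF \<eta> C]) auto
    also have "\<dots> \<le> C * (hnorm M x * norm h)"
      using x contr[of "hact M x (ket h)"] sn_hact_ket_le[OF x, of h] C(1) by (intro mult_left_mono) auto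
    finally show ?thesis by (simp add: mult.assoc)
  qed
  have T_apply: "T \<eta> x h = \<eta> (t (hact M x (ket h))) unit_vec"
    if \<eta>: "\<eta> \<in> dual_carrier M" and x: "x \<in> carrier M" for \<eta> x h
  proof -
    obtain C where C: "0 \<le> C" "\<And>x. x \<in> carrier M \<Longrightarrow> norm (\<eta> x) \<le> C * hnorm M x"
      using dual_bound[OF \<eta>] by metis
    have "bop_of (\<lambda>h. \<eta> (t (hact M x (ket h))) unit_vec) h = \<eta> (t (hact M x (ket h))) unit_vec"
      using x \<eta> by (intro bop_of_apply[where K = "C * hnorm M x"] bound[OF \<eta> C x])
        (simp_all add: hact_ket_add hact_ket_scaleC t_add t_scale)
    then show ?thesis using \<eta> x by (simp add: T_def)
  qed
  have T_closed: "T \<eta> \<in> dual_carrier M" if \<eta>: "\<eta> \<in> dual_carrier M" for \<eta>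
  proof -
    obtain C where C: "0 \<le> C" "\<And>x. x \<in> carrier M \<Longrightarrow> norm (\<eta> x) \<le> C * hnorm M x"
      using dual_bound[OF \<eta>] by metis
    show ?thesis
    proof (rule dualI[where C = C])
      show "T \<eta> \<in> extensional (carrier M)" using \<eta> by (simp add: T_def)
      fix x y b and c :: complex assume x: "x \<in> carrier M"
      show "T \<eta> (hadd M x y) = T \<eta> x + T \<eta> y" if "y \<in> carrier M"
        using x \<eta> that by (intro bop_eqI) (simp add: T_apply hact_hadd_distrib t_add)
      show "T \<eta> (hscale M c x) = c *\<^sub>C T \<eta> x"
        using x \<eta> by (intro bop_eqI) (simp add: T_apply hact_hscale_distrib t_scale)
      show "T \<eta> (hact M x b) = T \<eta> x * b"
        using x \<eta> by (intro bop_eqI) (simp add: T_apply hact_hact bop_mult_ket)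
      show "norm (T \<eta> x) \<le> C * hnorm M x"
        using x \<eta> C(1) bound[OF \<eta> C x] by (intro norm_bop_le) (simp_all add: T_apply)
    qed
  qed
  have T_PiE: "T \<in> carrier dual \<rightarrow>\<^sub>E carrier dual"
    using T_closed by (auto simp: T_def)
  have T_hact: "hact dual (T \<eta>) (ket h) = T (hact dual \<eta> (ket h))"
    if \<eta>: "\<eta> \<in> dual_carrier M" for \<eta> h
  proof (rule dual_eqI)
    fix x assume x: "x \<in> carrier M"
    show "hact dual (T \<eta>) (ket h) x = T (hact dual \<eta> (ket h)) x"
      using x \<eta> by (intro bop_eqI) (simp add: T_apply, simp add: hact_dual_module T_apply)
  qed (use \<eta> T_closed in auto)
  have right: "D.s (hat M x) (T (hat M y)) = s x (t y)" if "x \<in> carrier M" "y \<in> carrier M" for x y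
    using that sym[of "hact M x (ket unit_vec)" y]
    by (simp add: D.s_def ip_hat T_closed T_apply) (simp flip: s_def)
  have left: "D.s (T (hat M x)) (hat M y) = s (t x) y" if "x \<in> carrier M" "y \<in> carrier M" for x y
    using right[OF that(2,1)] D.s.ip_commute[of "T (hat M x)" "hat M y"] that s.ip_commute[of "t x" y]
    by (simp add: T_closed)
  have T_ip: "hip dual (T \<eta>) \<zeta> = hip dual \<eta> (T \<zeta>)"
    if c: "\<eta> \<in> dual_carrier M" "\<zeta> \<in> dual_carrier M" for \<eta> \<zeta>
  proof (rule bop_eqI_cinner)
    fix h k
    obtain x y where xy: "x \<in> carrier M" "y \<in> carrier M"
      "hact dual \<eta> (ket h) = hat M x" "hact dual \<zeta> (ket k) = hat M y"
      using hact_ket_hat_pair[OF c] by metis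
    have "cinner (hip dual (T \<eta>) \<zeta> h) k = s (t x) y"
      using c T_closed D.s_ket[of "T \<eta>" \<zeta> h k] xy by (simp add: T_hact left)
    moreover have "cinner (hip dual \<eta> (T \<zeta>) h) k = s x (t y)"
      using c T_closed D.s_ket[of \<eta> "T \<zeta>" h k] xy by (simp add: T_hact right)
    ultimately show "cinner (hip dual (T \<eta>) \<zeta> h) k = cinner (hip dual \<eta> (T \<zeta>) h) k"
      using xy by (simp add: sym)
  qed
  have "T \<in> adjointable dual"
    using D.adjointableI(1)[OF T_PiE T_PiE] T_ip by auto
  then show thesis using left that by blast
qed

end

context paschke
begin

interpretation D: hilbert_module dual
  by (rule hilbert_module_dual_module)

text \<open>Dual description of the seminorm: testing against a sequence of span vectors tending to
  \<open>x\<close> gives \<open>s x x \<le> C * sn x\<close> in the limit.\<close>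

lemma sn_le_elem:
  assumes x: "x \<in> carrier X" and C: "0 \<le> C" "\<And>l. cmod (s (elem l) x) \<le> C * sn (elem l)"
  shows "sn x \<le> C"
proof -
  obtain l where l: "(\<lambda>n. sdist (elem (l n)) x) \<longlonglongrightarrow> 0"
    using elem_sequence[OF x] by metis
  have "cmod (s x x) \<le> C * (0 + sn x)"
  proof (rule LIMSEQ_le)
    show "(\<lambda>n. cmod (s (elem (l n)) x)) \<longlonglongrightarrow> cmod (s x x)"
      using x l by (intro tendsto_norm s.ip_tendsto_left) auto
    show "(\<lambda>n. C * (sdist (elem (l n)) x + sn x)) \<longlonglongrightarrow> C * (0 + sn x)"
      by (intro tendsto_intros l)
    have "cmod (s (elem (l n)) x) \<le> C * (sdist (elem (l n)) x + sn x)" for n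
    proof -
      have "elem (l n) = hadd X (hadd X (elem (l n)) (hscale X (-1) x)) x"
        using x by (intro ip_eqI) (auto simp: ip_left)
      then have "sn (elem (l n)) \<le> sdist (elem (l n)) x + sn x"
        using x s.seminorm_triangle[of "hadd X (elem (l n)) (hscale X (-1) x)" x] by simp
      then show ?thesis
        using C mult_left_mono order_trans by blast
    qed
    then show "\<exists>N. \<forall>n\<ge>N. cmod (s (elem (l n)) x) \<le> C * (sdist (elem (l n)) x + sn x)"
      by blast
  qed
  then have "sn x * sn x \<le> C * sn x"
    using x by (simp add: s.ip_self norm_power power2_eq_square norm_mult)
  then show ?thesis
    using C(1) x s.seminorm_nonneg[OF x] by (cases "sn x = 0") (auto simp: mult_le_cancel_right)
qed

text \<open>The vectors \<open>v m\<close> representing \<open>\<theta>\<close> depend contractively on \<^term>\<open>elem m\<close>, so that \<open>elem m \<mapsto> v m\<close> extends to a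
  symmetric contraction of the space \<open>(X, s)\<close>.\<close>

theorem radon_nikodym:
  assumes \<theta>: "completely_positive \<theta>" and le: "cp_le \<theta> \<phi>"
  obtains T where "T \<in> adjointable dual"
    "\<And>l m. D.s (T (hat X (elem l))) (hat X (elem m)) = cp_form \<theta> l m"
proof -
  have lin: "complex_linear \<theta>" using \<theta> by (simp add: completely_positive_def)
  have Re_le: "Re (cp_form \<theta> l l) \<le> (sn (elem l))\<^sup>2" for l
  proof -
    have "complex_linear (\<lambda>a. \<phi> a - \<theta> a)"
      using le by (simp add: cp_le_def completely_positive_def)
    from le[unfolded cp_le_def completely_positive_iff_cp_form[OF this]]
    have "cp_form \<phi> l l - cp_form \<theta> l l \<in> \<real>\<^sub>\<ge>\<^sub>0"
      by (simp add: cp_form_diff)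
    then show ?thesis
      by (simp add: s.seminorm_sq s_elem complex_nonneg_Reals_iff)
  qed
  have nonneg: "0 \<le> Re (cp_form \<theta> l l)" for l
    using \<theta> by (auto simp: completely_positive_iff_cp_form[OF lin] complex_nonneg_Reals_iff)
  have cs: "cmod (cp_form \<theta> l m) \<le> sn (elem l) * sn (elem m)" for l m
  proof (rule power2_le_imp_le)
    have "(cmod (cp_form \<theta> l m))\<^sup>2 \<le> Re (cp_form \<theta> m m) * Re (cp_form \<theta> l l)"
      by (rule cp_form_commute(2)[OF \<theta>])
    also have "\<dots> \<le> (sn (elem m))\<^sup>2 * (sn (elem l))\<^sup>2"
      by (intro mult_mono Re_le nonneg) auto
    finally show "(cmod (cp_form \<theta> l m))\<^sup>2 \<le> (sn (elem l) * sn (elem m))\<^sup>2"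
      by (simp add: power_mult_distrib mult.commute)
  qed simp
  have "\<exists>v\<in>carrier X. \<forall>l. cp_form \<theta> l m = s (elem l) v" for m
  proof -
    have "\<exists>v\<in>carrier X. \<forall>(x, c)\<in>range (\<lambda>l. (elem l, cp_form \<theta> l m)). c = s x v"
    proof (rule s.riesz_relation[OF s_complete, where K = "sn (elem m)"])
      fix x c y d t
      assume "(x, c) \<in> range (\<lambda>l. (elem l, cp_form \<theta> l m))" "(y, d) \<in> range (\<lambda>l. (elem l, cp_form \<theta> l m))"
      then obtain l l' where "x = elem l" "c = cp_form \<theta> l m" "y = elem l'" "d = cp_form \<theta> l' m" by auto
      then show "(hadd X x (hscale X t y), c + t * d) \<in> range (\<lambda>l. (elem l, cp_form \<theta> l m))"
        by (intro image_eqI[where x = "l @ scale_list t l'"]) (auto simp: elem_append elem_scale cp_form_scale[OF lin])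
    qed (use cs in \<open>auto simp: mult.commute\<close>)
    then show ?thesis by auto
  qed
  then obtain v where v [simp]: "\<And>m. v m \<in> carrier X" and cv: "\<And>l m. cp_form \<theta> l m = s (elem l) (v m)"
    by metis
  have cv': "cp_form \<theta> l m = s (v l) (elem m)" for l m
    using cp_form_commute(1)[OF \<theta>, of l m] s.ip_commute[of "v l" "elem m"] by (simp add: cv)
  \<comment> \<open>The difference of \<open>v m\<close> and \<open>v m'\<close> represents the form
    at the concatenated list \<open>m @ scale_list (-1) m'\<close>, so \<open>cs\<close> for that
    list is the contraction estimate.\<close>
  have contr: "sdist (v m) (v m') \<le> sdist (elem m) (elem m')" for m m'
  proof (rule sn_le_elem)
    fix l
    have "s (elem l) (hadd X (v m) (hscale X (-1) (v m'))) = cp_form \<theta> l (m @ scale_list (-1) m')"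
      by (simp add: s_simps cp_form_scale[OF lin] flip: cv)
    then show "cmod (s (elem l) (hadd X (v m) (hscale X (-1) (v m')))) \<le>
        sdist (elem m) (elem m') * sn (elem l)"
      using cs[of l "m @ scale_list (-1) m'"] by (simp add: elem_append elem_scale mult.commute)
  qed auto
  have "\<exists>t. \<forall>x\<in>carrier X. t x \<in> carrier X \<and> (\<exists>l. (\<lambda>n::nat. sdist (elem (l n)) x) \<longlonglongrightarrow> 0 \<and>
    (\<lambda>n. sdist (v (l n)) (t x)) \<longlonglongrightarrow> 0)"
  proof (rule contraction_extension)
    show "sdist (v l) (v m) \<le> sdist (elem l) (elem m)" for l m by (rule contr)
    show "sdist x y \<le> sdist x z + sdist y z"
      if "x \<in> carrier X" "y \<in> carrier X" "z \<in> carrier X" for x y z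
      using that s.seminorm_diff_triangle[of x z y] by (simp add: s.seminorm_diff_commute[of z y])
    show "\<exists>l. sdist (elem l) x < \<epsilon>" if x: "x \<in> carrier X" "\<epsilon> > 0" for x \<epsilon>
    proof -
      obtain l where "hdist (elem l) x < \<epsilon>" using elem_dense[OF x] .
      then show ?thesis
        using sn_le_hnorm[of "hdiff X (elem l) x"] x(1) by (auto simp: hdiff_def intro!: exI[of _ l])
    qed
    show "\<exists>y\<in>carrier X. (\<lambda>n. sdist (w n) y) \<longlonglongrightarrow> 0"
      if "\<And>n. w n \<in> carrier X" "\<And>\<epsilon>. \<epsilon> > 0 \<Longrightarrow> \<exists>N. \<forall>m\<ge>N. \<forall>n\<ge>N. sdist (w m) (w n) < \<epsilon>" for w
      using s_complete that unfolding s.seminorm_complete_def by blast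
  qed auto
  then obtain t where t [simp]: "\<And>x. x \<in> carrier X \<Longrightarrow> t x \<in> carrier X"
    and seq: "\<And>x. x \<in> carrier X \<Longrightarrow> \<exists>l. (\<lambda>n. sdist (elem (l n)) x) \<longlonglongrightarrow> 0 \<and>
    (\<lambda>n. sdist (v (l n)) (t x)) \<longlonglongrightarrow> 0" by metis
  have sym: "s x (t y) = s (t x) y" if xy: "x \<in> carrier X" "y \<in> carrier X" for x y
  proof -
    obtain l where l: "(\<lambda>n. sdist (elem (l n)) x) \<longlonglongrightarrow> 0"
      "(\<lambda>n. sdist (v (l n)) (t x)) \<longlonglongrightarrow> 0"
      using seq[OF xy(1)] by blast
    obtain m where m: "(\<lambda>n. sdist (elem (m n)) y) \<longlonglongrightarrow> 0"
      "(\<lambda>n. sdist (v (m n)) (t y)) \<longlonglongrightarrow> 0"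
      using seq[OF xy(2)] by blast
    have "(\<lambda>n. s (elem (l n)) (v (m n))) \<longlonglongrightarrow> s x (t y)"
      using xy by (intro s.ip_tendsto l m) auto
    moreover have "(\<lambda>n. s (elem (l n)) (v (m n))) \<longlonglongrightarrow> s (t x) y"
      unfolding cv[symmetric] cv' using xy by (intro s.ip_tendsto l m) auto
    ultimately show ?thesis by (rule LIMSEQ_unique)
  qed
  \<comment> \<open>The sequence attached to \<open>elem l\<close> need not be constant, and
    \<open>t (elem l)\<close> need not be \<open>v l\<close>; the values of the form agree
    nevertheless.\<close>
  have t_elem: "s (t (elem l)) (elem m) = cp_form \<theta> l m" for l m
  proof -
    obtain l' where l': "(\<lambda>n. sdist (elem (l' n)) (elem l)) \<longlonglongrightarrow> 0"
      "(\<lambda>n. sdist (v (l' n)) (t (elem l))) \<longlonglongrightarrow> 0"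
      using seq[OF elem_closed] by blast
    have "(\<lambda>n. cp_form \<theta> (l' n) m) \<longlonglongrightarrow> s (t (elem l)) (elem m)"
      unfolding cv' by (intro s.ip_tendsto_left l') auto
    moreover have "(\<lambda>n. cp_form \<theta> (l' n) m) \<longlonglongrightarrow> s (elem l) (v m)"
      unfolding cv by (intro s.ip_tendsto_left l') auto
    ultimately show ?thesis
      unfolding cv by (rule LIMSEQ_unique)
  qed
  have v_le: "sn (v l) \<le> sn (elem l)" for l
    using cs[of _ l] by (intro sn_le_elem) (auto simp: cv mult.commute)
  have t_le: "sn (t x) \<le> sn x" if x: "x \<in> carrier X" for x
  proof -
    obtain l where l: "(\<lambda>n. sdist (elem (l n)) x) \<longlonglongrightarrow> 0"
      "(\<lambda>n. sdist (v (l n)) (t x)) \<longlonglongrightarrow> 0"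
      using seq[OF x] by blast
    have "Re (s (t x) (t x)) \<le> Re (s x x)"
    proof (rule LIMSEQ_le)
      show "(\<lambda>n. Re (s (v (l n)) (v (l n)))) \<longlonglongrightarrow> Re (s (t x) (t x))"
        using x by (intro tendsto_Re s.ip_tendsto l) auto
      show "(\<lambda>n. Re (s (elem (l n)) (elem (l n)))) \<longlonglongrightarrow> Re (s x x)"
        using x by (intro tendsto_Re s.ip_tendsto l) auto
      show "\<exists>N. \<forall>n\<ge>N. Re (s (v (l n)) (v (l n))) \<le> Re (s (elem (l n)) (elem (l n)))"
        using v_le by (auto simp: power_mono simp flip: s.seminorm_sq)
    qed
    then show ?thesis by (simp add: s.seminorm_def)
  qed
  obtain T where T: "T \<in> adjointable dual"
    "\<And>x y. \<lbrakk>x \<in> carrier X; y \<in> carrier X\<rbrakk> \<Longrightarrow> D.s (T (hat X x)) (hat X y) = s (t x) y"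
    using dual_op_of_symmetric_contraction[OF t sym t_le] by metis
  show thesis
    by (rule that[OF T(1)]) (simp add: T(2) t_elem)
qed

end

subsection \<open>The order isomorphism\<close>

context paschke
begin

interpretation D: hilbert_module dual
  by (rule hilbert_module_dual_module)

text \<open>The sequence is fixed before \<open>T\<close>, so several operators can be compared
  along it. Convergence of the images rests on the boundedness of adjointable operators on
  \<open>X'\<close>.\<close>

lemma hat_elem_sequence:
  assumes x: "x \<in> carrier X"
  obtains l where "\<And>T. T \<in> adjointable dual \<Longrightarrow> (\<lambda>n. D.sdist (T (hat X (elem (l n)))) (T (hat X x))) \<longlonglongrightarrow> 0"
proof -
  obtain l where l: "(\<lambda>n. hdist (elem (l n)) x) \<longlonglongrightarrow> 0"
    using elem_sequence[OF x] by metis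
  have "(\<lambda>n. D.s.seminorm (hdiff dual (T (hat X (elem (l n)))) (T (hat X x)))) \<longlonglongrightarrow> 0"
    if T: "T \<in> adjointable dual" for T
  proof -
    obtain C where C: "\<And>\<eta>. \<eta> \<in> dual_carrier X \<Longrightarrow> hnorm dual (T \<eta>) \<le> C * hnorm dual \<eta>"
      using D.adjointable_bounded[OF T] by (metis carrier_dual_module)
    have le: "D.s.seminorm (hdiff dual (T (hat X y)) (T (hat X x))) \<le> C * hdist y x"
      if y: "y \<in> carrier X" for y
    proof -
      have "hdiff dual (T (hat X y)) (T (hat X x)) = T (hat X (hdiff X y x))"
        using x y T by (simp add: hdiff_def hat_hadd_dual hat_hscale_dual D.adjointable_hadd D.adjointable_hscale)
      then have "D.s.seminorm (hdiff dual (T (hat X y)) (T (hat X x))) \<le> hnorm dual (T (hat X (hdiff X y x)))"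
        using x y T by (simp add: D.sn_le_hnorm)
      also have "\<dots> \<le> C * hnorm dual (hat X (hdiff X y x))"
        using x y by (intro C) simp
      also have "hnorm dual (hat X (hdiff X y x)) = hdist y x"
        using x y by (simp add: hnorm_def ip_hat)
      finally show ?thesis .
    qed
    have "(\<lambda>n. C * hdist (elem (l n)) x) \<longlonglongrightarrow> 0"
      using l by (rule tendsto_mult_right_zero)
    then show ?thesis
      using x T by (rule_tac tendsto_sandwich[OF _ _ tendsto_const])
        (auto intro!: always_eventually le simp: D.s.seminorm_nonneg)
  qed
  then show thesis using that unfolding hdiff_def by blast
qed

lemma s_dual_tendsto:
  assumes x: "x \<in> carrier X" and y: "y \<in> carrier X"
  shows "\<exists>l m. \<forall>T\<in>adjointable dual.
    (\<lambda>n. D.s (T (hat X (elem (l n)))) (hat X (elem (m n)))) \<longlonglongrightarrow> D.s (T (hat X x)) (hat X y)"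
proof -
  obtain l where l: "\<And>T. T \<in> adjointable dual \<Longrightarrow> (\<lambda>n. D.sdist (T (hat X (elem (l n)))) (T (hat X x))) \<longlonglongrightarrow> 0"
    using hat_elem_sequence[OF x] by metis
  obtain m where m: "\<And>T. T \<in> adjointable dual \<Longrightarrow> (\<lambda>n. D.sdist (T (hat X (elem (m n)))) (T (hat X y))) \<longlonglongrightarrow> 0"
    using hat_elem_sequence[OF y] by metis
  have lim: "(\<lambda>n. D.s (T (hat X (elem (l n)))) (hat X (elem (m n)))) \<longlonglongrightarrow> D.s (T (hat X x)) (hat X y)"
    if "T \<in> adjointable dual" for T
  proof (rule D.s.ip_tendsto[OF _ _ l[OF that]])
    show "(\<lambda>n. D.sdist (hat X (elem (m n))) (hat X y)) \<longlonglongrightarrow> 0"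
      using m[OF D.op_one_adjointable] y by simp
  qed (use x y that in simp_all)
  show ?thesis by (intro exI[of _ l] exI[of _ m] ballI lim)
qed

lemma dual_op_eqI_elem:
  assumes S: "S \<in> adjointable dual" and T: "T \<in> adjointable dual"
    and eq: "\<And>l m. D.s (S (hat X (elem l))) (hat X (elem m)) = D.s (T (hat X (elem l))) (hat X (elem m))"
  shows "S = T"
proof (rule dual_op_eqI[OF S T])
  fix x y assume xy: "x \<in> carrier X" "y \<in> carrier X"
  obtain l m where lm: "\<forall>T\<in>adjointable dual.
    (\<lambda>n. D.s (T (hat X (elem (l n)))) (hat X (elem (m n)))) \<longlonglongrightarrow> D.s (T (hat X x)) (hat X y)"
    using s_dual_tendsto[OF xy] by blast
  show "D.s (S (hat X x)) (hat X y) = D.s (T (hat X x)) (hat X y)"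
    using lm[THEN bspec, OF S] lm[THEN bspec, OF T] unfolding eq by (rule LIMSEQ_unique)
qed

lemma dual_form_nonneg_elem:
  assumes T: "T \<in> adjointable dual"
    and pos: "\<And>l. D.s (T (hat X (elem l))) (hat X (elem l)) \<in> \<real>\<^sub>\<ge>\<^sub>0" and x: "x \<in> carrier X"
  shows "D.s (T (hat X x)) (hat X x) \<in> \<real>\<^sub>\<ge>\<^sub>0"
proof -
  obtain l where l: "\<And>T. T \<in> adjointable dual \<Longrightarrow> (\<lambda>n. D.sdist (T (hat X (elem (l n)))) (T (hat X x))) \<longlonglongrightarrow> 0"
    using hat_elem_sequence[OF x] by metis
  have "(\<lambda>n. D.s (T (hat X (elem (l n)))) (hat X (elem (l n)))) \<longlonglongrightarrow> D.s (T (hat X x)) (hat X x)"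
  proof (rule D.s.ip_tendsto[OF _ _ l[OF T]])
    show "(\<lambda>n. D.sdist (hat X (elem (l n))) (hat X x)) \<longlonglongrightarrow> 0"
      using l[OF D.op_one_adjointable] x by simp
  qed (use x T in simp_all)
  then show ?thesis
    by (rule Lim_in_closed_set[OF closed_nonneg_Reals_complex always_eventually, rotated 2]) (auto simp: pos)
qed

text \<open>The hypothesis \<open>le\<close> says that \<open>T\<close> is at most 1 on the dense
  span, the normalization under which square roots were constructed.\<close>

lemma op_positive_iff_cp:
  assumes T: "commutes T"
    and le: "\<And>l. Re (cp_form (\<Phi> T) l l) \<le> Re (cp_form \<phi> l l)"
  shows "op_positive dual T \<longleftrightarrow> completely_positive (\<Phi> T)"
proof -
  have Ta: "T \<in> adjointable dual" using T by (simp add: commutes_def)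
  note iff = completely_positive_iff_cp_form[OF compressed_map_linear[OF Ta]]
  show ?thesis
  proof
    assume "op_positive dual T"
    then have "D.s (T (hat X (elem l))) (hat X (elem l)) \<in> \<real>\<^sub>\<ge>\<^sub>0" for l
      using D.op_positive_ip[of T "hat X (elem l)"] by (simp add: D.s_def bop_positive_def)
    then show "completely_positive (\<Phi> T)"
      by (simp add: iff s_elem_compressed[OF T])
  next
    assume "completely_positive (\<Phi> T)"
    then have pos: "D.s (T (hat X (elem l))) (hat X (elem l)) \<in> \<real>\<^sub>\<ge>\<^sub>0" for l
      by (simp add: iff s_elem_compressed[OF T])
    show "op_positive dual T"
    proof (rule op_positive_dual[OF Ta])
      fix x assume x: "x \<in> carrier X"
      show "D.s (T (hat X x)) (hat X x) \<in> \<real>\<^sub>\<ge>\<^sub>0"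
        by (rule dual_form_nonneg_elem[OF Ta pos x])
      \<comment> \<open>The upper bound passes from the span to all of \<open>X\<close> as
        nonnegativity of the form of \<open>1 - T\<close>, which is a closed condition.\<close>
      let ?U = "op_add dual (op_one dual) (op_scale dual (-1) T)"
      have "D.s (?U (hat X x)) (hat X x) \<in> \<real>\<^sub>\<ge>\<^sub>0"
      proof (rule dual_form_nonneg_elem[OF _ _ x])
        show "?U \<in> adjointable dual" using Ta by simp
        fix l
        have "D.s (?U (hat X (elem l))) (hat X (elem l)) = cp_form \<phi> l l - cp_form (\<Phi> T) l l"
          using Ta by (simp add: D.s_simps s_hat s_elem s_elem_compressed[OF T])
        moreover have "Im (cp_form \<phi> l l) = 0"
          using s.ip_self_nonneg[OF elem_closed, of l] by (simp add: s_elem complex_nonneg_Reals_iff)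
        ultimately show "D.s (?U (hat X (elem l))) (hat X (elem l)) \<in> \<real>\<^sub>\<ge>\<^sub>0"
          using le[of l] pos[of l] by (simp add: complex_nonneg_Reals_iff s_elem_compressed[OF T])
      qed
      then show "Re (D.s (T (hat X x)) (hat X x)) \<le> Re (s x x)"
        using x Ta by (simp add: D.s_simps s_hat complex_nonneg_Reals_iff)
    qed
  qed
qed

lemma commutesI_diff:
  assumes "commutes S" "commutes T"
  shows "commutes (op_add dual S (op_scale dual c T))"
  unfolding commutes_def dual_rep_def
proof (intro conjI allI)
  have ad: "S \<in> adjointable dual" "T \<in> adjointable dual"
    using assms by (auto simp: commutes_def)
  then show "op_add dual S (op_scale dual c T) \<in> adjointable dual" by simp
  fix a
  show "op_mult dual (op_add dual S (op_scale dual c T)) (op_extend X (\<sigma> a)) =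
    op_mult dual (op_extend X (\<sigma> a)) (op_add dual S (op_scale dual c T))"
  proof (rule D.op_eqI)
    fix \<eta> \<zeta> assume c: "\<eta> \<in> carrier dual" "\<zeta> \<in> carrier dual"
    then show "hip dual (op_mult dual (op_add dual S (op_scale dual c T)) (op_extend X (\<sigma> a)) \<eta>) \<zeta> =
      hip dual (op_mult dual (op_extend X (\<sigma> a)) (op_add dual S (op_scale dual c T)) \<eta>) \<zeta>"
      using ad by (simp add: D.adjointable_hadd[OF op_extend_adjointable] D.adjointable_hscale[OF op_extend_adjointable]
        commutes_apply assms)
  qed (rule D.adjointable_PiE, use ad in simp)+
qed

lemma compressed_map_combine:
  assumes "S \<in> adjointable dual" "T \<in> adjointable dual"
  shows "\<Phi> (op_add dual (op_scale dual b S) (op_scale dual c T)) a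
      = b *\<^sub>C \<Phi> S a + c *\<^sub>C \<Phi> T a"
    and "\<Phi> (op_add dual S (op_scale dual c T)) a
      = \<Phi> S a + c *\<^sub>C \<Phi> T a"
  using assms by (simp_all add: compressed_map_eq D.ip_left)

end

section \<open>The correspondence in the presence of the group\<close>

context paschke_action
begin

interpretation D: hilbert_module dual
  by (rule hilbert_module_dual_module)

definition commutes_action :: "(('x \<Rightarrow> 'h bop) \<Rightarrow> 'x \<Rightarrow> 'h bop) \<Rightarrow> bool"
  where "commutes_action T \<longleftrightarrow> commutes T \<and> (\<forall>g\<in>carrier G.
    op_mult dual T (dual_rep X W g) = op_mult dual (dual_rep X W g) T)"

lemma commutant_eq:
  "commutant dual (range (dual_rep X \<sigma>) \<union> dual_rep X (paschke_unitaries G \<tau> X \<sigma> e) ` carrier G)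
    = {T. commutes_action T}"
  by (auto simp: commutant_def commutes_action_def commutes_def W_def)

lemma W_isometry:
  assumes g: "g \<in> carrier G" and c: "\<eta> \<in> dual_carrier X" "\<zeta> \<in> dual_carrier X"
  shows "hip dual (op_extend X (W g) \<eta>) (op_extend X (W g) \<zeta>) = hip dual \<eta> \<zeta>"
    and "op_extend X (W g) (op_extend X (hadj X (W g)) \<eta>) = \<eta>"
proof -
  have "op_mult dual (op_extend X (hadj X (W g))) (op_extend X (W g)) = op_one dual"
    "op_mult dual (op_extend X (W g)) (op_extend X (hadj X (W g))) = op_one dual"
    by (rule dual_op_eqI; use g in \<open>simp add: W_unitary\<close>)+
  from fun_cong[OF this(1), of \<zeta>] fun_cong[OF this(2), of \<eta>]
  have *: "op_extend X (hadj X (W g)) (op_extend X (W g) \<zeta>) = \<zeta>"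
    "op_extend X (W g) (op_extend X (hadj X (W g)) \<eta>) = \<eta>"
    using c by simp_all
  show "hip dual (op_extend X (W g) \<eta>) (op_extend X (W g) \<zeta>) = hip dual \<eta> \<zeta>"
    using g c by (simp add: D.ip_hadj hadj_op_extend *)
  show "op_extend X (W g) (op_extend X (hadj X (W g)) \<eta>) = \<eta>" by (rule *(2))
qed

lemma commutes_action_apply:
  assumes T: "commutes_action T" and g: "g \<in> carrier G" and \<eta>: "\<eta> \<in> dual_carrier X"
  shows "T (op_extend X (W g) \<eta>) = op_extend X (W g) (T \<eta>)"
proof -
  have "op_mult dual T (dual_rep X W g) = op_mult dual (dual_rep X W g) T"
    using T g by (simp add: commutes_action_def)
  from fun_cong[OF this, of \<eta>] show ?thesis using \<eta> by (simp add: dual_rep_def)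
qed

lemma commutes_actionD:
  assumes "commutes_action T"
  shows "commutes T" and "T \<in> adjointable dual"
  using assms by (auto simp: commutes_action_def commutes_def)

text \<open>Since \<open>W g\<close> fixes \<open>e\<close>, it sends \<open>\<sigma> a e\<close> to
  \<open>\<sigma> (\<tau> g a) e\<close>; it then passes through \<open>T\<close> and cancels
  against the one in front of \<open>hat X e\<close>.\<close>

lemma compressed_map_invariant:
  assumes T: "commutes_action T" and g: "g \<in> carrier G"
  shows "\<Phi> T (\<tau> g a) = \<Phi> T a"
proof -
  note Ta = commutes_actionD(2)[OF T]
  have "hat X (\<sigma> (\<tau> g a) e) = op_extend X (W g) (hat X (\<sigma> a e))"
    using g by (simp add: W_\<sigma> W_e)
  moreover have "hat X e = op_extend X (W g) (hat X e)"
    using g by (simp add: W_e)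
  ultimately have "\<Phi> T (\<tau> g a) =
    hip dual (op_extend X (W g) (T (hat X (\<sigma> a e)))) (op_extend X (W g) (hat X e))"
    using commutes_action_apply[OF T g, of "hat X (\<sigma> a e)"] unfolding compressed_map_eq
    by (metis hat_closed adjointable_closed \<sigma>_adjointable e_closed)
  then show ?thesis
    using W_isometry(1)[OF g, of "T (hat X (\<sigma> a e))" "hat X e"] Ta by (simp add: compressed_map_eq)
qed

text \<open>\<open>op_positive_iff_cp\<close> is needed for \<open>T\<close> and for
  \<open>1 - T\<close>, each time with an upper bound by 1. The two supply each other's bound:
  positivity of \<open>1 - T\<close> bounds \<open>T\<close>, and positivity of \<open>T\<close>
  bounds \<open>1 - T\<close>, in either of the two senses of positivity.\<close>

lemma interval_iff:
  "T \<in> commutant_interval G \<tau> X \<sigma> e \<longleftrightarrow> commutes_action T \<and>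
    completely_positive (\<Phi> T) \<and> completely_positive (\<lambda>a. \<phi> a - \<Phi> T a)"
proof (cases "commutes_action T")
  case True
  let ?N = "dual"
  note T = commutes_actionD[OF True]
  have "op_add ?N T (op_scale ?N (-1) (op_zero ?N)) = T"
    using T(2) by (intro D.op_eqI D.adjointable_PiE) (simp_all add: D.ip_left)
  then have 0: "op_le ?N (op_zero ?N) T \<longleftrightarrow> op_positive ?N T"
    by (simp add: op_le_def)
  let ?U = "op_add ?N (op_one ?N) (op_scale ?N (-1) T)"
  have U: "commutes ?U" "\<Phi> ?U = (\<lambda>a. \<phi> a - \<Phi> T a)"
    using T commutesI_diff[OF commutes_one T(1)] by (auto simp: compressed_map_combine(2) compressed_map_one)
  have pos_iff: "D.s (V (hat X (elem l))) (hat X (elem l)) \<in> \<real>\<^sub>\<ge>\<^sub>0" if "op_positive ?N V" for V l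
    using D.op_positive_ip[OF that, of "hat X (elem l)"] by (simp add: D.s_def bop_positive_def)
  have cpT: "0 \<le> Re (cp_form (\<Phi> T) l l)"
    if "op_positive ?N T \<or> completely_positive (\<Phi> T)" for l
    using that pos_iff[of T l] completely_positive_iff_cp_form[OF compressed_map_linear[OF T(2)]]
    by (auto simp: s_elem_compressed[OF T(1)] complex_nonneg_Reals_iff)
  have cpU: "Re (cp_form (\<Phi> T) l l) \<le> Re (cp_form \<phi> l l)"
    if "op_positive ?N ?U \<or> completely_positive (\<Phi> ?U)" for l
  proof -
    have Ua: "?U \<in> adjointable ?N" using T by simp
    have "cp_form (\<Phi> ?U) l l \<in> \<real>\<^sub>\<ge>\<^sub>0"
      using that pos_iff[of ?U l] completely_positive_iff_cp_form[OF compressed_map_linear[OF Ua]]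
        s_elem_compressed[OF U(1), of l l] by auto
    then show ?thesis by (simp add: U(2) cp_form_diff complex_nonneg_Reals_iff)
  qed
  have "op_positive ?N T \<and> op_positive ?N ?U \<longleftrightarrow>
    completely_positive (\<Phi> T) \<and> completely_positive (\<Phi> ?U)"
    using op_positive_iff_cp[OF T(1)] op_positive_iff_cp[OF U(1)] cpT cpU
    by (auto simp: U(2) cp_form_diff)
  then show ?thesis
    using True 0 by (simp add: commutant_interval_def commutant_eq op_le_def U(2))
qed (simp add: commutant_interval_def commutant_eq)

lemma interval_inj: "inj_on \<Phi> (commutant_interval G \<tau> X \<sigma> e)"
proof (rule inj_onI)
  fix S T
  assume "S \<in> commutant_interval G \<tau> X \<sigma> e" "T \<in> commutant_interval G \<tau> X \<sigma> e"
    and eq: "\<Phi> S = \<Phi> T"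
  then have "commutes_action S" "commutes_action T" by (auto simp: interval_iff)
  note S = commutes_actionD[OF this(1)] and T = commutes_actionD[OF this(2)]
  show "S = T"
    by (rule dual_op_eqI_elem[OF S(2) T(2)]) (simp add: s_elem_compressed S T eq)
qed

text \<open>Left multiplication by \<open>a\<close> has left multiplication by \<open>star a\<close>
  as its adjoint for every such form; this is why an operator representing the form commutes with
  \<open>A\<close>.\<close>

lemma cp_form_mult_left:
  "cp_form \<psi> (map (\<lambda>(a', b). (a * a', b)) l) m = cp_form \<psi> l (map (\<lambda>(a', b). (star a * a', b)) m)"
  by (simp add: cp_form_def o_def case_prod_beta star_mult star_star mult.assoc)

lemma interval_surj:
  assumes "\<theta> \<in> cp_interval \<phi> \<inter> CPG G \<tau>"
  shows "\<exists>T\<in>commutant_interval G \<tau> X \<sigma> e. \<Phi> T = \<theta>"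
proof -
  let ?N = "dual"
  have \<theta>: "completely_positive \<theta>" "cp_le \<theta> \<phi>" "\<And>g a. g \<in> carrier G \<Longrightarrow> \<theta> (\<tau> g a) = \<theta> a"
    using assms by (auto simp: cp_interval_def CPG_def)
  obtain T where Ta: "T \<in> adjointable ?N"
    and T: "\<And>l m. D.s (T (hat X (elem l))) (hat X (elem m)) = cp_form \<theta> l m"
    using radon_nikodym[OF \<theta>(1,2)] by metis
  have "op_mult ?N T (dual_rep X \<sigma> a) = op_mult ?N (dual_rep X \<sigma> a) T" for a
    unfolding dual_rep_def
    by (rule dual_op_eqI_elem)
      (use Ta in \<open>simp_all add: D.s_hadj[of "op_extend X _"] hadj_op_extend hadj_\<sigma> \<sigma>_elem T cp_form_mult_left\<close>)
  then have com: "commutes T" using Ta by (simp add: commutes_def)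
  have "op_mult ?N T (dual_rep X W g) = op_mult ?N (dual_rep X W g) T" if g: "g \<in> carrier G" for g
  proof -
    \<comment> \<open>Invariance of \<open>\<theta>\<close> says that conjugating \<open>T\<close>
      by the unitary does not change its form; multiplying by the unitary then gives
      commutation.\<close>
    have "op_mult ?N (op_extend X (hadj X (W g))) (op_mult ?N T (op_extend X (W g))) = T"
    proof (rule dual_op_eqI_elem)
      show "D.s (op_mult ?N (op_extend X (hadj X (W g))) (op_mult ?N T (op_extend X (W g))) (hat X (elem l))) (hat X (elem m))
        = D.s (T (hat X (elem l))) (hat X (elem m))" for l m
        using Ta g by (simp add: D.s_hadj[of "op_extend X _"] hadj_op_extend W_elem T cp_form_act_list \<theta>(3))
    qed (use Ta g in simp_all)
    then have "op_mult ?N (op_extend X (W g)) T =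
      op_mult ?N (op_extend X (W g)) (op_mult ?N (op_extend X (hadj X (W g))) (op_mult ?N T (op_extend X (W g))))"
      by simp
    also have "\<dots> = op_mult ?N T (op_extend X (W g))"
      using Ta g by (intro D.op_eqI D.adjointable_PiE) (simp_all add: W_isometry(2))
    finally show ?thesis by (simp add: dual_rep_def)
  qed
  with com have ca: "commutes_action T" by (simp add: commutes_action_def)
  have eq: "\<Phi> T = \<theta>"
  proof
    fix a
    show "\<Phi> T a = \<theta> a"
    proof (rule bop_eqI_cinner)
      fix h k
      \<comment> \<open>The unit in the second list and the two kets isolate one matrix coefficient
        of the map at \<open>a\<close>.\<close>
      have "cp_form (\<Phi> T) [(a, ket h)] [(1, ket k)] = cp_form \<theta> [(a, ket h)] [(1, ket k)]"
        using T s_elem_compressed[OF com] by metis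
      then show "cinner (\<Phi> T a h) k = cinner (\<theta> a h) k"
        by (simp add: cp_form_single)
    qed
  qed
  then show ?thesis
    using ca \<theta> by (intro bexI[of _ T]) (auto simp: interval_iff cp_le_def)
qed

theorem affine_order_iso:
  "affine_order_iso_cp dual (commutant_interval G \<tau> X \<sigma> e)
    (cp_interval \<phi> \<inter> CPG G \<tau>) \<Phi>"
  unfolding affine_order_iso_cp_def bij_betw_def
proof (intro conjI ballI interval_inj)
  let ?N = "dual" and ?I = "commutant_interval G \<tau> X \<sigma> e"
  have "\<Phi> ` ?I \<subseteq> cp_interval \<phi> \<inter> CPG G \<tau>"
    by (auto simp: interval_iff cp_interval_def CPG_def cp_le_def compressed_map_invariant)
  moreover have "cp_interval \<phi> \<inter> CPG G \<tau> \<subseteq> \<Phi> ` ?I"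
    using interval_surj by blast
  ultimately show "\<Phi> ` ?I = cp_interval \<phi> \<inter> CPG G \<tau>" by blast
next
  let ?N = "dual" and ?I = "commutant_interval G \<tau> X \<sigma> e"
  fix S T assume S: "S \<in> ?I" and T: "T \<in> ?I"
  then have ca: "commutes_action S" "commutes_action T" by (auto simp: interval_iff)
  note Sc = commutes_actionD[OF ca(1)] and Tc = commutes_actionD[OF ca(2)]
  have cpf: "cp_form (\<Phi> S) l l \<in> \<real>\<^sub>\<ge>\<^sub>0" "cp_form (\<Phi> T) l l \<in> \<real>\<^sub>\<ge>\<^sub>0"
    "cp_form \<phi> l l - cp_form (\<Phi> S) l l \<in> \<real>\<^sub>\<ge>\<^sub>0" "cp_form \<phi> l l - cp_form (\<Phi> T) l l \<in> \<real>\<^sub>\<ge>\<^sub>0" for l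
  proof -
    have cp: "cp_form \<psi> l l \<in> \<real>\<^sub>\<ge>\<^sub>0" if "completely_positive \<psi>" for \<psi> :: "'a \<Rightarrow> 'h bop"
      using that completely_positive_iff_cp_form[of \<psi>] by (auto simp: completely_positive_def[of \<psi>])
    show "cp_form (\<Phi> S) l l \<in> \<real>\<^sub>\<ge>\<^sub>0" "cp_form (\<Phi> T) l l \<in> \<real>\<^sub>\<ge>\<^sub>0"
      "cp_form \<phi> l l - cp_form (\<Phi> S) l l \<in> \<real>\<^sub>\<ge>\<^sub>0" "cp_form \<phi> l l - cp_form (\<Phi> T) l l \<in> \<real>\<^sub>\<ge>\<^sub>0"
      using S T cp by (auto simp: interval_iff simp flip: cp_form_diff)
  qed
  show "op_le ?N S T \<longleftrightarrow> cp_le (\<Phi> S) (\<Phi> T)"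
  proof -
    let ?V = "op_add ?N T (op_scale ?N (-1) S)"
    have V: "\<Phi> ?V = (\<lambda>a. \<Phi> T a - \<Phi> S a)"
      by (rule ext) (simp add: compressed_map_combine(2) Sc Tc)
    \<comment> \<open>\<open>T - S\<close> is at most \<open>T\<close>, because \<open>S\<close> is
      positive, and hence at most 1; this is the normalization required by
      \<open>op_positive_iff_cp\<close>.\<close>
    have "Re (cp_form (\<Phi> ?V) l l) \<le> Re (cp_form \<phi> l l)" for l
      using cpf[of l] by (simp add: V cp_form_diff complex_nonneg_Reals_iff)
    then have "op_positive ?N ?V \<longleftrightarrow> completely_positive (\<Phi> ?V)"
      by (intro op_positive_iff_cp commutesI_diff Sc Tc)
    then show ?thesis by (simp add: op_le_def cp_le_def V)
  qed
  fix t :: real assume t: "t \<in> {0..1}"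
  let ?V = "op_add ?N (op_scale ?N (of_real t) S) (op_scale ?N (of_real (1 - t)) T)"
  have V: "\<Phi> ?V = (\<lambda>a. t *\<^sub>R \<Phi> S a + (1 - t) *\<^sub>R \<Phi> T a)"
    by (rule ext) (simp only: compressed_map_combine(1)[OF Sc(2) Tc(2)] scaleC_of_real)
  have Va: "?V \<in> adjointable ?N" using Sc Tc by simp
  have com: "commutes_action ?V"
    unfolding commutes_action_def commutes_def dual_rep_def
  proof (intro conjI allI ballI)
    show "op_mult ?N ?V (op_extend X (\<sigma> a)) = op_mult ?N (op_extend X (\<sigma> a)) ?V" for a
      using Sc(2) Tc(2)
      by (intro D.op_eqI D.adjointable_PiE) (simp_all add: commutes_apply[OF Sc(1)] commutes_apply[OF Tc(1)]
          D.adjointable_hadd[OF op_extend_adjointable] D.adjointable_hscale[OF op_extend_adjointable])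
    show "op_mult ?N ?V (op_extend X (W g)) = op_mult ?N (op_extend X (W g)) ?V" if "g \<in> carrier G" for g
      using Sc(2) Tc(2) that
      by (intro D.op_eqI D.adjointable_PiE) (simp_all add: commutes_action_apply[OF ca(1)] commutes_action_apply[OF ca(2)]
          D.adjointable_hadd[OF op_extend_adjointable] D.adjointable_hscale[OF op_extend_adjointable])
  qed (rule Va)
  have form: "cp_form (\<Phi> ?V) l l = of_real t * cp_form (\<Phi> S) l l + of_real (1 - t) * cp_form (\<Phi> T) l l" for l
    using commutes_actionD(1)[OF com] Sc Tc
    by (simp add: D.s_simps flip: s_elem_compressed)
  have lin: "complex_linear (\<Phi> ?V)" "complex_linear (\<lambda>a. \<phi> a - \<Phi> ?V a)"
  proof -
    show "complex_linear (\<Phi> ?V)" by (rule compressed_map_linear[OF Va])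
    \<comment> \<open>\<open>\<phi>\<close> is the compressed map of the identity, so it inherits
      linearity.\<close>
    moreover have "complex_linear \<phi>"
      using compressed_map_linear[OF D.op_one_adjointable] by (simp add: compressed_map_one)
    ultimately show "complex_linear (\<lambda>a. \<phi> a - \<Phi> ?V a)"
      by (simp add: complex_linear_def scaleC_diff_right)
  qed
  have "completely_positive (\<Phi> ?V)"
    unfolding completely_positive_iff_cp_form[OF lin(1)] form
    using cpf t by (simp add: complex_nonneg_Reals_iff)
  moreover have "completely_positive (\<lambda>a. \<phi> a - \<Phi> ?V a)"
    unfolding completely_positive_iff_cp_form[OF lin(2)]
  proof
    fix l
    have "cp_form (\<lambda>a. \<phi> a - \<Phi> ?V a) l l = of_real t * (cp_form \<phi> l l - cp_form (\<Phi> S) l l) +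
      of_real (1 - t) * (cp_form \<phi> l l - cp_form (\<Phi> T) l l)"
      unfolding cp_form_diff form by (simp add: algebra_simps)
    then show "cp_form (\<lambda>a. \<phi> a - \<Phi> ?V a) l l \<in> \<real>\<^sub>\<ge>\<^sub>0"
      using cpf(3,4)[of l] t by (simp add: complex_nonneg_Reals_iff)
  qed
  ultimately have "?V \<in> ?I"
    unfolding interval_iff using com by (intro conjI)
  then show "let V = ?V in V \<in> ?I \<and> \<Phi> V = (\<lambda>a. t *\<^sub>R \<Phi> S a + (1 - t) *\<^sub>R \<Phi> T a)"
    unfolding Let_def using V by (intro conjI)
qed

end

theorem lemma4p2:
  fixes G :: "('g, 'm) monoid_scheme"
    and \<tau> :: "'g \<Rightarrow> 'a::unital_cstar_algebra \<Rightarrow> 'a"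
    and \<phi> :: "'a \<Rightarrow> 'h::complex_hilbert bop"
    and X :: "('x, 'h bop) hmod"
    and \<sigma> :: "'a \<Rightarrow> 'x \<Rightarrow> 'x"
    and e :: 'x
  assumes "separable_space (euclidean :: 'a topology)"
    and "separable_space (euclidean :: 'h topology)"
    and "group G"
    and "star_action G \<tau>"
    and "\<phi> \<in> UCPG G \<tau>"
    and "paschke_dilation \<phi> X \<sigma> e"
  shows "affine_order_iso_cp (dual_module X)
      (commutant_interval G \<tau> X \<sigma> e)
      (cp_interval \<phi> \<inter> CPG G \<tau>)
      (compressed_map X \<sigma> e)"
proof -
  interpret group G by fact
  interpret hilbert_module X
    using assms(6) by (simp add: paschke_dilation_def)
  interpret paschke_action X \<phi> \<sigma> e G \<tau>
    using assms(4-6) by unfold_locales (auto simp: UCPG_def CPG_def)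
  show ?thesis by (rule affine_order_iso)
qed

end
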